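(* Suppose that $\overline H=(H_0,H_1)$ is a compatible pair of Hilbert spaces. Then, for $0<\theta<1$, $K_{\theta,2}(\overline H)$ is the unique geometric interpolation space of exponent $\theta$ relative to $\overline H$. (Uniqueness means that any geometric interpolation space of exponent $\theta$ relative to $\overline H$ is equal to $K_{\theta,2}(\overline H)$ with equality, not merely equivalence, of norms.)
   Context: All spaces are complex. A compatible pair of Hilbert spaces $\overline H=(H_0,H_1)$ consists of Hilbert spaces $H_0,H_1$ that are linear subspaces of a larger vector space $V$, such that $\Delta(\overline H):=H_0\cap H_1$ with norm $\max\{\|\phi\|_{H_0},\|\phi\|_{H_1}\}$ and $\Sigma(\overline H):=H_0+H_1$ with norm $\|\phi\|_{\Sigma(\overline H)}=\inf\{\|\phi_0\|_{H_0}+\|\phi_1\|_{H_1}:\phi_j\in H_j,\ \phi_0+\phi_1=\phi\}$ are Banach spaces. No separability, and no density of $\Delta(\overline H)$ in $H_0$ or $H_1$, is assumed. K-method: for $t>0$, $\phi\in\Sigma(\overline H)$, $K(t,\phi):=\inf\{(\|\phi_0\|_{H_0}^2+t^2\|\phi_1\|_{H_1}^2)^{1/2}:\phi_j\in H_j,\ \phi_0+\phi_1=\phi\}$. For $0<\theta<1$, $K_{\theta,2}(\overline H)$ is the set of $\phi\in\Sigma(\overline H)$ for which $\|\phi\|_{K_{\theta,2}(\overline H)}:=N_{\theta,2}\left(\int_0^\infty |t^{-\theta}K(t,\phi)|^2\,\frac{dt}{t}\right)^{1/2}<\infty$, where $N_{\theta,2}:=\big((2/\pi)\sin(\pi\theta)\big)^{1/2}$.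 An intermediate space between $H_0$ and $H_1$ is a Banach space $H$ with $\Delta(\overline H)\subset H\subset\Sigma(\overline H)$, both inclusions continuous. An intermediate space $H$ is a geometric interpolation space of exponent $\theta$ relative to $\overline H$ (for some $0<\theta<1$) if $H$ is a Hilbert space, $\Delta(\overline H)$ is dense in $H$, and the following three conditions hold for linear operators $T$: (i) if $T$ maps $\Delta(\overline H)$ to $\Delta(\overline H)$ and $\|T\phi\|_{H_0}\le\lambda_0\|\phi\|_{H_0}$ and $\|T\phi\|_{H_1}\le\lambda_1\|\phi\|_{H_1}$ for all $\phi\in\Delta(\overline H)$, then $\|T\phi\|_H\le\lambda_0^{1-\theta}\lambda_1^\theta\|\phi\|_H$ for all $\phi\in\Delta(\overline H)$; (ii) if $T$ maps $\Delta(\overline H)$ to $\mathcal H$, for some Hilbert space $\mathcal H$, and $\|T\phi\|_{\mathcal H}\le\lambda_0\|\phi\|_{H_0}$ and $\|T\phi\|_{\mathcal H}\le\lambda_1\|\phi\|_{H_1}$ for all $\phi\in\Delta(\overline H)$, then $\|T\phi\|_{\mathcal H}\le\lambda_0^{1-\theta}\lambda_1^\theta\|\phi\|_H$ for all $\phi\in\Delta(\overline H)$; (iii) if $T$ maps $\mathcal H$ to $\Delta(\overline H)$, for some Hilbert space $\mathcal H$, and $\|T\phi\|_{H_0}\le\lambda_0\|\phi\|_{\mathcal H}$ and $\|T\phi\|_{H_1}\le\lambda_1\|\phi\|_{\mathcal H}$ for all $\phi\in\mathcal H$, then $\|T\phi\|_H\le\lambda_0^{1-\theta}\lambda_1^\theta\|\phi\|_{\mathcal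 H}$ for all $\phi\in\mathcal H$. *)

theory Defs
  imports "HOL-Analysis.Analysis"
begin

text \<open>
  The library's inner product spaces are real and live on whole types.  A complex normed space is
  therefore a carrier set inside an ambient complex vector space (a type \<open>'v\<close> with a scalar
  multiplication \<open>sc\<close>) together with a norm.  The values of the norm outside the carrier carry no
  meaning, so two spaces are compared with \<open>same_space\<close> below, not with record equality.
\<close>

record 'v nspace =
  elems :: "'v set"
  nrm :: "'v \<Rightarrow> real"

definition same_space :: "'v nspace \<Rightarrow> 'v nspace \<Rightarrow> bool" where
  "same_space X Y \<longleftrightarrow> elems X = elems Y \<and> (\<forall>x\<in>elems X. nrm X x = nrm Y x)"

definition normed_on :: "(complex \<Rightarrow> 'v::ab_group_add \<Rightarrow> 'v) \<Rightarrow> 'v nspace \<Rightarrow> bool" where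
  "normed_on sc X \<longleftrightarrow>
     vector_space sc \<and> module.subspace sc (elems X) \<and>
     (\<forall>x\<in>elems X. 0 \<le> nrm X x \<and> (nrm X x = 0 \<longleftrightarrow> x = 0)) \<and>
     (\<forall>c. \<forall>x\<in>elems X. nrm X (sc c x) = cmod c * nrm X x) \<and>
     (\<forall>x\<in>elems X. \<forall>y\<in>elems X. nrm X (x + y) \<le> nrm X x + nrm X y)"

definition banach_on :: "(complex \<Rightarrow> 'v::ab_group_add \<Rightarrow> 'v) \<Rightarrow> 'v nspace \<Rightarrow> bool" where
  "banach_on sc X \<longleftrightarrow>
     normed_on sc X \<and>
     (\<forall>s :: nat \<Rightarrow> 'v. range s \<subseteq> elems X \<longrightarrow>
        (\<forall>e>0. \<exists>M. \<forall>m\<ge>M. \<forall>n\<ge>M. nrm X (s m - s n) < e) \<longrightarrow>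
        (\<exists>l\<in>elems X. (\<lambda>n. nrm X (s n - l)) \<longlonglongrightarrow> 0))"

definition inner_product_on ::
    "(complex \<Rightarrow> 'v::ab_group_add \<Rightarrow> 'v) \<Rightarrow> 'v set \<Rightarrow> ('v \<Rightarrow> 'v \<Rightarrow> complex) \<Rightarrow> bool" where
  "inner_product_on sc S ip \<longleftrightarrow>
     (\<forall>x\<in>S. \<forall>y\<in>S. \<forall>z\<in>S. ip (x + y) z = ip x z + ip y z) \<and>
     (\<forall>c. \<forall>x\<in>S. \<forall>y\<in>S. ip (sc c x) y = c * ip x y) \<and>
     (\<forall>x\<in>S. \<forall>y\<in>S. ip y x = cnj (ip x y)) \<and>
     (\<forall>x\<in>S. x \<noteq> 0 \<longrightarrow> 0 < Re (ip x x))"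

text \<open>
  By polarization the norm determines the inner product, which is therefore not kept as data.
\<close>

definition hilbert_on :: "(complex \<Rightarrow> 'v::ab_group_add \<Rightarrow> 'v) \<Rightarrow> 'v nspace \<Rightarrow> bool" where
  "hilbert_on sc X \<longleftrightarrow>
     banach_on sc X \<and>
     (\<exists>ip. inner_product_on sc (elems X) ip \<and> (\<forall>x\<in>elems X. nrm X x = sqrt (Re (ip x x))))"

definition Delta_space :: "'v nspace \<Rightarrow> 'v nspace \<Rightarrow> 'v nspace" where
  "Delta_space H0 H1 = \<lparr>elems = elems H0 \<inter> elems H1, nrm = (\<lambda>x. max (nrm H0 x) (nrm H1 x))\<rparr>"

definition splittings :: "'v::ab_group_add nspace \<Rightarrow> 'v nspace \<Rightarrow> 'v \<Rightarrow> ('v \<times> 'v) set" where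
  "splittings H0 H1 x = {(x0, x1). x0 \<in> elems H0 \<and> x1 \<in> elems H1 \<and> x0 + x1 = x}"

definition Sigma_space :: "'v::ab_group_add nspace \<Rightarrow> 'v nspace \<Rightarrow> 'v nspace" where
  "Sigma_space H0 H1 =
     \<lparr>elems = {x0 + x1 |x0 x1. x0 \<in> elems H0 \<and> x1 \<in> elems H1},
      nrm = (\<lambda>x. INF (x0, x1) \<in> splittings H0 H1 x. nrm H0 x0 + nrm H1 x1)\<rparr>"

definition compatible_pair ::
    "(complex \<Rightarrow> 'v::ab_group_add \<Rightarrow> 'v) \<Rightarrow> 'v nspace \<Rightarrow> 'v nspace \<Rightarrow> bool" where
  "compatible_pair sc H0 H1 \<longleftrightarrow>
     hilbert_on sc H0 \<and> hilbert_on sc H1 \<and>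
     banach_on sc (Delta_space H0 H1) \<and> banach_on sc (Sigma_space H0 H1)"

definition K_functional :: "'v::ab_group_add nspace \<Rightarrow> 'v nspace \<Rightarrow> real \<Rightarrow> 'v \<Rightarrow> real" where
  "K_functional H0 H1 t x =
     (INF (x0, x1) \<in> splittings H0 H1 x. sqrt ((nrm H0 x0)\<^sup>2 + t\<^sup>2 * (nrm H1 x1)\<^sup>2))"

definition K_integral :: "'v::ab_group_add nspace \<Rightarrow> 'v nspace \<Rightarrow> real \<Rightarrow> 'v \<Rightarrow> ennreal" where
  "K_integral H0 H1 \<theta> x =
     (\<integral>\<^sup>+t\<in>{0<..}. ennreal (\<bar>t powr (-\<theta>) * K_functional H0 H1 t x\<bar>\<^sup>2 / t) \<partial>lborel)"

definition K_norm_const :: "real \<Rightarrow> real" where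
  "K_norm_const \<theta> = sqrt (2 / pi * sin (pi * \<theta>))"

definition K_space :: "'v::ab_group_add nspace \<Rightarrow> 'v nspace \<Rightarrow> real \<Rightarrow> 'v nspace" where
  "K_space H0 H1 \<theta> =
     \<lparr>elems = {x \<in> elems (Sigma_space H0 H1). K_integral H0 H1 \<theta> x < \<infinity>},
      nrm = (\<lambda>x. K_norm_const \<theta> * sqrt (enn2real (K_integral H0 H1 \<theta> x)))\<rparr>"

definition continuous_inclusion :: "'v::ab_group_add nspace \<Rightarrow> 'v nspace \<Rightarrow> bool" where
  "continuous_inclusion X Y \<longleftrightarrow>
     elems X \<subseteq> elems Y \<and>
     (\<forall>x\<in>elems X. \<forall>e>0. \<exists>d>0. \<forall>y\<in>elems X. nrm X (y - x) < d \<longrightarrow> nrm Y (y - x) < e)"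

definition dense_in_space :: "'v::ab_group_add set \<Rightarrow> 'v nspace \<Rightarrow> bool" where
  "dense_in_space D X \<longleftrightarrow>
     D \<subseteq> elems X \<and> (\<forall>x\<in>elems X. \<forall>e>0. \<exists>y\<in>D. nrm X (x - y) < e)"

definition intermediate_space ::
    "(complex \<Rightarrow> 'v::ab_group_add \<Rightarrow> 'v) \<Rightarrow> 'v nspace \<Rightarrow> 'v nspace \<Rightarrow> 'v nspace \<Rightarrow> bool" where
  "intermediate_space sc H0 H1 H \<longleftrightarrow>
     banach_on sc H \<and>
     continuous_inclusion (Delta_space H0 H1) H \<and> continuous_inclusion H (Sigma_space H0 H1)"

definition linear_between ::
    "(complex \<Rightarrow> 'a::ab_group_add \<Rightarrow> 'a) \<Rightarrow> 'a set \<Rightarrow>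
     (complex \<Rightarrow> 'b::ab_group_add \<Rightarrow> 'b) \<Rightarrow> 'b set \<Rightarrow> ('a \<Rightarrow> 'b) \<Rightarrow> bool" where
  "linear_between sa A sb B T \<longleftrightarrow>
     T ` A \<subseteq> B \<and>
     (\<forall>x\<in>A. \<forall>y\<in>A. T (x + y) = T x + T y) \<and>
     (\<forall>c. \<forall>x\<in>A. T (sa c x) = sb c (T x))"

text \<open>
  Operators are functions on the whole ambient type, of which only the restriction to the domain
  (\<open>\<Delta>\<close> in the first two conditions, the Hilbert space \<open>G\<close> in the third) is used.
  The bounds \<open>l0\<close>, \<open>l1\<close> are nonnegative, as is implicit in the use of real powers; note that
  \<open>0 powr a = 0\<close>.
\<close>

definition geo_cond_endo ::
    "(complex \<Rightarrow> 'v::ab_group_add \<Rightarrow> 'v) \<Rightarrow> 'v nspace \<Rightarrow> 'v nspace \<Rightarrow> real \<Rightarrow> 'v nspace \<Rightarrow> bool" where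
  "geo_cond_endo sc H0 H1 \<theta> H \<longleftrightarrow>
     (let D = elems (Delta_space H0 H1) in
      \<forall>T l0 l1. 0 \<le> l0 \<longrightarrow> 0 \<le> l1 \<longrightarrow> linear_between sc D sc D T \<longrightarrow>
        (\<forall>x\<in>D. nrm H0 (T x) \<le> l0 * nrm H0 x) \<longrightarrow>
        (\<forall>x\<in>D. nrm H1 (T x) \<le> l1 * nrm H1 x) \<longrightarrow>
        (\<forall>x\<in>D. nrm H (T x) \<le> l0 powr (1 - \<theta>) * l1 powr \<theta> * nrm H x))"

definition geo_cond_from ::
    "(complex \<Rightarrow> 'h::ab_group_add \<Rightarrow> 'h) \<Rightarrow> 'h nspace \<Rightarrow>
     (complex \<Rightarrow> 'v::ab_group_add \<Rightarrow> 'v) \<Rightarrow> 'v nspace \<Rightarrow> 'v nspace \<Rightarrow> real \<Rightarrow> 'v nspace \<Rightarrow> bool" where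
  "geo_cond_from sg G sc H0 H1 \<theta> H \<longleftrightarrow>
     (let D = elems (Delta_space H0 H1) in
      \<forall>T l0 l1. 0 \<le> l0 \<longrightarrow> 0 \<le> l1 \<longrightarrow> linear_between sc D sg (elems G) T \<longrightarrow>
        (\<forall>x\<in>D. nrm G (T x) \<le> l0 * nrm H0 x) \<longrightarrow>
        (\<forall>x\<in>D. nrm G (T x) \<le> l1 * nrm H1 x) \<longrightarrow>
        (\<forall>x\<in>D. nrm G (T x) \<le> l0 powr (1 - \<theta>) * l1 powr \<theta> * nrm H x))"

definition geo_cond_into ::
    "(complex \<Rightarrow> 'h::ab_group_add \<Rightarrow> 'h) \<Rightarrow> 'h nspace \<Rightarrow>
     (complex \<Rightarrow> 'v::ab_group_add \<Rightarrow> 'v) \<Rightarrow> 'v nspace \<Rightarrow> 'v nspace \<Rightarrow> real \<Rightarrow> 'v nspace \<Rightarrow> bool" where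
  "geo_cond_into sg G sc H0 H1 \<theta> H \<longleftrightarrow>
     (let D = elems (Delta_space H0 H1) in
      \<forall>T l0 l1. 0 \<le> l0 \<longrightarrow> 0 \<le> l1 \<longrightarrow> linear_between sg (elems G) sc D T \<longrightarrow>
        (\<forall>x\<in>elems G. nrm H0 (T x) \<le> l0 * nrm G x) \<longrightarrow>
        (\<forall>x\<in>elems G. nrm H1 (T x) \<le> l1 * nrm G x) \<longrightarrow>
        (\<forall>x\<in>elems G. nrm H (T x) \<le> l0 powr (1 - \<theta>) * l1 powr \<theta> * nrm G x))"

text \<open>
  A formula cannot quantify over types, so the type \<open>'h\<close> in which the auxiliary Hilbert spaces \<open>G\<close>
  live is a parameter; \<open>G\<close> ranges over all Hilbert spaces carried by a subspace of \<open>'h\<close> under any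
  complex vector space structure on \<open>'h\<close>.  Taking \<open>'h = 'v\<close> loses nothing: in the condition for
  operators into \<open>G\<close> one may replace \<open>G\<close> by the closure of the range of \<open>T\<close>, and in the one for
  operators out of \<open>G\<close> one may replace \<open>G\<close> by the orthogonal complement of the kernel of \<open>T\<close>; either
  is isometric to a Hilbert space carried by a subspace of \<open>\<Delta>\<close>.
\<close>

definition geometric_interpolation_space ::
    "'h::ab_group_add itself \<Rightarrow> (complex \<Rightarrow> 'v::ab_group_add \<Rightarrow> 'v) \<Rightarrow>
     'v nspace \<Rightarrow> 'v nspace \<Rightarrow> real \<Rightarrow> 'v nspace \<Rightarrow> bool" where
  "geometric_interpolation_space (_ :: 'h itself) sc H0 H1 \<theta> H \<longleftrightarrow>
     0 < \<theta> \<and> \<theta> < 1 \<and>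
     intermediate_space sc H0 H1 H \<and>
     hilbert_on sc H \<and>
     dense_in_space (elems (Delta_space H0 H1)) H \<and>
     geo_cond_endo sc H0 H1 \<theta> H \<and>
     (\<forall>(sg :: complex \<Rightarrow> 'h \<Rightarrow> 'h) G. hilbert_on sg G \<longrightarrow> geo_cond_from sg G sc H0 H1 \<theta> H) \<and>
     (\<forall>(sg :: complex \<Rightarrow> 'h \<Rightarrow> 'h) G. hilbert_on sg G \<longrightarrow> geo_cond_into sg G sc H0 H1 \<theta> H)"

end

theory Submission
  imports Defs
begin

text \<open>
  Existence: \<open>K(t, \<cdot>)\<^sup>2\<close> is an infimum of squared Hilbert norms over an affine family and so satisfies the
  parallelogram law, which integration preserves.  The three operator bounds come from splitting
  \<open>T\<phi>\<close> along a splitting of \<open>\<phi>\<close> and from \<open>\<integral> t\<^sup>1\<^sup>-\<^sup>2\<^sup>\<theta> / (a\<^sup>2 + b\<^sup>2 t\<^sup>2) dt = N\<^sup>-\<^sup>2 a\<^sup>-\<^sup>2\<^sup>\<theta> b\<^sup>2\<^sup>\<theta>\<^sup>-\<^sup>2\<close>, with \<open>N\<close> the normalisation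
  constant.

  Uniqueness, without a spectral theorem: give \<open>\<Delta>\<close> the inner product
  \<open>(x, y)\<^sub>\<Delta> = (x, y)\<^sub>0 + (x, y)\<^sub>1\<close> and let \<open>A\<close> be the operator with \<open>(Ax, y)\<^sub>\<Delta> = (x, y)\<^sub>0\<close>, so that \<open>0 \<le> A \<le> 1\<close>.
  Condition (i), applied to \<open>1 + isA\<close>, makes \<open>A\<close> symmetric for the form \<open>h\<close> of any geometric
  interpolation space.  Conditions (iii) and (ii), for operators of rank one, put \<open>h\<close> below every
  tangent of \<open>w(a) = a\<^sup>1\<^sup>-\<^sup>\<theta> (1 - a)\<^sup>\<theta>\<close> evaluated at \<open>A\<close> and above cubic minorants touching \<open>w\<close> at the same
  points.  For the difference \<open>E\<close> of two such forms this gives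
  \<open>E(x, x) \<le> (r (1 - r))\<^sup>-\<^sup>2 \<parallel>(A - r) x\<parallel>\<^sub>\<Delta>\<^sup>2\<close> for all \<open>r\<close> in \<open>(0, 1)\<close>.  Summed over a Bernstein partition of unity in
  \<open>A\<close>, these bounds show that \<open>E\<close> vanishes on the range of \<open>A (1 - A)\<close>, which is dense.
\<close>

section \<open>The integral behind the normalisation constant\<close>

text \<open>In \<Delta> the endpoint norms have the forms of \<open>A\<close> and
  \<open>1 - A\<close>, so every geometric interpolation space ought to carry the form of
  \<open>w(A)\<close>. Lacking a functional calculus, the proof never names this value: it compares
  any two geometric interpolation spaces, and the K-space is one of them. The model is a function e
  on [0, 1] with e(a) \<le> C(r) (a - r)^2 for all r in (0, 1), which is nonpositive inside the
  interval because a = r may be taken. A form cannot be evaluated at a point, so the localisation is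
  done with polynomials in \<open>A\<close>. Multiplying an inequality between forms by such a
  polynomial rests on the positivity of products of commuting positive operators, and E counts as
  commuting with \<open>A\<close> only once \<open>A\<close> is symmetric for both forms; this is
  why (i) has to come first. The constant C(r) blows up as r tends to 0 or 1, which is why the
  conclusion is first reached for vectors \<open>A (1 - A) x\<close>; that these are dense comes
  from the injectivity of \<open>A\<close> and \<open>1 - A\<close>, that is, from the definiteness
  of the two endpoint norms.\<close>

lemma Gamma_reflection_real:
  fixes x :: real
  shows "Gamma x * Gamma (1 - x) = pi / sin (pi * x)"
proof -
  have "complex_of_real (Gamma x * Gamma (1 - x)) = Gamma (of_real x) * Gamma (1 - of_real x)"
    by (simp add: Gamma_complex_of_real[symmetric])
  also have "\<dots> = of_real (pi / sin (pi * x))"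
    by (simp add: Gamma_reflection_complex sin_of_real[symmetric])
  finally show ?thesis by (simp only: of_real_eq_iff)
qed

text \<open>The substitution \<open>u = t\<^sup>2 / (1 + t\<^sup>2)\<close> gives half the Beta
  integral with parameters \<open>1 - \<theta>\<close> and \<open>\<theta>\<close>, which the
  reflection formula evaluates.\<close>

lemma has_integral_powr_over_one_plus_square:
  fixes \<theta> :: real
  assumes "0 < \<theta>" "\<theta> < 1"
  shows "((\<lambda>t. t powr (1 - 2 * \<theta>) / (1 + t\<^sup>2)) has_integral pi / (2 * sin (pi * \<theta>))) {0<..}"
proof -
  define f where "f = (\<lambda>u::real. u powr (- \<theta>) * (1 - u) powr (\<theta> - 1))"
  define g where "g = (\<lambda>t::real. t\<^sup>2 / (1 + t\<^sup>2))"
  define g' where "g' = (\<lambda>t::real. 2 * t / (1 + t\<^sup>2)\<^sup>2)"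
  have pos: "1 + t\<^sup>2 > 0" for t :: real
    by (simp add: add_pos_nonneg)
  have img: "g ` {0<..} = {0<..<1}"
  proof -
    have "u \<in> g ` {0<..}" if "0 < u" "u < 1" for u
    proof
      show "u = g (sqrt (u / (1 - u)))"
        using that by (simp add: g_def field_simps)
    qed (use that in auto)
    moreover have "g t \<in> {0<..<1}" if "t > 0" for t
      using that pos[of t] by (simp add: g_def)
    ultimately show ?thesis by auto
  qed
  have inj: "inj_on g {0<..}"
  proof
    fix s t :: real assume "s \<in> {0<..}" "t \<in> {0<..}" "g s = g t"
    then show "s = t"
      using pos[of s] pos[of t] by (simp add: g_def frac_eq_eq algebra_simps)
  qed
  have der: "(g has_field_derivative g' t) (at t within {0<..})" for t
    unfolding g_def g'_def using pos[of t]
    by (auto intro!: derivative_eq_intros simp: power2_eq_square algebra_simps divide_simps)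
  have "(f has_integral Beta (1 - \<theta>) \<theta>) {0<..<1}"
    using has_integral_Beta_real[of "1 - \<theta>" \<theta>] assms
    by (simp add: f_def has_integral_Icc_iff_Ioo)
  then have "f absolutely_integrable_on g ` {0<..} \<and> integral (g ` {0<..}) f = Beta (1 - \<theta>) \<theta>"
    unfolding img
    by (auto intro!: nonnegative_absolutely_integrable_1 simp: f_def has_integral_iff)
  then have *: "(\<lambda>t. \<bar>g' t\<bar> * f (g t)) absolutely_integrable_on {0<..} \<and>
        integral {0<..} (\<lambda>t. \<bar>g' t\<bar> * f (g t)) = Beta (1 - \<theta>) \<theta>"
    by (subst has_absolute_integral_change_of_variables_1') (auto intro: der inj)
  then have hi: "((\<lambda>t. \<bar>g' t\<bar> * f (g t)) has_integral Beta (1 - \<theta>) \<theta>) {0<..}"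
    by (simp add: has_integral_iff set_lebesgue_integral_eq_integral(1))
  have eq: "\<bar>g' t\<bar> * f (g t) = 2 * (t powr (1 - 2 * \<theta>) / (1 + t\<^sup>2))" if "t > 0" for t
  proof -
    have a: "1 - g t = inverse (1 + t\<^sup>2)"
      using pos[of t] by (simp add: g_def field_simps)
    have "f (g t) = (t powr 2) powr (- \<theta>) * ((1 + t\<^sup>2) powr \<theta> * (1 + t\<^sup>2) powr (1 - \<theta>))"
      unfolding f_def a using that pos[of t]
      by (simp add: g_def powr_divide powr_minus_divide inverse_powr powr_diff divide_simps)
    also have "\<dots> = t powr (- 2 * \<theta>) * (1 + t\<^sup>2)"
      using pos[of t] by (simp add: powr_powr powr_add[symmetric])
    finally have "\<bar>g' t\<bar> * f (g t) = 2 * t / (1 + t\<^sup>2)\<^sup>2 * (t powr (- 2 * \<theta>) * (1 + t\<^sup>2))"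
      using that by (simp add: g'_def)
    also have "\<dots> = 2 * (t powr 1 * t powr (- 2 * \<theta>)) / (1 + t\<^sup>2)"
      using that pos[of t] by (simp add: power2_eq_square[of "1 + t\<^sup>2"])
    finally show ?thesis
      unfolding powr_add[symmetric] by simp
  qed
  have B: "Beta (1 - \<theta>) \<theta> = pi / sin (pi * \<theta>)"
    using Gamma_reflection_real[of \<theta>] by (simp add: Beta_def mult.commute)
  have "((\<lambda>t. 2 * (t powr (1 - 2 * \<theta>) / (1 + t\<^sup>2))) has_integral pi / sin (pi * \<theta>)) {0<..}"
    using hi unfolding B by (rule has_integral_eq[rotated]) (simp add: eq)
  from has_integral_mult_right[OF this, of "1 / 2"] show ?thesis
    by (simp add: mult.assoc[symmetric] mult.commute[of _ 2])
qed

lemma nn_integral_Ioi_scale: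
  fixes f :: "real \<Rightarrow> ennreal" and c :: real
  assumes [measurable]: "(\<lambda>t. f t * indicator {0<..} t) \<in> borel_measurable borel" and c: "c > 0"
  shows "(\<integral>\<^sup>+t\<in>{0<..}. f t \<partial>lborel) = c * (\<integral>\<^sup>+t\<in>{0<..}. f (c * t) \<partial>lborel)"
  using c nn_integral_real_affine[OF assms(1), of c 0]
  by (simp add: indicator_def zero_less_mult_iff)

lemma K_norm_const_pos: "0 < \<theta> \<Longrightarrow> \<theta> < 1 \<Longrightarrow> 0 < K_norm_const \<theta>"
  by (simp add: K_norm_const_def sin_gt_zero)

text \<open>Rescaling by \<open>a / b\<close> reduces to \<open>a = b = 1\<close>, whose value fixes
  the normalisation. The formula serves an upper bound for \<open>K\<close> with data
  \<open>(a, b)\<close> and a lower bound with data \<open>(b, a)\<close>; being exact, it leaves no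
  constant in the operator bounds.\<close>

lemma nn_integral_K_weight:
  fixes a b \<theta> :: real
  assumes "0 < a" "0 < b" "0 < \<theta>" "\<theta> < 1"
  shows "(\<integral>\<^sup>+t\<in>{0<..}. ennreal (t powr (1 - 2 * \<theta>) / (a\<^sup>2 + b\<^sup>2 * t\<^sup>2)) \<partial>lborel) =
    ennreal (1 / ((K_norm_const \<theta>)\<^sup>2 * (a powr \<theta> * b powr (1 - \<theta>))\<^sup>2))"
proof -
  have "(\<integral>\<^sup>+t. indicator {0<..} t * ennreal (t powr (1 - 2 * \<theta>) / (1 + t\<^sup>2)) \<partial>lborel)
      = (\<integral>\<^sup>+t. ennreal (indicator {0<..} t * (t powr (1 - 2 * \<theta>) / (1 + t\<^sup>2))) \<partial>lborel)"
    by (intro nn_integral_cong) (auto simp: indicator_def)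
  also have "\<dots> = ennreal (pi / (2 * sin (pi * \<theta>)))"
    using assms
    by (intro nn_integral_has_integral_lebesgue has_integral_powr_over_one_plus_square) auto
  also have "pi / (2 * sin (pi * \<theta>)) = 1 / (K_norm_const \<theta>)\<^sup>2"
    using assms by (simp add: K_norm_const_def sin_gt_zero less_imp_le)
  finally have base: "(\<integral>\<^sup>+t\<in>{0<..}. ennreal (t powr (1 - 2 * \<theta>) / (1 + t\<^sup>2)) \<partial>lborel)
      = ennreal (1 / (K_norm_const \<theta>)\<^sup>2)"
    by (simp add: mult.commute)
  define C where "C = (a / b) powr (1 - 2 * \<theta>) / a\<^sup>2"
  have C: "C \<ge> 0" by (simp add: C_def)
  have "(\<integral>\<^sup>+t\<in>{0<..}. ennreal (t powr (1 - 2 * \<theta>) / (a\<^sup>2 + b\<^sup>2 * t\<^sup>2)) \<partial>lborel)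
     = (a / b) * (\<integral>\<^sup>+t\<in>{0<..}. ennreal ((a / b * t) powr (1 - 2 * \<theta>) / (a\<^sup>2 + b\<^sup>2 * (a / b * t)\<^sup>2)) \<partial>lborel)"
    using assms by (intro nn_integral_Ioi_scale) auto
  also have "(\<integral>\<^sup>+t\<in>{0<..}. ennreal ((a / b * t) powr (1 - 2 * \<theta>) / (a\<^sup>2 + b\<^sup>2 * (a / b * t)\<^sup>2)) \<partial>lborel)
     = (\<integral>\<^sup>+t. ennreal C * (ennreal (t powr (1 - 2 * \<theta>) / (1 + t\<^sup>2)) * indicator {0<..} t) \<partial>lborel)"
  proof (intro nn_integral_cong)
    fix t :: real
    have "(a / b * t) powr (1 - 2 * \<theta>) / (a\<^sup>2 + b\<^sup>2 * (a / b * t)\<^sup>2)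
        = C * (t powr (1 - 2 * \<theta>) / (1 + t\<^sup>2))" if "t > 0"
    proof -
      have "a\<^sup>2 + b\<^sup>2 * (a / b * t)\<^sup>2 = a\<^sup>2 * (1 + t\<^sup>2)"
        using assms by (simp add: power_mult_distrib power_divide algebra_simps)
      moreover have "(a / b * t) powr (1 - 2 * \<theta>) = (a / b) powr (1 - 2 * \<theta>) * t powr (1 - 2 * \<theta>)"
        using assms that by (intro powr_mult)
      ultimately show ?thesis by (simp add: C_def)
    qed
    then show "ennreal ((a / b * t) powr (1 - 2 * \<theta>) / (a\<^sup>2 + b\<^sup>2 * (a / b * t)\<^sup>2)) * indicator {0<..} t
       = ennreal C * (ennreal (t powr (1 - 2 * \<theta>) / (1 + t\<^sup>2)) * indicator {0<..} t)"
      using C by (auto simp: indicator_def ennreal_mult'[symmetric])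
  qed
  also have "\<dots> = ennreal C * ennreal (1 / (K_norm_const \<theta>)\<^sup>2)"
    by (subst nn_integral_cmult) (simp_all add: base)
  also have "ennreal (a / b) * \<dots> = ennreal (a / b * C / (K_norm_const \<theta>)\<^sup>2)"
    using assms C by (simp add: ennreal_mult''[symmetric])
  also have "a / b * C = 1 / (a powr \<theta> * b powr (1 - \<theta>))\<^sup>2"
  proof -
    have "a / b * C = (a powr 1 / b powr 1) * (a powr (1 - 2 * \<theta>) / b powr (1 - 2 * \<theta>)) / a powr 2"
      using assms by (simp add: C_def powr_divide powr_numeral)
    also have "\<dots> = (a powr 1 * a powr (1 - 2 * \<theta>) / a powr 2) / (b powr 1 * b powr (1 - 2 * \<theta>))"
      by simp
    also have "\<dots> = a powr (- 2 * \<theta>) / b powr (2 * (1 - \<theta>))"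
      unfolding powr_add[symmetric] powr_diff[symmetric] by (simp add: algebra_simps)
    also have "\<dots> = 1 / (a powr \<theta> * b powr (1 - \<theta>))\<^sup>2"
    proof -
      have "a powr (2 * \<theta>) = (a powr \<theta>)\<^sup>2" "b powr (2 * (1 - \<theta>)) = (b powr (1 - \<theta>))\<^sup>2"
        by (simp_all only: power2_eq_square powr_add[symmetric] mult_2)
      then show ?thesis by (simp add: power_mult_distrib powr_minus_divide)
    qed
    finally show ?thesis .
  qed
  finally show ?thesis by (simp add: mult.commute)
qed

text \<open>Weighted arithmetic-geometric mean inequality, the source of the tangents of
  \<open>w\<close>. A zero argument makes the left side \<open>0\<close>, since
  \<open>0 powr p = 0\<close>.\<close>

lemma powr_weighted_mean_le:
  fixes a b \<theta> :: real
  assumes "0 \<le> a" "0 \<le> b" "0 < \<theta>" "\<theta> < 1"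
  shows "a powr (1 - \<theta>) * b powr \<theta> \<le> (1 - \<theta>) * a + \<theta> * b"
  using Youngs_inequality_0[of "1 - \<theta>" \<theta> a b] assms by (cases "a = 0 \<or> b = 0") auto

lemma powr_sq: "0 \<le> a \<Longrightarrow> ((a::real) powr p)\<^sup>2 = (a\<^sup>2) powr p"
  by (cases "a = 0") (simp_all add: powr_power[symmetric] powr_powr flip: powr_numeral, simp add: mult.commute)

lemma two_ennreal: "a \<ge> 0 \<Longrightarrow> 2 * ennreal a = ennreal (2 * a)"
  by (simp add: ennreal_mult')

section \<open>Seminorms with the parallelogram law\<close>

text \<open>Subtracting \<open>c * f 1\<close> leaves an additive function \<open>h\<close> that
  vanishes on the integers, so a bound on \<open>[0, 1]\<close> is a bound everywhere; then
  \<open>h (n * c) = n * h c\<close> forces \<open>h = 0\<close>. The quadratic growth is what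
  nonnegativity of the squares of \<open>N (c x + y)\<close> and \<open>N (c x - y)\<close> provides
  for the polar form.\<close>

lemma additive_quadratic_bound_imp_linear:
  fixes f :: "real \<Rightarrow> real"
  assumes add: "\<And>a b. f (a + b) = f a + f b"
    and bound: "\<And>c. \<bar>f c\<bar> \<le> A + B * c\<^sup>2" and "B \<ge> 0"
  shows "f c = c * f 1"
proof -
  define h where "h = (\<lambda>c. f c - c * f 1)"
  have hadd: "h (a + b) = h a + h b" for a b
    by (simp add: h_def add algebra_simps)
  have h0: "h 0 = 0" using hadd[of 0 0] by simp
  have hneg: "h (- a) = - h a" for a using hadd[of a "- a"] h0 by simp
  have hmul: "h (real n * a) = real n * h a" for n a
    by (induction n) (simp_all add: h0 hadd algebra_simps)
  have hnat: "h (real n) = 0" for n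
    using hmul[of n 1] by (simp add: h_def)
  have hint: "h (of_int k) = 0" for k
    by (cases k rule: int_cases2) (simp_all add: hnat hneg)
  define C where "C = A + B + \<bar>f 1\<bar>"
  have unit: "\<bar>h t\<bar> \<le> C" if "0 \<le> t" "t \<le> 1" for t
  proof -
    have "t\<^sup>2 \<le> 1" using that by (simp add: power_le_one)
    then have "\<bar>f t\<bar> \<le> A + B" using bound[of t] mult_left_mono[of "t\<^sup>2" 1 B] \<open>B \<ge> 0\<close> by simp
    moreover have "\<bar>t * f 1\<bar> \<le> \<bar>f 1\<bar>" using that by (simp add: abs_mult mult_left_le_one_le)
    ultimately show ?thesis unfolding h_def C_def by linarith
  qed
  have "\<bar>h t\<bar> \<le> C" for t
  proof -
    have "h t = h (of_int \<lfloor>t\<rfloor>) + h (frac t)"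
      using hadd[of "of_int \<lfloor>t\<rfloor>" "frac t"] by (simp add: frac_def)
    then show ?thesis using unit[of "frac t"] by (simp add: hint frac_lt_1 less_imp_le)
  qed
  then have *: "real n * \<bar>h c\<bar> \<le> C" for n
    using hmul[of n c] by (metis abs_mult abs_of_nat)
  have "h c = 0"
  proof (rule ccontr)
    assume "h c \<noteq> 0"
    then obtain n where "C < real n * \<bar>h c\<bar>"
      using reals_Archimedean3[of "\<bar>h c\<bar>"] by auto
    with * show False by (simp add: not_le[symmetric])
  qed
  then show ?thesis by (simp add: h_def)
qed

text \<open>First-order test: small \<open>s\<close> of both signs exclude
  \<open>c \<noteq> 0\<close>. It delivers the Euler equation of the minimiser in the Riesz theorem
  and the vanishing first-order term in \<open>h_iA\<close>.\<close>

lemma linear_le_quadratic_imp_zero: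
  fixes c d :: real
  assumes "\<And>s. s * c \<le> s\<^sup>2 * d"
  shows "c = 0"
proof (rule ccontr)
  assume "c \<noteq> 0"
  define s where "s = c / (\<bar>d\<bar> + 1)"
  have "s * c \<le> s\<^sup>2 * d" by (rule assms)
  also have "\<dots> \<le> s\<^sup>2 * \<bar>d\<bar>" by (intro mult_left_mono) auto
  finally have "c\<^sup>2 * (\<bar>d\<bar> + 1) \<le> c\<^sup>2 * \<bar>d\<bar>"
    by (simp add: s_def power2_eq_square divide_simps split: if_splits)
  then show False using \<open>c \<noteq> 0\<close> by (simp add: distrib_left)
qed

text \<open>The real part of the sesquilinear form that exists by the Jordan--von Neumann theorem.\<close>

definition polar :: "('v::ab_group_add \<Rightarrow> real) \<Rightarrow> 'v \<Rightarrow> 'v \<Rightarrow> real" where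
  "polar N x y = ((N (x + y))\<^sup>2 - (N (x - y))\<^sup>2) / 4"

text \<open>Completeness is left out so that the same theory serves the endpoint spaces and the
  restriction of a norm to \<Delta>. The triangle inequality is a consequence: the parallelogram law
  yields the form, and the form yields Cauchy-Schwarz.\<close>

locale parallelogram_seminorm = vector_space sc
  for sc :: "complex \<Rightarrow> 'v::ab_group_add \<Rightarrow> 'v" +
  fixes S :: "'v set" and N :: "'v \<Rightarrow> real"
  assumes subsp: "subspace S"
    and N_nonneg: "x \<in> S \<Longrightarrow> 0 \<le> N x"
    and N_scale: "x \<in> S \<Longrightarrow> N (sc c x) = cmod c * N x"
    and parallelogram: "x \<in> S \<Longrightarrow> y \<in> S \<Longrightarrow> (N (x + y))\<^sup>2 + (N (x - y))\<^sup>2 = 2 * (N x)\<^sup>2 + 2 * (N y)\<^sup>2"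
begin

abbreviation g where "g \<equiv> polar N"

lemmas S_closed = subspace_0[OF subsp] subspace_add[OF subsp] subspace_diff[OF subsp]
  subspace_neg[OF subsp] subspace_scale[OF subsp]

lemma N_0: "N 0 = 0"
  using N_scale[of 0 0] S_closed(1) by simp

lemma N_minus: "x \<in> S \<Longrightarrow> N (- x) = N x"
  using N_scale[of x "-1"] by simp

lemma N_minus_commute: "x \<in> S \<Longrightarrow> y \<in> S \<Longrightarrow> N (x - y) = N (y - x)"
  using N_minus[of "x - y"] S_closed by simp

lemma g_self: "x \<in> S \<Longrightarrow> g x x = (N x)\<^sup>2"
  using N_scale[of x 2] scale_left_distrib[of 1 1 x] by (simp add: polar_def N_0 power_mult_distrib)

lemma g_commute: "x \<in> S \<Longrightarrow> y \<in> S \<Longrightarrow> g x y = g y x"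
  by (simp add: polar_def N_minus_commute add.commute)

lemma g_0_left: "x \<in> S \<Longrightarrow> g 0 x = 0"
  by (simp add: polar_def N_minus)

text \<open>Jordan-von Neumann: subtracting the parallelogram laws for \<open>a + z, b\<close> and
  \<open>a - z, b\<close> gives \<open>mid\<close>. With \<open>u\<close> and \<open>v\<close> half
  the sum and half the difference of \<open>x\<close> and \<open>y\<close>, its left side is
  \<open>g x z + g y z\<close>, and its right side is \<open>g (u + u) z\<close> by the case
  \<open>b = a\<close>.\<close>

lemma g_add_left:
  assumes "x \<in> S" "y \<in> S" "z \<in> S"
  shows "g (x + y) z = g x z + g y z"
proof -
  have mid: "g (a + b) z + g (a - b) z = 2 * g a z" if "a \<in> S" "b \<in> S" for a b
  proof -
    have "(N (a + b + z))\<^sup>2 + (N (a - b + z))\<^sup>2 = 2 * (N (a + z))\<^sup>2 + 2 * (N b)\<^sup>2"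
      "(N (a + b - z))\<^sup>2 + (N (a - b - z))\<^sup>2 = 2 * (N (a - z))\<^sup>2 + 2 * (N b)\<^sup>2"
      using that assms parallelogram[of "a + z" b] parallelogram[of "a - z" b]
      by (simp_all add: S_closed algebra_simps)
    moreover have "4 * g u z = (N (u + z))\<^sup>2 - (N (u - z))\<^sup>2" for u
      by (simp add: polar_def)
    note this[of "a + b"] this[of "a - b"] this[of a]
    ultimately show ?thesis by linarith
  qed
  have double: "g (a + a) z = 2 * g a z" if "a \<in> S" for a
    using mid[OF that that] g_0_left assms by simp
  define u v where "u = sc (1/2) (x + y)" and "v = sc (1/2) (x - y)"
  have uv: "u \<in> S" "v \<in> S" using assms by (auto simp: u_def v_def intro!: S_closed)
  have half: "sc (1/2) w + sc (1/2) w = w" for w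
    by (simp flip: scale_left_distrib)
  have "u + v = sc (1/2) (x + x)" "u - v = sc (1/2) (y + y)"
    unfolding u_def v_def scale_right_distrib[symmetric] scale_right_diff_distrib[symmetric]
    by (simp_all add: algebra_simps)
  then have "u + v = x" "u - v = y" by (simp_all add: scale_right_distrib half)
  moreover have "u + u = x + y" by (simp add: u_def half)
  ultimately show ?thesis
    using mid[OF uv] double[OF uv(1)] by simp
qed

lemma g_add_right: "x \<in> S \<Longrightarrow> y \<in> S \<Longrightarrow> z \<in> S \<Longrightarrow> g z (x + y) = g z x + g z y"
  using g_add_left[of x y z] by (simp add: g_commute S_closed)

lemma g_minus_left: "x \<in> S \<Longrightarrow> y \<in> S \<Longrightarrow> g (- x) y = - g x y"
  using g_add_left[of x "- x" y] by (simp add: S_closed g_0_left)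

lemma g_minus_right: "x \<in> S \<Longrightarrow> y \<in> S \<Longrightarrow> g x (- y) = - g x y"
  using g_minus_left[of y x] by (simp add: g_commute S_closed)

lemma g_diff_left: "x \<in> S \<Longrightarrow> y \<in> S \<Longrightarrow> z \<in> S \<Longrightarrow> g (x - y) z = g x z - g y z"
  using g_add_left[of x "- y" z] by (simp add: S_closed g_minus_left)

lemma g_diff_right: "x \<in> S \<Longrightarrow> y \<in> S \<Longrightarrow> z \<in> S \<Longrightarrow> g z (x - y) = g z x - g z y"
  using g_add_right[of x "- y" z] by (simp add: S_closed g_minus_right)

lemma N_add_sq: "x \<in> S \<Longrightarrow> y \<in> S \<Longrightarrow> (N (x + y))\<^sup>2 = (N x)\<^sup>2 + 2 * g x y + (N y)\<^sup>2"
  by (simp add: g_self[symmetric] g_add_left g_add_right S_closed g_commute)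

lemma N_diff_sq: "x \<in> S \<Longrightarrow> y \<in> S \<Longrightarrow> (N (x - y))\<^sup>2 = (N x)\<^sup>2 - 2 * g x y + (N y)\<^sup>2"
  by (simp add: g_self[symmetric] g_diff_left g_diff_right S_closed g_commute)

lemma g_scale_left:
  assumes "x \<in> S" "y \<in> S"
  shows "g (sc (complex_of_real c) x) y = c * g x y"
proof -
  have "g (sc (of_real c) x) y = c * g (sc (of_real 1) x) y"
  proof (rule additive_quadratic_bound_imp_linear[where A = "(N y)\<^sup>2 / 2" and B = "(N x)\<^sup>2 / 2"])
    fix a b :: real
    show "g (sc (of_real (a + b)) x) y = g (sc (of_real a) x) y + g (sc (of_real b) x) y"
      using assms by (simp add: scale_left_distrib g_add_left S_closed)
  next
    fix c :: real
    have "0 \<le> (N (sc (of_real c) x + y))\<^sup>2" "0 \<le> (N (sc (of_real c) x - y))\<^sup>2" by simp_all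
    then show "\<bar>g (sc (of_real c) x) y\<bar> \<le> (N y)\<^sup>2 / 2 + (N x)\<^sup>2 / 2 * c\<^sup>2"
      using assms by (simp add: N_add_sq N_diff_sq S_closed N_scale power_mult_distrib mult.commute)
  qed simp
  then show ?thesis by simp
qed

lemma g_scale_right:
  "x \<in> S \<Longrightarrow> y \<in> S \<Longrightarrow> g x (sc (complex_of_real c) y) = c * g x y"
  using g_scale_left[of y x c] by (simp add: g_commute S_closed)

lemma g_ii: "x \<in> S \<Longrightarrow> y \<in> S \<Longrightarrow> g (sc \<i> x) (sc \<i> y) = g x y"
  by (simp add: polar_def N_scale S_closed
      scale_right_distrib[symmetric] scale_right_diff_distrib[symmetric])

lemma g_i_left: "x \<in> S \<Longrightarrow> y \<in> S \<Longrightarrow> g (sc \<i> x) y = - g x (sc \<i> y)"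
  using g_ii[of x "sc \<i> y"] by (simp add: S_closed g_minus_right)

lemma g_i_self: "x \<in> S \<Longrightarrow> g (sc \<i> x) x = 0"
  using g_i_left[of x x] by (simp add: g_commute S_closed)

lemma Cauchy_Schwarz:
  assumes "x \<in> S" "y \<in> S"
  shows "\<bar>g x y\<bar> \<le> N x * N y"
proof -
  have *: "0 \<le> (N x)\<^sup>2 + 2 * c * g x y + c\<^sup>2 * (N y)\<^sup>2" for c
  proof -
    have "0 \<le> (N (x + sc (of_real c) y))\<^sup>2" by simp
    then show ?thesis
      using assms by (simp add: N_add_sq S_closed N_scale power_mult_distrib g_scale_right)
  qed
  have "(g x y)\<^sup>2 \<le> (N x)\<^sup>2 * (N y)\<^sup>2"
  proof (cases "N y = 0")
    case True
    have "g x y = 0"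
    proof (rule ccontr)
      assume "g x y \<noteq> 0"
      \<comment> \<open>When \<open>N y = 0\<close>, the expression in \<open>*\<close> is affine in
        \<open>c\<close>; this choice of \<open>c\<close> gives it the value
        \<open>-1\<close>.\<close>
      then have "2 * (- ((N x)\<^sup>2 + 1) / (2 * g x y)) * g x y = - ((N x)\<^sup>2 + 1)"
        by simp
      with *[of "- ((N x)\<^sup>2 + 1) / (2 * g x y)"] True show False by simp
    qed
    then show ?thesis by simp
  next
    case False
    then have "(N x)\<^sup>2 + 2 * (- g x y / (N y)\<^sup>2) * g x y + (- g x y / (N y)\<^sup>2)\<^sup>2 * (N y)\<^sup>2
      = (N x)\<^sup>2 - (g x y)\<^sup>2 / (N y)\<^sup>2"
      by (simp add: power2_eq_square field_simps)
    with *[of "- g x y / (N y)\<^sup>2"] False show ?thesis by (simp add: field_simps)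
  qed
  then have "\<bar>g x y\<bar>\<^sup>2 \<le> (N x * N y)\<^sup>2" by (simp add: power_mult_distrib)
  then show ?thesis by (rule power2_le_imp_le) (simp add: assms N_nonneg)
qed

lemma N_triangle:
  assumes "x \<in> S" "y \<in> S"
  shows "N (x + y) \<le> N x + N y"
proof (rule power2_le_imp_le)
  show "(N (x + y))\<^sup>2 \<le> (N x + N y)\<^sup>2"
    using Cauchy_Schwarz[OF assms] assms by (simp add: N_add_sq power2_sum)
qed (use assms N_nonneg in auto)

lemma N_diff_triangle: "x \<in> S \<Longrightarrow> y \<in> S \<Longrightarrow> N (x - y) \<le> N x + N y"
  using N_triangle[of x "- y"] by (simp add: N_minus S_closed)

lemma N_reverse_triangle:
  assumes "x \<in> S" "y \<in> S"
  shows "\<bar>N x - N y\<bar> \<le> N (x - y)"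
  using N_triangle[of "x - y" y] N_triangle[of "y - x" x] N_minus_commute[of x y] assms S_closed
  by simp

text \<open>The sesquilinear form is linear in its first argument, hence the sign of its imaginary part.\<close>

definition cip :: "'v \<Rightarrow> 'v \<Rightarrow> complex" where
  "cip x y = Complex (g x y) (g x (sc \<i> y))"

lemma cip_add_left: "x \<in> S \<Longrightarrow> y \<in> S \<Longrightarrow> z \<in> S \<Longrightarrow> cip (x + y) z = cip x z + cip y z"
  by (simp add: cip_def g_add_left S_closed complex_eq_iff)

lemma cip_commute: "x \<in> S \<Longrightarrow> y \<in> S \<Longrightarrow> cip y x = cnj (cip x y)"
  using g_i_left[of x y] g_commute[of x y] g_commute[of "sc \<i> x" y]
  by (simp add: cip_def complex_eq_iff S_closed)

lemma cip_scale_left: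
  assumes "x \<in> S" "y \<in> S"
  shows "cip (sc c x) y = c * cip x y"
proof -
  have "sc c x = sc (of_real (Re c)) x + sc (of_real (Im c)) (sc \<i> x)"
    using complex_eq[of c] by (simp add: scale_left_distrib[symmetric] mult.commute)
  moreover have "cip (sc (of_real r) z) y = of_real r * cip z y" if "z \<in> S" for r z
    using that assms by (simp add: cip_def complex_eq_iff g_scale_left S_closed)
  moreover have "cip (sc \<i> x) y = \<i> * cip x y"
    using assms g_i_left[of x y] g_ii[of x y] by (simp add: cip_def complex_eq_iff)
  ultimately show ?thesis
    using assms by (simp add: cip_add_left S_closed del: scale_scale) (simp add: complex_eq_iff)
qed

lemma cip_self: "x \<in> S \<Longrightarrow> Re (cip x x) = (N x)\<^sup>2"
  by (simp add: cip_def g_self)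

lemma Re_cip: "Re (cip x y) = g x y"
  by (simp add: cip_def)

lemma cip_Cauchy_Schwarz:
  assumes "x \<in> S" "y \<in> S"
  shows "cmod (cip x y) \<le> N x * N y"
proof (cases "cip x y = 0")
  case False
  define u where "u = cnj (cip x y) / of_real (cmod (cip x y))"
  have "u * cip x y = of_real (cmod (cip x y))"
    using False by (simp add: u_def field_simps complex_norm_square[symmetric] power2_eq_square)
  then have "cmod (cip x y) = g (sc u x) y"
    using cip_scale_left[OF assms, of u] by (metis Re_cip Re_complex_of_real)
  also have "\<dots> \<le> N (sc u x) * N y"
    using Cauchy_Schwarz[of "sc u x" y] assms by (simp add: S_closed abs_le_iff)
  also have "N (sc u x) = N x"
    using False assms by (simp add: N_scale u_def norm_divide)
  finally show ?thesis .
qed (use assms N_nonneg in auto)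

lemma inner_product_on_cip:
  assumes "\<And>x. x \<in> S \<Longrightarrow> x \<noteq> 0 \<Longrightarrow> 0 < N x"
  shows "inner_product_on sc S cip"
  unfolding inner_product_on_def
proof (intro conjI ballI allI impI)
  show "0 < Re (cip x x)" if "x \<in> S" "x \<noteq> 0" for x
    using assms[OF that] that by (simp add: cip_self)
qed (fact cip_add_left cip_scale_left cip_commute)+

lemma g_scale_complex:
  assumes "x \<in> S" "y \<in> S"
  shows "g (sc c x) y = g x (sc (cnj c) y)"
proof -
  have "cip (sc c x) y = cip x (sc (cnj c) y)"
    using assms cip_commute[of x "sc (cnj c) y"] cip_commute[of x y] cip_scale_left[of y x "cnj c"]
    by (metis S_closed(5) cip_commute cip_scale_left complex_cnj_cnj complex_cnj_mult)
  then show ?thesis by (metis Re_cip)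
qed

text \<open>The representing vector minimises \<open>J y = (N y)\<^sup>2 - 2 * f y\<close>. The
  parallelogram law, applied to midpoints, makes a minimising sequence Cauchy, and the first-order
  condition at the minimum is \<open>g z y = f y\<close>. Real linearity of \<open>f\<close> matches
  \<open>g\<close>, which is the real part of the sesquilinear form.\<close>

lemma Riesz_representation:
  assumes complete: "\<And>s. range s \<subseteq> S \<Longrightarrow> (\<forall>e>0. \<exists>M. \<forall>m\<ge>M. \<forall>n\<ge>M. N (s m - s n) < e) \<Longrightarrow>
        \<exists>l\<in>S. (\<lambda>n. N (s n - l)) \<longlonglongrightarrow> 0"
    and add: "\<And>x y. x \<in> S \<Longrightarrow> y \<in> S \<Longrightarrow> f (x + y) = f x + f y"
    and scale: "\<And>c x. x \<in> S \<Longrightarrow> f (sc (of_real c) x) = c * f x"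
    and bound: "\<And>x. x \<in> S \<Longrightarrow> \<bar>f x\<bar> \<le> C * N x"
  shows "\<exists>z\<in>S. \<forall>y\<in>S. g z y = f y"
proof -
  define J where "J y = (N y)\<^sup>2 - 2 * f y" for y
  have J_add: "J (x + sc (of_real s) y) = J x + 2 * s * (g x y - f y) + s\<^sup>2 * (N y)\<^sup>2"
    if "x \<in> S" "y \<in> S" for x y s
    using that by (simp add: J_def N_add_sq S_closed N_scale power_mult_distrib add scale g_scale_right algebra_simps)
  have lower: "- C\<^sup>2 \<le> J y" if "y \<in> S" for y
  proof -
    have "0 \<le> (N y - C)\<^sup>2" by simp
    then show ?thesis using bound[OF that] by (simp add: J_def power2_diff mult.commute)
  qed
  define j where "j = (INF y\<in>S. J y)"
  have bdd: "bdd_below (J ` S)" using lower by (intro bdd_belowI2) auto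
  have j_le: "j \<le> J y" if "y \<in> S" for y
    unfolding j_def using bdd that by (rule cINF_lower)
  have "\<exists>y\<in>S. J y < j + 1 / real (Suc n)" for n
    using cINF_less_iff[OF _ bdd, of "j + 1 / real (Suc n)"] S_closed(1) by (auto simp: j_def[symmetric])
  then obtain s where s: "\<And>n. s n \<in> S" "\<And>n. J (s n) < j + 1 / real (Suc n)"
    by metis
  have dist: "(N (s m - s n))\<^sup>2 \<le> 2 / real (Suc m) + 2 / real (Suc n)" for m n
  proof -
    define w where "w = sc (of_real (1/2)) (s m + s n)"
    have w: "w \<in> S" using s by (simp add: w_def S_closed)
    have "f (s m) + f (s n) = 2 * f w" "(N (s m + s n))\<^sup>2 = 4 * (N w)\<^sup>2"
      using s unfolding w_def scale[OF S_closed(2)[OF s(1) s(1)]] N_scale[OF S_closed(2)[OF s(1) s(1)]]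
      by (simp_all add: add power_divide)
    then have "(N (s m - s n))\<^sup>2 = 2 * J (s m) + 2 * J (s n) - 4 * J w"
      using parallelogram[OF s(1) s(1), of m n] by (simp add: J_def)
    also have "\<dots> \<le> 2 / real (Suc m) + 2 / real (Suc n)"
      using s(2)[of m] s(2)[of n] j_le[OF w] by simp
    finally show ?thesis .
  qed
  have "\<exists>M. \<forall>m\<ge>M. \<forall>n\<ge>M. N (s m - s n) < e" if "e > 0" for e
  proof -
    obtain M where M: "4 / e\<^sup>2 < real (Suc M)"
      using reals_Archimedean2[of "4 / e\<^sup>2"] by (metis less_Suc_eq of_nat_less_iff order.strict_trans)
    then have M': "4 / real (Suc M) < e\<^sup>2" using that by (simp add: field_simps)
    have "N (s m - s n) < e" if "m \<ge> M" "n \<ge> M" for m n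
    proof (rule power_less_imp_less_base)
      have "2 / real (Suc m) \<le> 2 / real (Suc M)" "2 / real (Suc n) \<le> 2 / real (Suc M)"
        using that by (auto intro!: divide_left_mono)
      then show "(N (s m - s n))\<^sup>2 < e\<^sup>2" using dist[of m n] M' by linarith
    qed (use \<open>e > 0\<close> in simp)
    then show ?thesis by blast
  qed
  moreover have "range s \<subseteq> S" using s by auto
  ultimately obtain z where z: "z \<in> S" "(\<lambda>n. N (s n - z)) \<longlonglongrightarrow> 0"
    using complete by blast
  have Jz: "J z \<le> j"
  proof (rule LIMSEQ_le_const)
    have "J z = J (s n) - 2 * (g z (s n - z) - f (s n - z)) - (N (s n - z))\<^sup>2" for n
      using J_add[OF z(1) S_closed(3)[OF s(1) z(1)], of 1 n] by simp
    moreover have "\<bar>g z (s n - z)\<bar> \<le> N z * N (s n - z)" "\<bar>f (s n - z)\<bar> \<le> C * N (s n - z)" for n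
      using Cauchy_Schwarz bound s z by (auto simp: S_closed)
    ultimately have "J z \<le> J (s n) + 2 * ((N z + C) * N (s n - z))" for n
      by (smt (verit) distrib_right zero_le_power2)
    then have "J z \<le> j + 1 / real (Suc n) + 2 * ((N z + C) * N (s n - z))" for n
      using s(2)[of n] by (smt (verit))
    then show "\<exists>M. \<forall>n\<ge>M. J z \<le> j + 1 / real (Suc n) + 2 * ((N z + C) * N (s n - z))" by blast
    have "(\<lambda>n. j + 1 / real (Suc n) + 2 * ((N z + C) * N (s n - z))) \<longlonglongrightarrow> j + 0 + 2 * ((N z + C) * 0)"
      by (intro tendsto_intros z(2) LIMSEQ_Suc[OF lim_1_over_n])
    then show "(\<lambda>n. j + 1 / real (Suc n) + 2 * ((N z + C) * N (s n - z))) \<longlonglongrightarrow> j" by simp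
  qed
  have "g z y = f y" if y: "y \<in> S" for y
  proof -
    have "s * (- 2 * (g z y - f y)) \<le> s\<^sup>2 * (N y)\<^sup>2" for s
      using j_le[OF S_closed(2)[OF z(1) S_closed(5)[OF y]], of "of_real s"] J_add[OF z(1) y, of s] Jz
      by (simp add: algebra_simps)
    then have "- 2 * (g z y - f y) = 0" by (rule linear_le_quadratic_imp_zero)
    then show ?thesis by simp
  qed
  then show ?thesis using z by blast
qed

end

lemma hilbert_onI:
  assumes "banach_on sc X" "parallelogram_seminorm sc (elems X) (nrm X)"
  shows "hilbert_on sc X"
proof -
  interpret parallelogram_seminorm sc "elems X" "nrm X" by fact
  have "0 < nrm X x" if "x \<in> elems X" "x \<noteq> 0" for x
    using assms(1) that unfolding banach_on_def normed_on_def by (simp add: less_le)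
  then have "inner_product_on sc (elems X) cip" by (rule inner_product_on_cip)
  then show ?thesis
    using assms(1) unfolding hilbert_on_def by (auto intro!: exI[of _ cip] simp: cip_self N_nonneg)
qed

lemma normed_onD:
  assumes "normed_on sc X"
  shows "vector_space sc" "module.subspace sc (elems X)"
    and "\<And>x. x \<in> elems X \<Longrightarrow> 0 \<le> nrm X x"
    and "\<And>x. x \<in> elems X \<Longrightarrow> nrm X x = 0 \<longleftrightarrow> x = 0"
    and "\<And>c x. x \<in> elems X \<Longrightarrow> nrm X (sc c x) = cmod c * nrm X x"
    and "\<And>x y. x \<in> elems X \<Longrightarrow> y \<in> elems X \<Longrightarrow> nrm X (x + y) \<le> nrm X x + nrm X y"
  using assms by (auto simp: normed_on_def)

lemma banach_on_normed_on: "banach_on sc X \<Longrightarrow> normed_on sc X"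
  by (simp add: banach_on_def)

lemma hilbert_on_parallelogram_seminorm:
  assumes "hilbert_on sc X"
  shows "parallelogram_seminorm sc (elems X) (nrm X)"
proof -
  have n: "normed_on sc X" using assms by (simp add: hilbert_on_def banach_on_def)
  interpret vector_space sc using n by (rule normed_onD)
  obtain ip where ip: "inner_product_on sc (elems X) ip" "\<And>x. x \<in> elems X \<Longrightarrow> nrm X x = sqrt (Re (ip x x))"
    using assms by (auto simp: hilbert_on_def)
  have sub: "subspace (elems X)" using n by (rule normed_onD)
  note closed = subspace_add[OF sub] subspace_diff[OF sub] subspace_scale[OF sub] subspace_neg[OF sub]
  note D = ip(1)[unfolded inner_product_on_def]
  have add: "ip (x + y) z = ip x z + ip y z" if "x \<in> elems X" "y \<in> elems X" "z \<in> elems X" for x y z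
    using D[THEN conjunct1] that by blast
  have com: "ip y x = cnj (ip x y)" if "x \<in> elems X" "y \<in> elems X" for x y
    using D[THEN conjunct2, THEN conjunct2, THEN conjunct1] that by blast
  have addr: "ip z (x + y) = ip z x + ip z y" if "x \<in> elems X" "y \<in> elems X" "z \<in> elems X" for x y z
    unfolding com[OF closed(1)[OF that(1,2)] that(3)] com[OF that(1,3)] com[OF that(2,3)] add[OF that] by simp
  have scl: "ip (sc c x) y = c * ip x y" if "x \<in> elems X" "y \<in> elems X" for c x y
    using D[THEN conjunct2, THEN conjunct1] that by blast
  have neg: "ip (- x) y = - ip x y" if "x \<in> elems X" "y \<in> elems X" for x y
    using scl[OF that, of "-1"] by simp
  have negr: "ip x (- y) = - ip x y" if "x \<in> elems X" "y \<in> elems X" for x y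
    unfolding com[OF closed(4)[OF that(2)] that(1)] com[OF that(2,1)] neg[OF that(2,1)] by simp
  have sq: "(nrm X x)\<^sup>2 = Re (ip x x)" if "x \<in> elems X" for x
  proof -
    have "0 \<le> nrm X x" by (rule normed_onD(3)[OF n that])
    then show ?thesis using ip(2)[OF that] by (simp add: real_sqrt_ge_0_iff)
  qed
  show ?thesis
  proof
    fix x y assume xy: "x \<in> elems X" "y \<in> elems X"
    have "ip (x + y) (x + y) + ip (x + - y) (x + - y) = 2 * ip x x + 2 * ip y y"
      using xy by (simp only: add addr neg negr closed) simp
    then show "(nrm X (x + y))\<^sup>2 + (nrm X (x - y))\<^sup>2 = 2 * (nrm X x)\<^sup>2 + 2 * (nrm X y)\<^sup>2"
      using xy by (simp add: sq closed complex_eq_iff)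
  qed (use sub normed_onD[OF n] in auto)
qed

lemma continuous_inclusionI:
  assumes "normed_on sc X" "elems X \<subseteq> elems Y" "0 < C" "\<And>z. z \<in> elems X \<Longrightarrow> nrm Y z \<le> C * nrm X z"
  shows "continuous_inclusion X Y"
  unfolding continuous_inclusion_def
proof (intro conjI ballI allI impI)
  interpret vector_space sc using assms(1) by (rule normed_onD)
  have sub: "subspace (elems X)" using assms(1) by (rule normed_onD)
  fix x and e :: real assume x: "x \<in> elems X" and e: "0 < e"
  show "\<exists>d>0. \<forall>y\<in>elems X. nrm X (y - x) < d \<longrightarrow> nrm Y (y - x) < e"
  proof (intro exI[of _ "e / C"] conjI ballI impI)
    fix y assume y: "y \<in> elems X" "nrm X (y - x) < e / C"
    have "nrm Y (y - x) \<le> C * nrm X (y - x)" using assms(4) subspace_diff[OF sub] x y by blast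
    also have "\<dots> < e" using y assms(3) by (simp add: field_simps)
    finally show "nrm Y (y - x) < e" .
  qed (use e assms in simp)
qed fact

text \<open>Continuity at \<open>0\<close> with tolerance \<open>1\<close> gives a radius
  \<open>d\<close>; scaling a vector to norm \<open>d / 2\<close> gives the constant
  \<open>2 / d\<close>.\<close>

lemma continuous_inclusion_bounded:
  assumes X: "normed_on sc X" and Y: "normed_on sc Y" and incl: "continuous_inclusion X Y"
  obtains C where "0 < C" "\<And>z. z \<in> elems X \<Longrightarrow> nrm Y z \<le> C * nrm X z"
proof -
  interpret vector_space sc using X by (rule normed_onD)
  have sub: "subspace (elems X)" using X by (rule normed_onD)
  have XY: "elems X \<subseteq> elems Y" using incl by (simp add: continuous_inclusion_def)
  have "0 \<in> elems X" by (rule subspace_0[OF sub])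
  then obtain d where d: "d > 0" "\<And>y. y \<in> elems X \<Longrightarrow> nrm X y < d \<Longrightarrow> nrm Y y < 1"
    using incl unfolding continuous_inclusion_def by (metis diff_zero zero_less_one)
  have "nrm Y z \<le> 2 / d * nrm X z" if z: "z \<in> elems X" for z
  proof (cases "z = 0")
    case True
    then show ?thesis using z XY normed_onD(4)[OF X z] normed_onD(4)[OF Y, of z] by auto
  next
    case False
    then have pos: "nrm X z > 0" using normed_onD(3,4)[OF X z] by simp
    define c where "c = d / (2 * nrm X z)"
    have c: "c > 0" using pos d by (simp add: c_def)
    have "nrm Y (sc (of_real c) z) < 1"
    proof (rule d(2))
      show "nrm X (sc (of_real c) z) < d"
        unfolding normed_onD(5)[OF X z] norm_of_real using c pos d by (simp add: c_def)
    qed (rule subspace_scale[OF sub z])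
    then have "c * nrm Y z < 1"
      using c z XY by (simp add: normed_onD(5)[OF Y] subset_iff)
    then show ?thesis using d pos by (simp add: c_def field_simps)
  qed
  then show ?thesis using that[of "2 / d"] d by simp
qed

section \<open>Bernstein sums of moment sequences\<close>

lemma sum_binomial_Suc:
  fixes f :: "nat \<Rightarrow> real"
  shows "(\<Sum>p\<le>Suc n. real (Suc n choose p) * f p)
    = (\<Sum>p\<le>n. real (n choose p) * f (Suc p)) + (\<Sum>p\<le>n. real (n choose p) * f p)"
proof -
  have "(\<Sum>p\<le>Suc n. real (Suc n choose p) * f p)
    = f 0 + (\<Sum>p\<le>n. real (Suc n choose Suc p) * f (Suc p))"
    by (simp only: sum.atMost_Suc_shift) simp
  also have "\<dots> = (\<Sum>p\<le>n. real (n choose p) * f (Suc p))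
      + (f 0 + (\<Sum>p\<le>n. real (n choose Suc p) * f (Suc p)))"
    by (simp add: ring_distribs sum.distrib)
  also have "f 0 + (\<Sum>p\<le>n. real (n choose Suc p) * f (Suc p)) = (\<Sum>p\<le>Suc n. real (n choose p) * f p)"
    by (simp only: sum.atMost_Suc_shift) simp
  finally show ?thesis by simp
qed

lemma sum_binomial_times_index:
  fixes f :: "nat \<Rightarrow> real"
  shows "(\<Sum>p\<le>Suc n. real (Suc n choose p) * (real p * f p))
    = real (Suc n) * (\<Sum>p\<le>n. real (n choose p) * f (Suc p))"
proof -
  have "real (Suc n choose Suc p) * (real (Suc p) * f (Suc p)) = real (Suc n) * (real (n choose p) * f (Suc p))" for p
    using arg_cong[OF Suc_times_binomial[of p n], of real] unfolding of_nat_mult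
    by (metis mult.assoc mult.commute)
  then show ?thesis
    by (subst sum.atMost_Suc_shift) (simp only: sum_distrib_left of_nat_0 mult_zero_left mult_zero_right add_0)
qed

text \<open>The hypothesis is the identity 1 = a + (1 - a) read off on moments; inserting its n-th
  power gives the Bernstein partition of unity.\<close>

lemma moment_expand:
  fixes l :: "nat \<Rightarrow> nat \<Rightarrow> real"
  assumes pascal: "\<And>j m. l j m = l (Suc j) m + l j (Suc m)"
  shows "l j m = (\<Sum>p\<le>n. real (n choose p) * l (j + p) (m + (n - p)))"
proof (induction n arbitrary: j m)
  case (Suc n)
  have "l j m = l (Suc j) m + l j (Suc m)" by (rule pascal)
  also have "\<dots> = (\<Sum>p\<le>n. real (n choose p) * l (j + Suc p) (m + (Suc n - Suc p)))
     + (\<Sum>p\<le>n. real (n choose p) * l (j + p) (m + (Suc n - p)))"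
    unfolding Suc[of "Suc j" m] Suc[of j "Suc m"]
    by (intro arg_cong2[of _ _ _ _ "(+)"] sum.cong) (auto simp: Suc_diff_le)
  finally show ?case
    unfolding sum_binomial_Suc[of n "\<lambda>p. l (j + p) (m + (Suc n - p))"] .
qed simp

text \<open>The variance of the binomial distribution: the Bernstein operator of degree n applied to
  \<open>(a - p / n)\<^sup>2\<close> gives a (1 - a) / n, and a (1 - a) = a - a^2 has the moment
  \<open>l 1 0 - l 2 0\<close>.\<close>

lemma moment_variance:
  fixes l :: "nat \<Rightarrow> nat \<Rightarrow> real"
  assumes pascal: "\<And>j m. l j m = l (Suc j) m + l j (Suc m)" and n: "n > 0"
  shows "(\<Sum>p\<le>n. real (n choose p) * (l (p + 2) (n - p) - 2 * (real p / real n) * l (p + 1) (n - p)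
      + (real p / real n)\<^sup>2 * l p (n - p))) = (l 1 0 - l 2 0) / real n"
proof -
  obtain k where k: "n = Suc k" using n by (cases n) auto
  have s0: "(\<Sum>p\<le>n. real (n choose p) * l (p + 2) (n - p)) = l 2 0"
    using moment_expand[where l = l, OF pascal, of 2 0 n] by (simp add: add.commute)
  have s1: "(\<Sum>p\<le>n. real (n choose p) * (real p * l (p + 1) (n - p))) = real n * l 2 0"
    unfolding k sum_binomial_times_index[of k "\<lambda>p. l (p + 1) (Suc k - p)"]
    using moment_expand[where l = l, OF pascal, of 2 0 k] by simp
  have s1': "(\<Sum>p\<le>k. real (k choose p) * (real p * l (p + 1) (k - p))) = real k * l 2 0"
  proof (cases k)
    case (Suc i)
    show ?thesis
      unfolding Suc sum_binomial_times_index[of i "\<lambda>p. l (p + 1) (Suc i - p)"]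
      using moment_expand[where l = l, OF pascal, of 2 0 i] by simp
  qed simp
  have s1'': "(\<Sum>p\<le>k. real (k choose p) * l (p + 1) (k - p)) = l 1 0"
    using moment_expand[where l = l, OF pascal, of 1 0 k] by simp
  have s2: "(\<Sum>p\<le>n. real (n choose p) * (real p * (real p * l p (n - p)))) = real n * (l 1 0 + real k * l 2 0)"
    unfolding k sum_binomial_times_index[of k "\<lambda>p. real p * l p (Suc k - p)"]
    using s1' s1'' by (simp add: algebra_simps sum.distrib)
  have "(\<Sum>p\<le>n. real (n choose p) * (l (p + 2) (n - p) - 2 * (real p / real n) * l (p + 1) (n - p)
      + (real p / real n)\<^sup>2 * l p (n - p)))
    = (\<Sum>p\<le>n. real (n choose p) * l (p + 2) (n - p)
      - 2 / real n * (real (n choose p) * (real p * l (p + 1) (n - p)))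
      + 1 / (real n)\<^sup>2 * (real (n choose p) * (real p * (real p * l p (n - p)))))"
    by (intro sum.cong refl) (simp add: algebra_simps power2_eq_square)
  also have "\<dots> = l 2 0 - 2 / real n * (real n * l 2 0) + 1 / (real n)\<^sup>2 * (real n * (l 1 0 + real k * l 2 0))"
    by (simp only: sum.distrib sum_subtractf sum_distrib_left[symmetric] s0 s1 s2)
  also have "\<dots> = (l 1 0 - l 2 0) / real n"
  proof -
    have "2 / real n * (real n * l 2 0) = 2 * l 2 0"
      "1 / (real n)\<^sup>2 * (real n * (l 1 0 + real k * l 2 0)) = (l 1 0 + (real n - 1) * l 2 0) / real n"
      using n by (simp_all add: k power2_eq_square)
    then show ?thesis using n by (simp add: diff_divide_distrib add_divide_distrib left_diff_distrib)
  qed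
  finally show ?thesis .
qed

text \<open>At r = (p + 2) / (n + 4) the weight \<open>1 / (r * (1 - r))\<^sup>2\<close> equals the
  fourth power of n + 4 divided by the squared factor on the right. It is thus paid for by passing
  to the binomial coefficient of degree n + 4. The 16 is 4 * 2 * 2, from comparing n + 4 with n + 1,
  n + 2 and n + 3.\<close>

lemma binomial_shift_bound:
  assumes "p \<le> n"
  shows "real (n choose p) * (real (n + 4)) ^ 4 \<le> 16 * real (n + 4 choose (p + 2)) * (real (p + 2) * real (n - p + 2))\<^sup>2"
proof -
  define q where "q = n - p"
  have n: "n = p + q" using assms by (simp add: q_def)
  have fc: "real (a + b choose a) = fact (a + b) / (fact a * fact b)" for a b
    using binomial_fact[of a "a + b", where 'a = real] by simp
  have e1: "real (p + q choose p) = fact (p + q) / (fact p * fact q)" by (rule fc)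
  have e2: "real (p + q + 4 choose (p + 2))
     = fact (p + q) * ((real (p+q) + 1) * (real (p+q) + 2) * (real (p+q) + 3) * (real (p+q) + 4))
       / (fact p * fact q * ((real p + 1) * (real p + 2) * (real q + 1) * (real q + 2)))"
  proof -
    have "real (p + q + 4 choose (p + 2)) = fact (p + q + 4) / (fact (p + 2) * fact (q + 2))"
      using fc[of "p + 2" "q + 2"] by (simp add: add_ac numeral_eq_Suc)
    moreover have "(fact (p + 2) :: real) = fact p * ((real p + 1) * (real p + 2))"
        "(fact (q + 2) :: real) = fact q * ((real q + 1) * (real q + 2))"
        "(fact (p + q + 4) :: real) = fact (p + q) * ((real (p+q) + 1) * (real (p+q) + 2) * (real (p+q) + 3) * (real (p+q) + 4))"
      by (simp_all add: numeral_eq_Suc algebra_simps)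
    ultimately show ?thesis by (simp only: mult_ac)
  qed
  define s where "s = real (p + q)"
  have s: "s \<ge> 0" by (simp add: s_def)
  have "(s + 4) * ((s + 4) * (s + 4)) \<le> (4 * (s + 1)) * ((2 * (s + 2)) * (2 * (s + 3)))"
    using s by (intro mult_mono) auto
  then have key: "(s + 4) ^ 4 \<le> 16 * ((s + 1) * (s + 2) * (s + 3) * (s + 4))"
    using s mult_right_mono[of "(s + 4) * ((s + 4) * (s + 4))" "(4 * (s + 1)) * ((2 * (s + 2)) * (2 * (s + 3)))" "s + 4"]
    by (simp add: power4_eq_xxxx algebra_simps)
  have frac: "1 \<le> ((real p + 2) * (real q + 2))\<^sup>2 / ((real p + 1) * (real p + 2) * (real q + 1) * (real q + 2))"
  proof -
    have "(real p + 1) * (real p + 2) * ((real q + 1) * (real q + 2)) \<le> (real p + 2) * (real p + 2) * ((real q + 2) * (real q + 2))"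
      by (intro mult_mono) auto
    then show ?thesis by (simp add: power2_eq_square mult_ac le_divide_eq)
  qed
  have "real (n choose p) * (real (n + 4)) ^ 4 = fact (p + q) / (fact p * fact q) * (s + 4) ^ 4"
    by (simp add: n e1 s_def add_ac)
  also have "\<dots> \<le> fact (p + q) / (fact p * fact q) * (16 * ((s + 1) * (s + 2) * (s + 3) * (s + 4)))"
    using key by (intro mult_left_mono) auto
  also have "\<dots> \<le> fact (p + q) / (fact p * fact q) * (16 * ((s + 1) * (s + 2) * (s + 3) * (s + 4)))
     * (((real p + 2) * (real q + 2))\<^sup>2 / ((real p + 1) * (real p + 2) * (real q + 1) * (real q + 2)))"
    using frac s mult_left_mono[OF frac, of "fact (p + q) / (fact p * fact q) * (16 * ((s + 1) * (s + 2) * (s + 3) * (s + 4)))"]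
    by simp
  also have "\<dots> = 16 * real (n + 4 choose (p + 2)) * (real (p + 2) * real (n - p + 2))\<^sup>2"
  proof -
    have Z: "real (p + 2) * real (n - p + 2) = (real p + 2) * (real q + 2)"
      by (simp add: q_def add.commute)
    show ?thesis unfolding Z unfolding n e2 s_def by simp
  qed
  finally show ?thesis .
qed

text \<open>Here \<open>l j m\<close> and \<open>e j m\<close> play the role of the moments of \<open>a\<^sup>j (1 - a)\<^sup>m\<close>.  Expand \<open>e 2 2\<close> in Bernstein terms and
  use the hypothesis at \<open>r = (p + 2) / (n + 4)\<close> in the term of index \<open>p\<close>: the extra factor \<open>a\<^sup>2 (1 - a)\<^sup>2\<close> absorbs
  the weight \<open>1 / (r (1 - r))\<^sup>2\<close>, and the variance of the Bernstein operator is of order \<open>1 / n\<close>.\<close>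

lemma moment_nonpos:
  fixes e l :: "nat \<Rightarrow> nat \<Rightarrow> real"
  assumes pe: "\<And>j m. e j m = e (Suc j) m + e j (Suc m)"
    and pl: "\<And>j m. l j m = l (Suc j) m + l j (Suc m)"
    and pos: "\<And>r j m. 0 \<le> l (j + 2) m - 2 * r * l (j + 1) m + r\<^sup>2 * l j m"
    and bound: "\<And>r j m. 0 < r \<Longrightarrow> r < 1 \<Longrightarrow>
      e j m \<le> (l (j + 2) m - 2 * r * l (j + 1) m + r\<^sup>2 * l j m) / (r * (1 - r))\<^sup>2"
  shows "e 2 2 \<le> 0"
proof -
  have est: "e 2 2 \<le> 16 * (l 1 0 - l 2 0) / real (n + 4)" for n
  proof -
    \<comment> \<open>The terms in the degree-n expansion of \<open>e 2 2\<close> are Bernstein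
      monomials of degree n + 4 with index p + 2, so indices at the very ends, where r (1 - r) could
      vanish, never occur.\<close>
    define N where "N = n + 4"
    define V where "V p = l (p + 2) (N - p) - 2 * (real p / real N) * l (p + 1) (N - p)
      + (real p / real N)\<^sup>2 * l p (N - p)" for p
    have V: "V p \<ge> 0" for p unfolding V_def by (rule pos)
    have summand: "real (n choose p) * e (2 + p) (2 + (n - p)) \<le> 16 * (real (N choose (p + 2)) * V (p + 2))"
      if "p \<le> n" for p
    proof -
      define r where "r = real (p + 2) / real N"
      have r: "0 < r" "r < 1" using that by (auto simp: r_def N_def)
      have "1 - r = real (n - p + 2) / real N"
        using that by (simp add: r_def N_def field_simps of_nat_diff)
      then have rr: "r * (1 - r) = real (p + 2) * real (n - p + 2) / (real N)\<^sup>2"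
        by (simp add: r_def power2_eq_square)
      have "N - (p + 2) = 2 + (n - p)" using that by (simp add: N_def)
      then have "e (2 + p) (2 + (n - p)) \<le> V (p + 2) / (r * (1 - r))\<^sup>2"
        using bound[OF r, of "p + 2" "N - (p + 2)"] by (simp add: V_def r_def add.commute)
      then have "real (n choose p) * e (2 + p) (2 + (n - p)) \<le> real (n choose p) * (V (p + 2) / (r * (1 - r))\<^sup>2)"
        by (intro mult_left_mono) auto
      also have "\<dots> = real (n choose p) * real N ^ 4 / (real (p + 2) * real (n - p + 2))\<^sup>2 * V (p + 2)"
        unfolding rr power_divide power_mult[symmetric] by simp
      also have "\<dots> \<le> 16 * real (N choose (p + 2)) * V (p + 2)"
        using binomial_shift_bound[OF that] V unfolding N_def
        by (intro mult_right_mono) (simp_all add: divide_le_eq)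
      finally show ?thesis by simp
    qed
    have "e 2 2 = (\<Sum>p\<le>n. real (n choose p) * e (2 + p) (2 + (n - p)))"
      by (rule moment_expand[where l = e]) (rule pe)
    also have "\<dots> \<le> (\<Sum>p\<le>n. 16 * (real (N choose (p + 2)) * V (p + 2)))"
      using summand by (intro sum_mono) auto
    also have "\<dots> = (\<Sum>p\<in>(\<lambda>p. p + 2) ` {..n}. 16 * (real (N choose p) * V p))"
      by (subst sum.reindex) (auto simp: inj_on_def)
    \<comment> \<open>Nonnegative terms at the four missing indices are added back, so that the
      variance formula applies to the full sum.\<close>
    also have "\<dots> \<le> (\<Sum>p\<le>N. 16 * (real (N choose p) * V p))"
      using V by (intro sum_mono2) (auto simp: N_def)
    also have "\<dots> = 16 * ((l 1 0 - l 2 0) / real N)"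
      unfolding sum_distrib_left[symmetric] V_def
      by (subst moment_variance[where l = l, OF pl]) (auto simp: N_def)
    finally show ?thesis by (simp add: N_def)
  qed
  have "(\<lambda>n. 16 * (l 1 0 - l 2 0) / real (n + 4)) \<longlonglongrightarrow> 0"
    by (rule LIMSEQ_ignore_initial_segment) (rule lim_const_over_n)
  then show ?thesis by (rule LIMSEQ_le_const) (use est in auto)
qed

section \<open>Positive contractions and the forms for which they are symmetric\<close>

locale positive_contraction = parallelogram_seminorm +
  fixes A :: "'a \<Rightarrow> 'a"
  assumes A_closed: "x \<in> S \<Longrightarrow> A x \<in> S"
    and A_add: "x \<in> S \<Longrightarrow> y \<in> S \<Longrightarrow> A (x + y) = A x + A y"
    and A_scale: "x \<in> S \<Longrightarrow> A (sc c x) = sc c (A x)"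
    and A_sym: "x \<in> S \<Longrightarrow> y \<in> S \<Longrightarrow> g (A x) y = g x (A y)"
    and A_pos: "x \<in> S \<Longrightarrow> 0 \<le> g (A x) x"
    and A_le: "x \<in> S \<Longrightarrow> g (A x) x \<le> g x x"
begin

lemma A_minus: "x \<in> S \<Longrightarrow> A (- x) = - A x"
  using A_scale[of x "-1"] by simp

lemma A_diff: "x \<in> S \<Longrightarrow> y \<in> S \<Longrightarrow> A (x - y) = A x - A y"
  using A_add[of x "- y"] by (simp add: A_minus S_closed)

text \<open>\<open>A - A\<^sup>2\<close> is the sum of the positive operators
  \<open>A (1 - A) A\<close> and \<open>(1 - A) A (1 - A)\<close>; the two inequalities in the proof
  are their quadratic forms.\<close>

lemma A_square_le:
  assumes x: "x \<in> S"
  shows "g (A x) (A x) \<le> g (A x) x"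
proof -
  have "0 \<le> g (A x - A (A x)) (A x)"
    using A_le[of "A x"] x by (simp add: g_diff_left A_closed)
  moreover have "0 \<le> g (A x - A (A x)) (x - A x)"
    using A_pos[of "x - A x"] x by (simp add: A_diff A_closed S_closed)
  ultimately have "0 \<le> g (A x - A (A x)) x"
    using x by (simp add: g_diff_right A_closed S_closed)
  then show ?thesis
    using x A_sym[of "A x" x] by (simp add: g_diff_left A_closed S_closed)
qed

lemma N_A_le: "x \<in> S \<Longrightarrow> N (A x) \<le> N x"
  using A_square_le[of x] A_le[of x] g_self[of x] g_self[OF A_closed, of x]
  by (intro power2_le_imp_le[of "N (A x)" "N x"]) (simp_all add: N_nonneg del: power_mono_iff)

lemma pow_closed: "x \<in> S \<Longrightarrow> (A ^^ n) x \<in> S"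
  by (induction n) (auto simp: A_closed)

lemma complement: "positive_contraction sc S N (\<lambda>x. x - A x)"
proof
  fix x y c assume "x \<in> S" "y \<in> S"
  then show "g (x - A x) y = g x (y - A y)"
    by (simp add: g_diff_left g_diff_right A_closed A_sym)
qed (use A_pos A_le in \<open>auto simp: A_closed S_closed A_add A_scale scale_right_diff_distrib g_diff_left\<close>)

lemma minus_square: "positive_contraction sc S N (\<lambda>x. A x - A (A x))"
proof
  fix x y assume xy: "x \<in> S" "y \<in> S"
  show "g (A x - A (A x)) y = g x (A y - A (A y))"
    using xy by (simp add: g_diff_left g_diff_right A_closed A_sym)
  show "0 \<le> g (A x - A (A x)) x"
    using A_square_le[of x] xy by (simp add: g_diff_left A_closed A_sym)
  have "0 \<le> g (A (A x)) x"
    using xy A_sym[of "A x" x] by (simp add: A_closed g_self)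
  then show "g (A x - A (A x)) x \<le> g x x"
    using A_le[of x] xy by (simp add: g_diff_left A_closed)
qed (auto simp: A_closed S_closed A_add A_scale scale_right_diff_distrib)

end

definition compatible_form ::
    "'v::ab_group_add set \<Rightarrow> ('v \<Rightarrow> real) \<Rightarrow> ('v \<Rightarrow> 'v) \<Rightarrow> ('v \<Rightarrow> 'v \<Rightarrow> real) \<Rightarrow> bool" where
  "compatible_form S N A F \<longleftrightarrow>
     (\<forall>x\<in>S. \<forall>y\<in>S. \<forall>z\<in>S. F (x + y) z = F x z + F y z) \<and>
     (\<forall>x\<in>S. \<forall>y\<in>S. F x y = F y x) \<and>
     (\<forall>x\<in>S. \<forall>y\<in>S. F (A x) y = F x (A y)) \<and>
     (\<exists>C\<ge>0. \<forall>x\<in>S. \<forall>y\<in>S. \<bar>F x y\<bar> \<le> C * N x * N y)"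

context positive_contraction
begin

context
  fixes F assumes F: "compatible_form S N A F"
begin

lemma F_add: "x \<in> S \<Longrightarrow> y \<in> S \<Longrightarrow> z \<in> S \<Longrightarrow> F (x + y) z = F x z + F y z"
  using F unfolding compatible_form_def by blast

lemma F_com: "x \<in> S \<Longrightarrow> y \<in> S \<Longrightarrow> F x y = F y x"
  using F unfolding compatible_form_def by blast

lemma F_sym: "x \<in> S \<Longrightarrow> y \<in> S \<Longrightarrow> F (A x) y = F x (A y)"
  using F unfolding compatible_form_def by blast

lemma F_bound: "\<exists>C\<ge>0. \<forall>x\<in>S. \<forall>y\<in>S. \<bar>F x y\<bar> \<le> C * N x * N y"
  using F unfolding compatible_form_def by blast

lemma F_diff: "x \<in> S \<Longrightarrow> y \<in> S \<Longrightarrow> z \<in> S \<Longrightarrow> F (x - y) z = F x z - F y z"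
  using F_add[of "x - y" y z] by (simp add: S_closed)

lemma F_diff_right: "x \<in> S \<Longrightarrow> y \<in> S \<Longrightarrow> z \<in> S \<Longrightarrow> F z (x - y) = F z x - F z y"
  using F_diff[of x y z] F_com[of "x - y" z] F_com[of x z] F_com[of y z] by (simp add: S_closed)

lemma F_add_right: "x \<in> S \<Longrightarrow> y \<in> S \<Longrightarrow> z \<in> S \<Longrightarrow> F z (x + y) = F z x + F z y"
  using F_add[of x y z] F_com[of "x + y" z] F_com[of x z] F_com[of y z] by (simp add: S_closed)

lemma compatible_form_complement: "compatible_form S N (\<lambda>x. x - A x) F"
  unfolding compatible_form_def
proof (intro conjI ballI)
  show "F x y = F y x" if "x \<in> S" "y \<in> S" for x y
    using that by (rule F_com)
qed (use F_bound in \<open>simp_all add: F_add F_diff F_diff_right F_sym A_closed\<close>)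

lemma compatible_form_minus_square: "compatible_form S N (\<lambda>x. A x - A (A x)) F"
  unfolding compatible_form_def
proof (intro conjI ballI)
  show "F x y = F y x" if "x \<in> S" "y \<in> S" for x y
    using that by (rule F_com)
qed (use F_bound in \<open>simp_all add: F_add F_diff F_diff_right F_sym A_closed\<close>)

lemma compatible_form_A: "compatible_form S N A (\<lambda>x. F (A x))"
proof -
  obtain C where C: "C \<ge> 0" "\<And>x y. x \<in> S \<Longrightarrow> y \<in> S \<Longrightarrow> \<bar>F x y\<bar> \<le> C * N x * N y"
    using F_bound by blast
  have "\<bar>F (A x) y\<bar> \<le> C * N x * N y" if "x \<in> S" "y \<in> S" for x y
    using C(2)[of "A x" y] N_A_le[of x] that C(1)
    by (meson A_closed N_nonneg mult_left_mono mult_right_mono order_trans)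
  moreover have "F (A x) y = F (A y) x" if "x \<in> S" "y \<in> S" for x y
    using that F_sym F_com by (metis A_closed)
  ultimately show ?thesis
    using C(1) unfolding compatible_form_def
    by (auto simp: A_closed A_add F_add F_sym)
qed

end

end

text \<open>Riesz's argument: \<open>A\<^sub>0 = A\<close> and \<open>A\<^sub>k\<^sub>+\<^sub>1 = A\<^sub>k - A\<^sub>k\<^sup>2\<close> are positive contractions tending strongly to \<open>0\<close>, and \<open>A\<close>
  is the sum of the squares \<open>A\<^sub>k\<^sup>2\<close>.\<close>

lemma (in positive_contraction) compatible_form_A_nonneg:
  assumes F: "compatible_form S N A F" and nonneg: "\<And>x. x \<in> S \<Longrightarrow> 0 \<le> F x x" and x: "x \<in> S"
  shows "0 \<le> F (A x) x"
proof -
  define B where "B = rec_nat A (\<lambda>_ T y. T y - T (T y))"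
  have B0: "B 0 = A" and BS: "B (Suc k) = (\<lambda>y. B k y - B k (B k y))" for k
    by (simp_all add: B_def)
  have pc: "positive_contraction sc S N (B k) \<and> compatible_form S N (B k) F" for k
  proof (induction k)
    case 0
    show ?case using F positive_contraction_axioms by (simp add: B0)
  next
    case (Suc k)
    then interpret B: positive_contraction sc S N "B k" by simp
    show ?case
      using Suc B.minus_square B.compatible_form_minus_square by (simp add: BS)
  qed
  then have Bc: "B k x \<in> S" for k
    using positive_contraction.A_closed x by blast
  have FB: "F (B k (B k x)) x = F (B k x) (B k x)" and gB: "g (B k (B k x)) x = (N (B k x))\<^sup>2" for k
  proof -
    interpret B: positive_contraction sc S N "B k" using pc by simp
    show "F (B k (B k x)) x = F (B k x) (B k x)"
      using pc x Bc by (intro B.F_sym) auto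
    show "g (B k (B k x)) x = (N (B k x))\<^sup>2"
      using x Bc by (simp add: B.A_sym g_self)
  qed
  have BBc: "B k (B k x) \<in> S" for k
    using pc Bc positive_contraction.A_closed by blast
  have sumF: "F (A x) x = (\<Sum>k<n. F (B k x) (B k x)) + F (B n x) x" for n
    by (induction n) (use x Bc BBc in \<open>simp_all add: B0 BS F_diff[OF F] FB\<close>)
  \<comment> \<open>The same telescoping for \<open>g\<close> bounds the sum of the squares of
    \<open>N (B k x)\<close>. Hence \<open>B n x\<close> tends to \<open>0\<close>, and so does the
    remainder in \<open>sumF\<close>.\<close>
  have sumg: "g (A x) x = (\<Sum>k<n. (N (B k x))\<^sup>2) + g (B n x) x" for n
    by (induction n) (use x Bc BBc in \<open>simp_all add: B0 BS g_diff_left gB\<close>)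
  have "(\<Sum>k<n. (N (B k x))\<^sup>2) \<le> g (A x) x" for n
    using sumg[of n] pc[of n] x positive_contraction.A_pos[of sc S N "B n" x] by simp
  then have "summable (\<lambda>k. (N (B k x))\<^sup>2)"
    by (intro summableI_nonneg_bounded[where x = "g (A x) x"]) auto
  then have "(\<lambda>k. sqrt ((N (B k x))\<^sup>2)) \<longlonglongrightarrow> sqrt 0"
    by (intro tendsto_real_sqrt summable_LIMSEQ_zero)
  then have lim: "(\<lambda>k. N (B k x)) \<longlonglongrightarrow> 0"
    using N_nonneg[OF Bc] by simp
  obtain C where C: "\<And>y. y \<in> S \<Longrightarrow> \<bar>F y x\<bar> \<le> C * N y * N x"
    using F_bound[OF F] x by blast
  have "(\<lambda>k. F (B k x) x) \<longlonglongrightarrow> 0"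
  proof (rule Lim_null_comparison)
    show "\<forall>\<^sub>F k in sequentially. norm (F (B k x) x) \<le> C * N (B k x) * N x"
      using C Bc by simp
    show "(\<lambda>k. C * N (B k x) * N x) \<longlonglongrightarrow> 0"
      using tendsto_mult_right_zero[OF tendsto_mult_left_zero[OF lim, of "N x"], of C] by (simp add: mult_ac)
  qed
  moreover have "F (B k x) x \<le> F (A x) x" for k
    using sumF[of k] sum_nonneg[of "{..<k}" "\<lambda>k. F (B k x) (B k x)"] nonneg Bc by simp
  ultimately show ?thesis
    by (intro LIMSEQ_le_const2) auto
qed

context positive_contraction
begin

interpretation I: positive_contraction sc S N "\<lambda>x. x - A x"
  by (rule complement)

abbreviation (input) co where "co \<equiv> (\<lambda>x. x - A x)"

lemma co_A: "x \<in> S \<Longrightarrow> co (A x) = A (co x)"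
  by (simp add: A_diff A_closed)

lemma monomial_closed: "x \<in> S \<Longrightarrow> (A ^^ j) ((co ^^ m) x) \<in> S"
  by (intro pow_closed I.pow_closed)

lemma A_pow_co: "x \<in> S \<Longrightarrow> (A ^^ j) (co x) = co ((A ^^ j) x)"
  by (induction j) (simp_all add: A_diff A_closed pow_closed)

lemma co_monomial: "x \<in> S \<Longrightarrow> co ((A ^^ j) ((co ^^ m) x)) = (A ^^ j) ((co ^^ Suc m) x)"
  using A_pow_co[OF I.pow_closed, of x j m] by simp

text \<open>A product of commuting positive operators is positive: each factor \<open>A\<close> or
  \<open>1 - A\<close> is absorbed into the form by one use of Riesz's argument, which is why the
  induction varies \<open>F\<close>.\<close>

lemma compatible_form_monomial_nonneg:
  assumes "compatible_form S N A F" "\<And>x. x \<in> S \<Longrightarrow> 0 \<le> F x x" "x \<in> S"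
  shows "0 \<le> F ((A ^^ j) ((co ^^ m) x)) x"
  using assms(1,2)
proof (induction j arbitrary: F)
  case 0
  then show ?case
  proof (induction m arbitrary: F)
    case 0
    then show ?case using assms(3) by simp
  next
    case (Suc m)
    have cf: "compatible_form S N co F" by (rule compatible_form_complement) fact
    have "compatible_form S N co (\<lambda>y. F (co y))" by (rule I.compatible_form_A[OF cf])
    then have "compatible_form S N (\<lambda>x. co x) (\<lambda>y. F (co y))" .
    from I.compatible_form_complement[OF this]
    have "compatible_form S N A (\<lambda>y. F (co y))" by simp
    moreover have "0 \<le> F (co y) y" if "y \<in> S" for y
      by (rule I.compatible_form_A_nonneg[OF cf Suc.prems(2) that])
    ultimately have "0 \<le> F (co ((A ^^ 0) ((co ^^ m) x))) x" by (rule Suc.IH)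
    then show ?case by simp
  qed
next
  case (Suc j)
  have "compatible_form S N A (\<lambda>y. F (A y))" by (rule compatible_form_A) fact
  moreover have "0 \<le> F (A y) y" if "y \<in> S" for y
    by (rule compatible_form_A_nonneg[OF Suc.prems that])
  ultimately have "0 \<le> F (A ((A ^^ j) ((co ^^ m) x))) x" by (rule Suc.IH)
  then show ?case by simp
qed

lemma compatible_form_g: "compatible_form S N A g"
  unfolding compatible_form_def
proof (intro conjI ballI exI[of _ 1])
  show "g x y = g y x" if "x \<in> S" "y \<in> S" for x y
    using that by (rule g_commute)
qed (use Cauchy_Schwarz in \<open>simp_all add: g_add_left A_sym\<close>)

lemma compatible_form_diff:
  assumes F: "compatible_form S N A F" and G: "compatible_form S N A G"
  shows "compatible_form S N A (\<lambda>x y. F x y - G x y)"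
  unfolding compatible_form_def
proof (intro conjI ballI)
  show "F x y - G x y = F y x - G y x" if "x \<in> S" "y \<in> S" for x y
    using F_com[OF F that] F_com[OF G that] by simp
  obtain C D where "C \<ge> 0" "D \<ge> 0"
    and C: "\<And>x y. x \<in> S \<Longrightarrow> y \<in> S \<Longrightarrow> \<bar>F x y\<bar> \<le> C * N x * N y"
    and D: "\<And>x y. x \<in> S \<Longrightarrow> y \<in> S \<Longrightarrow> \<bar>G x y\<bar> \<le> D * N x * N y"
    using F_bound[OF F] F_bound[OF G] by blast
  have "\<bar>F x y - G x y\<bar> \<le> (C + D) * N x * N y" if "x \<in> S" "y \<in> S" for x y
    using C[OF that] D[OF that] by (simp add: algebra_simps)
  then show "\<exists>C\<ge>0. \<forall>x\<in>S. \<forall>y\<in>S. \<bar>F x y - G x y\<bar> \<le> C * N x * N y"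
    using \<open>C \<ge> 0\<close> \<open>D \<ge> 0\<close> by (intro exI[of _ "C + D"]) auto
qed (simp_all add: F_add[OF F] F_add[OF G] F_sym[OF F] F_sym[OF G])

lemma compatible_form_cmult:
  assumes F: "compatible_form S N A F" and "c \<ge> 0"
  shows "compatible_form S N A (\<lambda>x y. c * F x y)"
  unfolding compatible_form_def
proof (intro conjI ballI)
  show "c * F x y = c * F y x" if "x \<in> S" "y \<in> S" for x y
    using F_com[OF F that] by simp
  obtain C where "C \<ge> 0" and C: "\<And>x y. x \<in> S \<Longrightarrow> y \<in> S \<Longrightarrow> \<bar>F x y\<bar> \<le> C * N x * N y"
    using F_bound[OF F] by blast
  have "\<bar>c * F x y\<bar> \<le> (c * C) * N x * N y" if "x \<in> S" "y \<in> S" for x y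
    using mult_left_mono[OF C[OF that] \<open>c \<ge> 0\<close>] \<open>c \<ge> 0\<close> by (simp add: abs_mult mult_ac)
  then show "\<exists>C\<ge>0. \<forall>x\<in>S. \<forall>y\<in>S. \<bar>c * F x y\<bar> \<le> C * N x * N y"
    using \<open>C \<ge> 0\<close> \<open>c \<ge> 0\<close> by (intro exI[of _ "c * C"]) auto
qed (simp_all add: F_add[OF F] F_sym[OF F] algebra_simps)

text \<open>The form of \<open>(A - r)\<^sup>2\<close>, expanded into forms known to be
  compatible.\<close>

definition shift_form :: "real \<Rightarrow> 'a \<Rightarrow> 'a \<Rightarrow> real" where
  "shift_form r x y = g (A (A x)) y - 2 * r * g (A x) y + r\<^sup>2 * g x y"

lemma shift_form_self: "x \<in> S \<Longrightarrow> shift_form r x x = (N (A x - sc (of_real r) x))\<^sup>2"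
  using A_sym[of "A x" x]
  by (simp add: shift_form_def N_diff_sq S_closed A_closed g_scale_right N_scale power_mult_distrib g_self)

lemma compatible_form_shift_form: "compatible_form S N A (shift_form r)"
proof -
  note g0 = compatible_form_g
  note g1 = compatible_form_A[OF g0]
  note g2 = compatible_form_A[OF g1]
  \<comment> \<open>A sum \<open>F + G\<close> is written as \<open>F - (0 * F - G)\<close>, since
    the combinations at hand are differences and multiples by \<open>c \<ge> 0\<close>. The latter
    also causes the case distinction on the sign of \<open>r\<close>.\<close>
  have "compatible_form S N A (\<lambda>x y. r\<^sup>2 * g x y - (0 * g x y - g (A (A x)) y))"
    by (intro compatible_form_diff compatible_form_cmult g0 g2) auto
  then have a: "compatible_form S N A (\<lambda>x y. g (A (A x)) y + r\<^sup>2 * g x y)"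
    by (simp add: add.commute)
  show ?thesis
  proof (cases "r \<ge> 0")
    case True
    have "compatible_form S N A (\<lambda>x y. (g (A (A x)) y + r\<^sup>2 * g x y) - 2 * r * g (A x) y)"
      using True by (intro compatible_form_diff a compatible_form_cmult g1) auto
    then show ?thesis by (simp add: shift_form_def[abs_def] algebra_simps)
  next
    case False
    have "compatible_form S N A (\<lambda>x y. (g (A (A x)) y + r\<^sup>2 * g x y) - (0 * g (A x) y - (- 2 * r) * g (A x) y))"
      using False by (intro compatible_form_diff a compatible_form_cmult g1) auto
    then show ?thesis by (simp add: shift_form_def[abs_def] algebra_simps)
  qed
qed

text \<open>The moments are \<open>E (w j m) x\<close> and \<open>g (w j m) x\<close>. Their Pascal
  rule is 1 = A + (1 - A); the two inequalities required of them say that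
  \<open>shift_form r\<close> and its multiple minus \<open>E\<close> stay positive after
  multiplication by monomials. The moment \<open>E (w 2 2) x\<close> is the value claimed because
  the factors of \<open>w 2 2\<close> can be shared between the two arguments.\<close>

lemma compatible_form_nonpos_on_range:
  assumes E: "compatible_form S N A E"
    and bound: "\<And>r x. 0 < r \<Longrightarrow> r < 1 \<Longrightarrow> x \<in> S \<Longrightarrow>
      E x x \<le> (N (A x - sc (of_real r) x))\<^sup>2 / (r * (1 - r))\<^sup>2"
    and x: "x \<in> S"
  shows "E (A (co x)) (A (co x)) \<le> 0"
proof -
  define w where "w j m = (A ^^ j) ((co ^^ m) x)" for j m
  have w: "w j m \<in> S" for j m unfolding w_def by (rule monomial_closed[OF x])
  have Aw: "A (w j m) = w (Suc j) m" for j m by (simp add: w_def)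
  have split: "w j m = w (Suc j) m + w j (Suc m)" for j m
  proof -
    have "co (w j m) = w j (Suc m)" unfolding w_def by (rule co_monomial[OF x])
    then show ?thesis by (simp add: Aw algebra_simps)
  qed
  have pascal: "F (w j m) x = F (w (Suc j) m) x + F (w j (Suc m)) x" if "compatible_form S N A F" for F j m
    by (subst split) (rule F_add[OF that w w x])
  have sf: "shift_form r (w j m) x = g (w (j + 2) m) x - 2 * r * g (w (j + 1) m) x + r\<^sup>2 * g (w j m) x" for r j m
    by (simp add: shift_form_def Aw)
  have "E (w 2 2) x \<le> 0"
  proof (rule moment_nonpos[where l = "\<lambda>j m. g (w j m) x" and e = "\<lambda>j m. E (w j m) x"])
    fix r :: real and j m
    show "0 \<le> g (w (j + 2) m) x - 2 * r * g (w (j + 1) m) x + r\<^sup>2 * g (w j m) x"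
      using compatible_form_monomial_nonneg[OF compatible_form_shift_form _ x, of r j m]
      unfolding w_def by (simp add: shift_form_self) (simp add: shift_form_def)
  next
    fix r :: real and j m assume r: "0 < r" "r < 1"
    define M where "M = 1 / (r * (1 - r))\<^sup>2"
    have "M \<ge> 0" by (simp add: M_def)
    have cf: "compatible_form S N A (\<lambda>x y. M * shift_form r x y - E x y)"
      using \<open>M \<ge> 0\<close> by (intro compatible_form_diff compatible_form_cmult compatible_form_shift_form E)
    have "0 \<le> M * shift_form r (w j m) x - E (w j m) x"
      unfolding w_def
    proof (rule compatible_form_monomial_nonneg[OF cf _ x])
      show "0 \<le> M * shift_form r y y - E y y" if "y \<in> S" for y
        using bound[OF r that] that by (simp add: shift_form_self M_def)
    qed
    then show "E (w j m) x \<le> (g (w (j + 2) m) x - 2 * r * g (w (j + 1) m) x + r\<^sup>2 * g (w j m) x) / (r * (1 - r))\<^sup>2"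
      unfolding sf by (simp add: M_def)
  qed (use pascal E compatible_form_g in auto)
  moreover have "E (w 2 2) x = E (A (co x)) (A (co x))"
  proof -
    have Ico: "compatible_form S N co E" by (rule compatible_form_complement[OF E])
    have "w 2 2 = A (co (A (co x)))"
      using x by (simp add: w_def numeral_2_eq_2 A_diff A_closed S_closed)
    then show ?thesis
      using x F_sym[OF E, of "co (A (co x))" x] I.F_sym[OF Ico, of "A (co x)" "A x"] co_A[OF x]
      by (simp add: A_closed S_closed)
  qed
  ultimately show ?thesis by simp
qed

section \<open>Powers of \<open>A\<close> and the density of the range of
  \<open>A (1 - A)\<close>\<close>

lemma pow_diff: "x \<in> S \<Longrightarrow> y \<in> S \<Longrightarrow> (A ^^ n) (x - y) = (A ^^ n) x - (A ^^ n) y"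
  by (induction n) (simp_all add: A_diff pow_closed)

lemma pow_add_sym: "x \<in> S \<Longrightarrow> g ((A ^^ m) x) ((A ^^ n) x) = g ((A ^^ (m + n)) x) x"
proof (induction n arbitrary: m)
  case (Suc n)
  have "g ((A ^^ m) x) ((A ^^ Suc n) x) = g ((A ^^ Suc m) x) ((A ^^ n) x)"
    using Suc.prems by (simp add: A_sym pow_closed)
  also have "\<dots> = g ((A ^^ (m + Suc n)) x) x"
    using Suc.IH[of "Suc m"] Suc.prems by simp
  finally show ?case .
qed simp

text \<open>The powers converge strongly to a fixed point of \<open>A\<close>. Indeed
  \<open>l n = g ((A ^^ n) x) x\<close> decreases and is nonnegative, and
  \<open>(N ((A ^^ m) x - (A ^^ n) x))\<^sup>2\<close> is a second difference of \<open>l\<close>,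
  so the sequence is Cauchy.\<close>

lemma power_tendsto_0:
  assumes complete: "\<And>s. range s \<subseteq> S \<Longrightarrow> (\<forall>e>0. \<exists>M. \<forall>m\<ge>M. \<forall>n\<ge>M. N (s m - s n) < e) \<Longrightarrow>
        \<exists>l\<in>S. (\<lambda>n. N (s n - l)) \<longlonglongrightarrow> 0"
    and fixpoint: "\<And>z. z \<in> S \<Longrightarrow> N (A z - z) = 0 \<Longrightarrow> N z = 0"
    and x: "x \<in> S"
  shows "(\<lambda>n. N ((A ^^ n) x)) \<longlonglongrightarrow> 0"
proof -
  define l where "l n = g ((A ^^ n) x) x" for n
  have "0 \<le> l n" for n
    using compatible_form_monomial_nonneg[OF compatible_form_g _ x, of n 0]
    by (simp add: l_def g_self)
  moreover have "l (Suc n) \<le> l n" for n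
    using compatible_form_monomial_nonneg[OF compatible_form_g _ x, of n 1] x A_pow_co[OF x, of n]
    by (simp add: l_def g_self g_diff_left A_closed pow_closed)
  ultimately obtain L where "l \<longlonglongrightarrow> L"
    using decseq_convergent[of l 0] decseq_SucI[of l] by blast
  then have "Cauchy l" by (rule LIMSEQ_imp_Cauchy)
  have diff: "(N ((A ^^ m) x - (A ^^ n) x))\<^sup>2 = (l (m + m) - l (m + n)) + (l (n + n) - l (m + n))" for m n
    using x by (simp add: N_diff_sq pow_closed g_self[symmetric] pow_add_sym l_def)
  have "\<exists>M. \<forall>m\<ge>M. \<forall>n\<ge>M. N ((A ^^ m) x - (A ^^ n) x) < e" if "e > 0" for e
  proof -
    obtain M where M: "\<And>m n. m \<ge> M \<Longrightarrow> n \<ge> M \<Longrightarrow> dist (l m) (l n) < e\<^sup>2 / 2"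
      using metric_CauchyD[OF \<open>Cauchy l\<close>, of "e\<^sup>2 / 2"] \<open>e > 0\<close> by (metis half_gt_zero zero_less_power)
    have "N ((A ^^ m) x - (A ^^ n) x) < e" if "m \<ge> M" "n \<ge> M" for m n
    proof -
      have "(N ((A ^^ m) x - (A ^^ n) x))\<^sup>2 < e\<^sup>2"
        using M[of "m + m" "m + n"] M[of "n + n" "m + n"] that unfolding diff dist_real_def by linarith
      then show ?thesis using \<open>e > 0\<close> by (simp add: power_less_imp_less_base)
    qed
    then show ?thesis by blast
  qed
  then obtain z where z: "z \<in> S" "(\<lambda>n. N ((A ^^ n) x - z)) \<longlonglongrightarrow> 0"
    using complete[of "\<lambda>n. (A ^^ n) x"] pow_closed[OF x] by blast
  have "N (A z - z) \<le> N ((A ^^ n) x - z) + N ((A ^^ Suc n) x - z)" for n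
  proof -
    have "A z - z = A (z - (A ^^ n) x) + ((A ^^ Suc n) x - z)"
      using x z by (simp add: A_diff pow_closed)
    then have "N (A z - z) \<le> N (A (z - (A ^^ n) x)) + N ((A ^^ Suc n) x - z)"
      using x z N_triangle[of "A (z - (A ^^ n) x)" "(A ^^ Suc n) x - z"]
      by (simp add: A_closed pow_closed S_closed add_diff_eq)
    also have "N (A (z - (A ^^ n) x)) \<le> N ((A ^^ n) x - z)"
      using N_A_le[of "z - (A ^^ n) x"] N_minus_commute[of z "(A ^^ n) x"] x z
      by (simp add: pow_closed S_closed)
    finally show ?thesis by simp
  qed
  moreover have "(\<lambda>n. N ((A ^^ n) x - z) + N ((A ^^ Suc n) x - z)) \<longlonglongrightarrow> 0 + 0"
    using LIMSEQ_Suc[OF z(2)] z(2) by (intro tendsto_add)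
  ultimately have "N (A z - z) \<le> 0" by (intro LIMSEQ_le_const) auto
  then have "N z = 0"
    using fixpoint[OF z(1)] N_nonneg[of "A z - z"] z A_closed S_closed by auto
  moreover have "N ((A ^^ n) x) \<le> N ((A ^^ n) x - z) + N z" for n
    using N_triangle[of "(A ^^ n) x - z" z] x z by (simp add: pow_closed S_closed)
  ultimately show ?thesis
    using N_nonneg x pow_closed z(2)
    by (intro real_tendsto_sandwich[OF _ _ tendsto_const z(2)]) auto
qed

text \<open>The geometric sum: 1 - A^n is 1 - A applied to 1 + A + ... + A^(n-1).\<close>

lemma id_minus_power_range: "x \<in> S \<Longrightarrow> \<exists>u\<in>S. x - (A ^^ n) x = u - A u"
proof (induction n)
  case 0
  then show ?case using S_closed A_diff[of x x] by (intro bexI[of _ 0]) auto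
next
  case (Suc n)
  then obtain u where u: "u \<in> S" "x - (A ^^ n) x = u - A u" by blast
  have "x - (A ^^ Suc n) x = (x - (A ^^ n) x) + ((A ^^ n) x - A ((A ^^ n) x))" by simp
  also have "\<dots> = (u + (A ^^ n) x) - A (u + (A ^^ n) x)"
    using u Suc.prems by (simp add: A_add pow_closed)
  finally show ?case using u Suc.prems by (intro bexI[of _ "u + (A ^^ n) x"]) (auto simp: S_closed pow_closed)
qed

end

context positive_contraction
begin

interpretation I: positive_contraction sc S N "\<lambda>x. x - A x"
  by (rule complement)

text \<open>The range of \<open>A (1 - A)\<close> is dense because it contains \<open>(1 - A\<^sup>n) (1 - (1 - A)\<^sup>n) x\<close>.\<close>

lemma compatible_form_nonpos:
  assumes complete: "\<And>s. range s \<subseteq> S \<Longrightarrow> (\<forall>e>0. \<exists>M. \<forall>m\<ge>M. \<forall>n\<ge>M. N (s m - s n) < e) \<Longrightarrow>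
        \<exists>l\<in>S. (\<lambda>n. N (s n - l)) \<longlonglongrightarrow> 0"
    and inj: "\<And>z. z \<in> S \<Longrightarrow> N (A z) = 0 \<Longrightarrow> N z = 0"
    and inj': "\<And>z. z \<in> S \<Longrightarrow> N (A z - z) = 0 \<Longrightarrow> N z = 0"
    and E: "compatible_form S N A E"
    and bound: "\<And>r x. 0 < r \<Longrightarrow> r < 1 \<Longrightarrow> x \<in> S \<Longrightarrow>
      E x x \<le> (N (A x - sc (of_real r) x))\<^sup>2 / (r * (1 - r))\<^sup>2"
    and x: "x \<in> S"
  shows "E x x \<le> 0"
proof -
  \<comment> \<open>Bounds the distance of \<open>x\<close> to
    \<open>y = (1 - A\<^sup>n) (1 - (1 - A)\<^sup>n) x\<close>: the error is \<open>(1 - A)\<^sup>n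
    x + A\<^sup>n x - A\<^sup>n (1 - A)\<^sup>n x\<close>, and the last term is at most
    \<open>N ((co ^^ n) x)\<close> by contractivity.\<close>
  define d where "d n = N ((A ^^ n) x) + 2 * N ((co ^^ n) x)" for n
  obtain C where "C \<ge> 0" and C: "\<And>x y. x \<in> S \<Longrightarrow> y \<in> S \<Longrightarrow> \<bar>E x y\<bar> \<le> C * N x * N y"
    using F_bound[OF E] by blast
  have contr: "N ((A ^^ n) y) \<le> N y" if "y \<in> S" for n y
    by (induction n) (use N_A_le[OF pow_closed[OF that]] in \<open>auto intro: order_trans\<close>)
  have est: "E x x \<le> C * (2 * (N x + d n) * d n + (d n)\<^sup>2)" for n
  proof -
    obtain u where u: "u \<in> S" "x - (co ^^ n) x = A u"
      using I.id_minus_power_range[OF x, of n] by auto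
    obtain w where w: "w \<in> S" "u - (A ^^ n) u = co w"
      using id_minus_power_range[OF u(1), of n] by auto
    define y where "y = A (co w)"
    define \<delta> where "\<delta> = x - y"
    have yS: "y \<in> S" "\<delta> \<in> S"
      using w x by (auto simp: y_def \<delta>_def A_closed S_closed)
    have "\<delta> = (co ^^ n) x + (A ^^ n) (x - (co ^^ n) x)"
      unfolding \<delta>_def y_def w(2)[symmetric] u(2)
      using u x by (simp add: A_diff pow_closed funpow_swap1 algebra_simps)
    then have "N \<delta> \<le> N ((co ^^ n) x) + N ((A ^^ n) (x - (co ^^ n) x))"
      using N_triangle[of "(co ^^ n) x" "(A ^^ n) (x - (co ^^ n) x)"] x
      by (simp add: pow_closed I.pow_closed S_closed)
    also have "(A ^^ n) (x - (co ^^ n) x) = (A ^^ n) x - (A ^^ n) ((co ^^ n) x)"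
      by (rule pow_diff[OF x I.pow_closed[OF x]])
    also have "N \<dots> \<le> N ((A ^^ n) x) + N ((co ^^ n) x)"
      using N_diff_triangle[of "(A ^^ n) x" "(A ^^ n) ((co ^^ n) x)"] contr[of "(co ^^ n) x" n] x
      by (simp add: pow_closed I.pow_closed)
    finally have d: "N \<delta> \<le> d n" by (simp add: d_def)
    have "N y \<le> N x + N \<delta>"
      using N_diff_triangle[of x \<delta>] x yS by (simp add: \<delta>_def S_closed)
    then have y: "N y \<le> N x + d n" using d by simp
    have x_eq: "x = y + \<delta>" by (simp add: \<delta>_def)
    have "E x x = E y y + 2 * E y \<delta> + E \<delta> \<delta>"
      unfolding x_eq
      using yS F_com[OF E, of y \<delta>] by (simp add: F_add[OF E] F_add_right[OF E] S_closed)
    also have "\<dots> \<le> 0 + 2 * (C * N y * N \<delta>) + C * N \<delta> * N \<delta>"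
      using compatible_form_nonpos_on_range[OF E bound w(1)] C[of y \<delta>] C[of \<delta> \<delta>] yS
      unfolding y_def[symmetric] by auto
    also have "\<dots> = C * (2 * N y * N \<delta> + N \<delta> * N \<delta>)"
      by (simp add: algebra_simps)
    also have "\<dots> \<le> C * (2 * (N x + d n) * d n + d n * d n)"
      using \<open>C \<ge> 0\<close> d y N_nonneg[OF yS(1)] N_nonneg[OF yS(2)] N_nonneg[OF x]
      by (intro mult_left_mono add_mono mult_mono) auto
    finally show ?thesis by (simp add: power2_eq_square)
  qed
  have a: "(\<lambda>n. N ((A ^^ n) x)) \<longlonglongrightarrow> 0"
    by (rule power_tendsto_0[OF complete inj' x])
  have b: "(\<lambda>n. N ((co ^^ n) x)) \<longlonglongrightarrow> 0"
  proof (rule I.power_tendsto_0[OF complete _ x])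
    show "N z = 0" if "z \<in> S" "N (co z - z) = 0" for z
      using that inj[of z] N_minus[of "A z"] by (simp add: A_closed)
  qed
  have "d \<longlonglongrightarrow> 0"
    unfolding d_def using tendsto_add[OF a tendsto_mult_right_zero[OF b, of 2]] by simp
  then have "(\<lambda>n. C * (2 * (N x + d n) * d n + (d n)\<^sup>2)) \<longlonglongrightarrow> C * (2 * (N x + 0) * 0 + 0\<^sup>2)"
    by (intro tendsto_intros)
  then show ?thesis
    using est by (intro LIMSEQ_le_const[where X = "\<lambda>n. C * (2 * (N x + d n) * d n + (d n)\<^sup>2)"]) auto
qed

end

section \<open>The interpolation space given by the K-functional\<close>

locale hilbert_pair = vector_space sc
  for sc :: "complex \<Rightarrow> 'v::ab_group_add \<Rightarrow> 'v" +
  fixes H0 H1 :: "'v nspace"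
  assumes pair: "compatible_pair sc H0 H1"
begin

abbreviation "E0 \<equiv> elems H0"
abbreviation "E1 \<equiv> elems H1"
abbreviation "n0 \<equiv> nrm H0"
abbreviation "n1 \<equiv> nrm H1"
abbreviation "D \<equiv> E0 \<inter> E1"
abbreviation "\<Sigma> \<equiv> elems (Sigma_space H0 H1)"
abbreviation "n\<Sigma> \<equiv> nrm (Sigma_space H0 H1)"
abbreviation "n\<Delta> \<equiv> nrm (Delta_space H0 H1)"
abbreviation "K \<equiv> K_functional H0 H1"

sublocale X0: parallelogram_seminorm sc E0 n0
  using pair by (auto simp: compatible_pair_def intro: hilbert_on_parallelogram_seminorm)

sublocale X1: parallelogram_seminorm sc E1 n1
  using pair by (auto simp: compatible_pair_def intro: hilbert_on_parallelogram_seminorm)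

lemma normed_H0: "normed_on sc H0" and normed_H1: "normed_on sc H1"
  and normed_\<Sigma>: "normed_on sc (Sigma_space H0 H1)" and normed_\<Delta>: "normed_on sc (Delta_space H0 H1)"
  using pair by (auto simp: compatible_pair_def hilbert_on_def banach_on_def)

lemma banach_\<Sigma>: "banach_on sc (Sigma_space H0 H1)" and banach_\<Delta>: "banach_on sc (Delta_space H0 H1)"
  using pair by (auto simp: compatible_pair_def)

lemma elems_\<Delta>: "elems (Delta_space H0 H1) = D"
  by (simp add: Delta_space_def)

lemma n\<Delta>_eq: "n\<Delta> x = max (n0 x) (n1 x)"
  by (simp add: Delta_space_def)

lemma \<Sigma>_iff: "x \<in> \<Sigma> \<longleftrightarrow> (\<exists>x0\<in>E0. \<exists>x1\<in>E1. x = x0 + x1)"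
  by (auto simp: Sigma_space_def)

lemma \<Sigma>I: "x0 \<in> E0 \<Longrightarrow> x1 \<in> E1 \<Longrightarrow> x0 + x1 \<in> \<Sigma>"
  by (auto simp: \<Sigma>_iff)

lemma \<Sigma>I0: "x \<in> E0 \<Longrightarrow> x \<in> \<Sigma>" and \<Sigma>I1: "x \<in> E1 \<Longrightarrow> x \<in> \<Sigma>"
  using \<Sigma>I[of x 0] \<Sigma>I[of 0 x] X0.S_closed(1) X1.S_closed(1) by auto

lemmas \<Sigma>_subspace = normed_onD(2)[OF normed_\<Sigma>]
lemmas \<Sigma>_closed = subspace_0[OF \<Sigma>_subspace] subspace_add[OF \<Sigma>_subspace] subspace_diff[OF \<Sigma>_subspace]
  subspace_neg[OF \<Sigma>_subspace] subspace_scale[OF \<Sigma>_subspace]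

lemma D_subspace: "subspace D"
  using X0.subsp X1.subsp by (rule subspace_inter)

lemmas D_closed = subspace_0[OF D_subspace] subspace_add[OF D_subspace] subspace_diff[OF D_subspace]
  subspace_neg[OF D_subspace] subspace_scale[OF D_subspace]

section \<open>The K-functional at a fixed t\<close>

definition cost :: "real \<Rightarrow> 'v \<Rightarrow> 'v \<Rightarrow> real" where
  "cost t x0 x1 = sqrt ((n0 x0)\<^sup>2 + t\<^sup>2 * (n1 x1)\<^sup>2)"

lemma cost_nonneg: "0 \<le> cost t x0 x1"
  by (simp add: cost_def)

lemma cost_sq: "(cost t x0 x1)\<^sup>2 = (n0 x0)\<^sup>2 + t\<^sup>2 * (n1 x1)\<^sup>2"
  by (simp add: cost_def)

lemma K_le:
  assumes "x0 \<in> E0" "x1 \<in> E1"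
  shows "K t (x0 + x1) \<le> cost t x0 x1"
  unfolding K_functional_def cost_def
  by (rule cINF_lower2[of _ _ "(x0, x1)"])
     (use assms in \<open>auto intro!: bdd_belowI2[of _ 0] simp: splittings_def\<close>)

lemma K_ge:
  assumes "x \<in> \<Sigma>" "\<And>x0 x1. x0 \<in> E0 \<Longrightarrow> x1 \<in> E1 \<Longrightarrow> x = x0 + x1 \<Longrightarrow> c \<le> cost t x0 x1"
  shows "c \<le> K t x"
  unfolding K_functional_def
  using assms by (intro cINF_greatest) (auto simp: splittings_def \<Sigma>_iff cost_def)

lemma K_split:
  assumes "x \<in> \<Sigma>" "K t x < c"
  obtains x0 x1 where "x0 \<in> E0" "x1 \<in> E1" "x = x0 + x1" "cost t x0 x1 < c"
  using K_ge[OF assms(1), of c t] assms(2) by (meson not_le)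

lemma K_nonneg: "x \<in> \<Sigma> \<Longrightarrow> 0 \<le> K t x"
  by (rule K_ge) (auto simp: cost_nonneg)

lemma K_sq_ge:
  assumes "x \<in> \<Sigma>" "\<And>x0 x1. x0 \<in> E0 \<Longrightarrow> x1 \<in> E1 \<Longrightarrow> x = x0 + x1 \<Longrightarrow> c \<le> (cost t x0 x1)\<^sup>2"
  shows "c \<le> (K t x)\<^sup>2"
proof (cases "c \<le> 0")
  case False
  have "sqrt c \<le> K t x"
    using assms by (intro K_ge) (auto intro: real_le_lsqrt cost_nonneg)
  then have "(sqrt c)\<^sup>2 \<le> (K t x)\<^sup>2" using False by (intro power_mono) auto
  then show ?thesis using False by simp
qed (auto intro: order_trans[OF _ zero_le_power2])

lemma K_sq_le: "x0 \<in> E0 \<Longrightarrow> x1 \<in> E1 \<Longrightarrow> (K t (x0 + x1))\<^sup>2 \<le> (cost t x0 x1)\<^sup>2"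
  by (intro power_mono K_le K_nonneg \<Sigma>I)

lemma K_le_n0: "x \<in> E0 \<Longrightarrow> K t x \<le> n0 x"
  using K_le[of x 0 t] X0.N_nonneg[of x] by (simp add: X1.S_closed X1.N_0 cost_def)

lemma K_le_n1: "x \<in> E1 \<Longrightarrow> 0 \<le> t \<Longrightarrow> K t x \<le> t * n1 x"
  using K_le[of 0 x t] X1.N_nonneg[of x] by (simp add: X0.S_closed X0.N_0 cost_def real_sqrt_mult)

lemma K_scale:
  assumes "x \<in> \<Sigma>"
  shows "K t (sc c x) = cmod c * K t x"
proof -
  have le: "K t (sc c x) \<le> cmod c * K t x" if "c \<noteq> 0" "x \<in> \<Sigma>" for c x
  proof -
    have "K t (sc c x) / cmod c \<le> K t x"
    proof (rule K_ge)
      fix x0 x1 assume x: "x0 \<in> E0" "x1 \<in> E1" "x = x0 + x1"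
      have "cost t (sc c x0) (sc c x1) = cmod c * cost t x0 x1"
        using x by (simp add: cost_def X0.N_scale X1.N_scale power_mult_distrib
            distrib_left[symmetric] mult.left_commute[of "t\<^sup>2"] real_sqrt_mult)
      then show "K t (sc c x) / cmod c \<le> cost t x0 x1"
        using K_le[of "sc c x0" "sc c x1" t] x that(1)
        by (simp add: X0.S_closed X1.S_closed scale_right_distrib field_simps)
    qed fact
    then show ?thesis using that by (simp add: field_simps)
  qed
  show ?thesis
  proof (cases "c = 0")
    case True
    then show ?thesis
      using K_le_n0[of 0 t] K_nonneg[of 0 t] X0.S_closed(1) \<Sigma>_closed(1) by (simp add: X0.N_0)
  next
    case False
    have "K t x \<le> K t (sc c x) / cmod c"
      using le[of "inverse c" "sc c x"] False assms by (simp add: \<Sigma>_closed norm_inverse divide_inverse mult.commute)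
    then show ?thesis using le[OF False assms] False by (simp add: field_simps)
  qed
qed

lemma K_minus: "x \<in> \<Sigma> \<Longrightarrow> K t (- x) = K t x"
  using K_scale[of x t "-1"] by simp

lemma cost_triangle:
  assumes "x0 \<in> E0" "x1 \<in> E1" "y0 \<in> E0" "y1 \<in> E1"
  shows "cost t (x0 + y0) (x1 + y1) \<le> cost t x0 x1 + cost t y0 y1"
proof -
  have "cost t (x0 + y0) (x1 + y1) \<le> sqrt ((n0 x0 + n0 y0)\<^sup>2 + (\<bar>t\<bar> * n1 x1 + \<bar>t\<bar> * n1 y1)\<^sup>2)"
    unfolding cost_def power_mult_distrib distrib_left[symmetric] power2_abs
    using assms X0.N_triangle X1.N_triangle X0.N_nonneg X1.N_nonneg X0.S_closed X1.S_closed
    by (intro real_sqrt_le_mono add_mono mult_left_mono power_mono) auto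
  also have "\<dots> \<le> sqrt ((n0 x0)\<^sup>2 + (\<bar>t\<bar> * n1 x1)\<^sup>2) + sqrt ((n0 y0)\<^sup>2 + (\<bar>t\<bar> * n1 y1)\<^sup>2)"
    by (rule real_sqrt_sum_squares_triangle_ineq)
  finally show ?thesis by (simp add: cost_def power_mult_distrib)
qed

lemma K_triangle:
  assumes "x \<in> \<Sigma>" "y \<in> \<Sigma>"
  shows "K t (x + y) \<le> K t x + K t y"
proof -
  have "K t (x + y) - K t y \<le> K t x"
  proof (rule K_ge)
    fix x0 x1 assume x: "x0 \<in> E0" "x1 \<in> E1" "x = x0 + x1"
    have "K t (x + y) - cost t x0 x1 \<le> K t y"
    proof (rule K_ge)
      fix y0 y1 assume y: "y0 \<in> E0" "y1 \<in> E1" "y = y0 + y1"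
      have "K t (x + y) \<le> cost t (x0 + y0) (x1 + y1)"
        using K_le[of "x0 + y0" "x1 + y1" t] x y X0.S_closed X1.S_closed by (simp add: add_ac)
      then show "K t (x + y) - cost t x0 x1 \<le> cost t y0 y1"
        using cost_triangle[of x0 x1 y0 y1 t] x y by simp
    qed fact
    then show "K t (x + y) - K t y \<le> cost t x0 x1" by simp
  qed fact
  then show ?thesis by simp
qed

text \<open>Adding and subtracting splittings of \<open>x\<close> and \<open>y\<close> and using the
  parallelogram law in each endpoint space gives one inequality; the same inequality for
  \<open>x + y\<close> and \<open>x - y\<close> is the reverse one.\<close>

lemma K_parallelogram:
  assumes "x \<in> \<Sigma>" "y \<in> \<Sigma>"
  shows "(K t (x + y))\<^sup>2 + (K t (x - y))\<^sup>2 = 2 * (K t x)\<^sup>2 + 2 * (K t y)\<^sup>2"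
proof -
  have le: "(K t (x + y))\<^sup>2 + (K t (x - y))\<^sup>2 \<le> 2 * (K t x)\<^sup>2 + 2 * (K t y)\<^sup>2"
    if "x \<in> \<Sigma>" "y \<in> \<Sigma>" for x y
  proof -
    have "((K t (x + y))\<^sup>2 + (K t (x - y))\<^sup>2) / 2 - (K t y)\<^sup>2 \<le> (K t x)\<^sup>2"
    proof (rule K_sq_ge)
      fix x0 x1 assume x: "x0 \<in> E0" "x1 \<in> E1" "x = x0 + x1"
      have "((K t (x + y))\<^sup>2 + (K t (x - y))\<^sup>2) / 2 - (cost t x0 x1)\<^sup>2 \<le> (K t y)\<^sup>2"
      proof (rule K_sq_ge)
        fix y0 y1 assume y: "y0 \<in> E0" "y1 \<in> E1" "y = y0 + y1"
        have "x + y = (x0 + y0) + (x1 + y1)" "x - y = (x0 - y0) + (x1 - y1)"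
          using x y by simp_all
        then have "(K t (x + y))\<^sup>2 + (K t (x - y))\<^sup>2
            \<le> (cost t (x0 + y0) (x1 + y1))\<^sup>2 + (cost t (x0 - y0) (x1 - y1))\<^sup>2"
          using K_sq_le[of "x0 + y0" "x1 + y1" t] K_sq_le[of "x0 - y0" "x1 - y1" t] x(1,2) y(1,2)
          by (simp add: X0.S_closed X1.S_closed)
        also have "\<dots> = ((n0 (x0 + y0))\<^sup>2 + (n0 (x0 - y0))\<^sup>2) + t\<^sup>2 * ((n1 (x1 + y1))\<^sup>2 + (n1 (x1 - y1))\<^sup>2)"
          by (simp add: cost_sq algebra_simps)
        also have "\<dots> = 2 * (cost t x0 x1)\<^sup>2 + 2 * (cost t y0 y1)\<^sup>2"
          unfolding X0.parallelogram[OF x(1) y(1)] X1.parallelogram[OF x(2) y(2)]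
          by (simp add: cost_sq algebra_simps)
        finally show "((K t (x + y))\<^sup>2 + (K t (x - y))\<^sup>2) / 2 - (cost t x0 x1)\<^sup>2 \<le> (cost t y0 y1)\<^sup>2"
          by (simp add: diff_le_eq divide_le_eq)
      qed fact
      then show "((K t (x + y))\<^sup>2 + (K t (x - y))\<^sup>2) / 2 - (K t y)\<^sup>2 \<le> (cost t x0 x1)\<^sup>2"
        by (simp add: diff_le_eq divide_le_eq add.commute)
    qed fact
    then show ?thesis by (simp add: diff_le_eq divide_le_eq)
  qed
  have double: "(x + y) + (x - y) = sc 2 x" "(x + y) - (x - y) = sc 2 y"
    using scale_left_distrib[of 1 1 x] scale_left_distrib[of 1 1 y] by simp_all
  have "(K t (sc 2 x))\<^sup>2 + (K t (sc 2 y))\<^sup>2 \<le> 2 * (K t (x + y))\<^sup>2 + 2 * (K t (x - y))\<^sup>2"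
    using le[of "x + y" "x - y"] assms unfolding double by (simp add: \<Sigma>_closed)
  then show ?thesis
    using le[OF assms] assms by (simp add: K_scale power_mult_distrib)
qed

lemma K_mono:
  assumes "x \<in> \<Sigma>" "0 \<le> s" "s \<le> t"
  shows "K s x \<le> K t x"
proof (rule K_ge)
  fix x0 x1 assume x: "x0 \<in> E0" "x1 \<in> E1" "x = x0 + x1"
  have "K s x \<le> cost s x0 x1" using K_le[of x0 x1 s] x by simp
  also have "\<dots> \<le> cost t x0 x1"
    unfolding cost_def using assms by (intro real_sqrt_le_mono add_left_mono mult_right_mono power_mono) auto
  finally show "K s x \<le> cost t x0 x1" .
qed fact

lemma K_quasi_antimono:
  assumes "x \<in> \<Sigma>" "0 < s" "s \<le> t"
  shows "K t x \<le> t / s * K s x"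
proof -
  have "s / t * K t x \<le> K s x"
  proof (rule K_ge)
    fix x0 x1 assume x: "x0 \<in> E0" "x1 \<in> E1" "x = x0 + x1"
    have "s / t * K t x \<le> s / t * cost t x0 x1"
      using K_le[of x0 x1 t] x assms by (intro mult_left_mono) auto
    also have "\<dots> = sqrt ((s / t)\<^sup>2 * ((n0 x0)\<^sup>2 + t\<^sup>2 * (n1 x1)\<^sup>2))"
      using assms by (simp add: cost_def real_sqrt_mult)
    also have "\<dots> \<le> cost s x0 x1"
    proof -
      have "(s / t)\<^sup>2 \<le> 1" using assms by (intro power_le_one) auto
      then have "(s / t)\<^sup>2 * (n0 x0)\<^sup>2 \<le> (n0 x0)\<^sup>2" by (simp add: mult_left_le_one_le)
      moreover have "(s / t)\<^sup>2 * (t\<^sup>2 * (n1 x1)\<^sup>2) = s\<^sup>2 * (n1 x1)\<^sup>2"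
        using assms by (simp add: power_divide)
      ultimately show ?thesis
        unfolding cost_def distrib_left by (intro real_sqrt_le_mono) linarith
    qed
    finally show "s / t * K t x \<le> cost s x0 x1" .
  qed fact
  then show ?thesis using assms by (simp add: field_simps)
qed

lemma n\<Sigma>_le: "x0 \<in> E0 \<Longrightarrow> x1 \<in> E1 \<Longrightarrow> n\<Sigma> (x0 + x1) \<le> n0 x0 + n1 x1"
  unfolding Sigma_space_def nspace.simps
  by (rule cINF_lower2[of _ _ "(x0, x1)"])
     (auto intro!: bdd_belowI2[of _ 0] add_nonneg_nonneg X0.N_nonneg X1.N_nonneg simp: splittings_def)

lemma n\<Sigma>_ge:
  assumes "x \<in> \<Sigma>" "\<And>x0 x1. x0 \<in> E0 \<Longrightarrow> x1 \<in> E1 \<Longrightarrow> x = x0 + x1 \<Longrightarrow> c \<le> n0 x0 + n1 x1"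
  shows "c \<le> n\<Sigma> x"
  unfolding Sigma_space_def nspace.simps
  using assms by (intro cINF_greatest) (auto simp: splittings_def \<Sigma>_iff)

lemma n\<Sigma>_le_K: "x \<in> \<Sigma> \<Longrightarrow> n\<Sigma> x \<le> 2 * K 1 x"
proof -
  assume "x \<in> \<Sigma>"
  then have "n\<Sigma> x / 2 \<le> K 1 x"
  proof (rule K_ge)
    fix x0 x1 assume x: "x0 \<in> E0" "x1 \<in> E1" "x = x0 + x1"
    have "n0 x0 \<le> cost 1 x0 x1" "n1 x1 \<le> cost 1 x0 x1"
      unfolding cost_def by (auto intro!: real_le_rsqrt)
    then show "n\<Sigma> x / 2 \<le> cost 1 x0 x1" using n\<Sigma>_le[OF x(1,2)] x(3) by simp
  qed
  then show ?thesis by simp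
qed

lemma K_le_n\<Sigma>:
  assumes "x \<in> \<Sigma>" "t > 0"
  shows "K t x \<le> max 1 t * n\<Sigma> x"
proof -
  have "K t x / max 1 t \<le> n\<Sigma> x"
  proof (rule n\<Sigma>_ge)
    fix x0 x1 assume x: "x0 \<in> E0" "x1 \<in> E1" "x = x0 + x1"
    have "K t x \<le> K t x0 + K t x1"
      unfolding x(3) using x by (intro K_triangle \<Sigma>I0 \<Sigma>I1)
    also have "\<dots> \<le> n0 x0 + t * n1 x1"
      using x assms by (intro add_mono K_le_n0 K_le_n1) auto
    also have "\<dots> \<le> max 1 t * n0 x0 + max 1 t * n1 x1"
      using x X0.N_nonneg[of x0] X1.N_nonneg[of x1]
      by (intro add_mono mult_right_mono) (auto simp: mult_le_cancel_right1)
    finally show "K t x / max 1 t \<le> n0 x0 + n1 x1"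
      using pos_divide_le_eq[of "max 1 t" "K t x" "n0 x0 + n1 x1"] by (simp add: algebra_simps)
  qed fact
  then show ?thesis
    using pos_divide_le_eq[of "max 1 t" "K t x" "n\<Sigma> x"] by (simp add: mult.commute)
qed

text \<open>The operators in the interpolation conditions are given on \<Delta> only; this is what
  permits applying them to both parts of a splitting of a vector in \<Delta>.\<close>

lemma split_in_D:
  assumes "x \<in> D" "x0 \<in> E0" "x1 \<in> E1" "x = x0 + x1"
  shows "x0 \<in> D" "x1 \<in> D"
  using assms X0.S_closed(3)[of x x0] X1.S_closed(3)[of x x1] by simp_all

end

section \<open>The weighted integral of K and the completeness of its space\<close>

locale hilbert_pair_exponent = hilbert_pair +
  fixes \<theta> :: real
  assumes \<theta>: "0 < \<theta>" "\<theta> < 1"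
begin

definition \<phi> :: "'a \<Rightarrow> real \<Rightarrow> ennreal" where
  "\<phi> x t = ennreal (\<bar>t powr (-\<theta>) * K t x\<bar>\<^sup>2 / t) * indicator {0<..} t"

abbreviation "I \<equiv> K_integral H0 H1 \<theta>"
abbreviation "EK \<equiv> elems (K_space H0 H1 \<theta>)"
abbreviation "nK \<equiv> nrm (K_space H0 H1 \<theta>)"

lemma I_eq: "I x = (\<integral>\<^sup>+t. \<phi> x t \<partial>lborel)"
  by (simp add: K_integral_def \<phi>_def)

lemma EK_iff: "x \<in> EK \<longleftrightarrow> x \<in> \<Sigma> \<and> I x < \<infinity>"
  by (simp add: K_space_def)

lemma EK_\<Sigma>: "x \<in> EK \<Longrightarrow> x \<in> \<Sigma>"
  by (simp add: EK_iff)

lemma nK_eq: "nK x = K_norm_const \<theta> * sqrt (enn2real (I x))"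
  by (simp add: K_space_def)

lemma nK_nonneg: "0 \<le> nK x"
  using K_norm_const_pos[OF \<theta>] by (simp add: nK_eq)

lemma I_nK: "x \<in> EK \<Longrightarrow> I x = ennreal ((nK x / K_norm_const \<theta>)\<^sup>2)"
  using K_norm_const_pos[OF \<theta>] by (simp add: nK_eq power_divide power_mult_distrib EK_iff)

lemma \<phi>_pos: "t > 0 \<Longrightarrow> \<phi> x t = ennreal (t powr (-2 * \<theta>) / t * (K t x)\<^sup>2)"
  unfolding \<phi>_def by (simp add: power_mult_distrib powr_power mult.commute)

lemma \<phi>_nonpos: "t \<le> 0 \<Longrightarrow> \<phi> x t = 0"
  by (simp add: \<phi>_def)

lemma measurable_\<phi> [measurable]:
  assumes "x \<in> \<Sigma>"
  shows "\<phi> x \<in> borel_measurable borel"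
proof -
  \<comment> \<open>\<open>K t x\<close> is even in \<open>t\<close>, hence monotone only on the
    half-line; cutting it off makes it monotone on all of the reals and so Borel.\<close>
  define k where "k t = (if t > 0 then K t x else 0)" for t
  have "mono k"
    using assms by (auto simp: mono_def k_def intro!: K_mono K_nonneg)
  then have [measurable]: "k \<in> borel_measurable borel" by (rule borel_measurable_mono)
  have "\<phi> x = (\<lambda>t. ennreal (\<bar>t powr (-\<theta>) * k t\<bar>\<^sup>2 / t) * indicator {0<..} t)"
    by (auto simp: \<phi>_def k_def indicator_def)
  then show ?thesis by simp
qed

lemma I_parallelogram:
  assumes "x \<in> \<Sigma>" "y \<in> \<Sigma>"
  shows "I (x + y) + I (x - y) = 2 * I x + 2 * I y"
proof -
  have "I (x + y) + I (x - y) = (\<integral>\<^sup>+t. \<phi> (x + y) t + \<phi> (x - y) t \<partial>lborel)"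
    unfolding I_eq using assms by (intro nn_integral_add[symmetric]) (auto simp: \<Sigma>_closed)
  also have "\<dots> = (\<integral>\<^sup>+t. 2 * \<phi> x t + 2 * \<phi> y t \<partial>lborel)"
  proof (intro nn_integral_cong)
    fix t :: real
    show "\<phi> (x + y) t + \<phi> (x - y) t = 2 * \<phi> x t + 2 * \<phi> y t"
    proof (cases "t > 0")
      case True
      define c where "c = t powr (-2 * \<theta>) / t"
      have c: "c \<ge> 0" using True by (simp add: c_def)
      have "c * (K t (x + y))\<^sup>2 + c * (K t (x - y))\<^sup>2 = 2 * (c * (K t x)\<^sup>2) + 2 * (c * (K t y)\<^sup>2)"
        using arg_cong[OF K_parallelogram[OF assms, of t], of "\<lambda>z. c * z"] by (simp add: distrib_left)
      moreover have "\<phi> z t = ennreal (c * (K t z)\<^sup>2)" for z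
        unfolding c_def by (rule \<phi>_pos[OF True])
      ultimately show ?thesis
        using c by (simp add: two_ennreal ennreal_plus[symmetric] del: ennreal_plus)
    qed (simp add: \<phi>_nonpos)
  qed
  also have "\<dots> = 2 * I x + 2 * I y"
    unfolding I_eq using assms by (simp add: nn_integral_add nn_integral_cmult)
  finally show ?thesis .
qed

lemma \<phi>_scale_le:
  assumes "c \<ge> 0" "0 < t \<Longrightarrow> K t y \<le> c * K t x" "y \<in> \<Sigma>"
  shows "\<phi> y t \<le> ennreal (c\<^sup>2) * \<phi> x t"
proof (cases "t > 0")
  case True
  have "(K t y)\<^sup>2 \<le> (c * K t x)\<^sup>2"
    using assms True by (intro power_mono K_nonneg) auto
  then have "t powr (-2 * \<theta>) / t * (K t y)\<^sup>2 \<le> t powr (-2 * \<theta>) / t * (c * K t x)\<^sup>2"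
    using True by (intro mult_left_mono) auto
  also have "\<dots> = c\<^sup>2 * (t powr (-2 * \<theta>) / t * (K t x)\<^sup>2)"
    by (simp add: power_mult_distrib)
  finally show ?thesis
    using True by (simp add: \<phi>_pos ennreal_mult'[symmetric] del: times_divide_eq_left)
qed (simp add: \<phi>_nonpos)

lemma I_scale:
  assumes "x \<in> \<Sigma>"
  shows "I (sc c x) = ennreal ((cmod c)\<^sup>2) * I x"
proof -
  have "\<phi> (sc c x) t = ennreal ((cmod c)\<^sup>2) * \<phi> x t" for t
    using assms by (cases "t > 0")
      (simp_all add: \<phi>_pos \<phi>_nonpos K_scale power_mult_distrib ennreal_mult'[symmetric] mult_ac)
  then have "\<phi> (sc c x) = (\<lambda>t. ennreal ((cmod c)\<^sup>2) * \<phi> x t)" by blast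
  then show ?thesis
    unfolding I_eq using nn_integral_cmult[of "\<phi> x" lborel "ennreal ((cmod c)\<^sup>2)"] assms by simp
qed

lemma EK_closed_add:
  assumes "x \<in> EK" "y \<in> EK"
  shows "x + y \<in> EK" "x - y \<in> EK"
proof -
  have "I (x + y) + I (x - y) < \<infinity>"
    using I_parallelogram[of x y] assms by (simp add: EK_iff ennreal_mult_less_top ennreal_add_less_top)
  then show "x + y \<in> EK" "x - y \<in> EK"
    using assms by (auto simp: EK_iff \<Sigma>_closed)
qed

lemma EK_closed_scale: "x \<in> EK \<Longrightarrow> sc c x \<in> EK"
  by (simp add: EK_iff I_scale \<Sigma>_closed ennreal_mult_less_top)

lemma EK_0: "0 \<in> EK"
  using I_scale[of 0 0] \<Sigma>_closed(1) by (simp add: EK_iff)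

sublocale XK: parallelogram_seminorm sc EK nK
proof
  show "subspace EK"
    by (rule subspaceI) (auto simp: EK_0 EK_closed_add EK_closed_scale)
  show "0 \<le> nK x" for x by (rule nK_nonneg)
  show "nK (sc c x) = cmod c * nK x" if "x \<in> EK" for x c
    using that by (simp add: nK_eq I_scale EK_iff enn2real_mult real_sqrt_mult)
  fix x y assume xy: "x \<in> EK" "y \<in> EK"
  define C where "C = (K_norm_const \<theta>)\<^sup>2"
  have "C \<ge> 0" by (simp add: C_def)
  then have "ennreal ((nK (x + y))\<^sup>2 / C + (nK (x - y))\<^sup>2 / C) = ennreal (2 * ((nK x)\<^sup>2 / C) + 2 * ((nK y)\<^sup>2 / C))"
    using I_parallelogram[of x y] xy EK_closed_add[OF xy]
    by (simp add: I_nK EK_\<Sigma> power_divide C_def[symmetric] two_ennreal del: times_divide_eq_right)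
  then have "(nK (x + y))\<^sup>2 / C + (nK (x - y))\<^sup>2 / C = 2 * ((nK x)\<^sup>2 / C) + 2 * ((nK y)\<^sup>2 / C)"
    by (subst (asm) ennreal_inj) (auto simp: C_def)
  moreover have "C > 0" using K_norm_const_pos[OF \<theta>] by (simp add: C_def)
  ultimately show "(nK (x + y))\<^sup>2 + (nK (x - y))\<^sup>2 = 2 * (nK x)\<^sup>2 + 2 * (nK y)\<^sup>2"
    by (simp add: field_simps)
qed

text \<open>Integrate over \<open>[t, 2t]\<close> only, where \<open>K\<close> is at least \<open>K t x\<close>.\<close>

lemma K_le_I:
  assumes x: "x \<in> \<Sigma>" and t: "t > 0"
  shows "ennreal ((2 * t) powr (-2 * \<theta>) / 2 * (K t x)\<^sup>2) \<le> I x"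
proof -
  define c where "c = (2 * t) powr (-2 * \<theta>) / (2 * t) * (K t x)\<^sup>2"
  have c: "c \<ge> 0" using t by (simp add: c_def)
  have "ennreal c * indicator {t..2 * t} s \<le> \<phi> x s" for s
  proof (cases "s \<in> {t..2 * t}")
    case True
    then have "s > 0" using t by simp
    have "(2 * t) powr (-2 * \<theta>) / (2 * t) \<le> s powr (-2 * \<theta>) / s"
      using True \<open>s > 0\<close> \<theta> by (intro frac_le powr_mono2') auto
    moreover have "(K t x)\<^sup>2 \<le> (K s x)\<^sup>2"
      using True t x by (intro power_mono K_mono K_nonneg) auto
    ultimately have "c \<le> s powr (-2 * \<theta>) / s * (K s x)\<^sup>2"
      unfolding c_def using \<open>s > 0\<close> by (intro mult_mono) auto
    then show ?thesis using True \<open>s > 0\<close> by (simp add: \<phi>_pos del: times_divide_eq_left)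
  qed simp
  then have "(\<integral>\<^sup>+s. ennreal c * indicator {t..2 * t} s \<partial>lborel) \<le> I x"
    unfolding I_eq by (intro nn_integral_mono) auto
  moreover have "(\<integral>\<^sup>+s. ennreal c * indicator {t..2 * t} s \<partial>lborel) = ennreal (c * t)"
    using t c by (simp add: nn_integral_cmult_indicator ennreal_mult'[symmetric])
  moreover have "c * t = (2 * t) powr (-2 * \<theta>) / 2 * (K t x)\<^sup>2"
    using t by (simp add: c_def)
  ultimately show ?thesis by simp
qed

text \<open>The 4 is the square root of 16, a bound for \<open>2 * 2 powr (2 * \<theta>)\<close>
  that is uniform in \<theta>.\<close>

definition cK :: real where "cK = 4 / K_norm_const \<theta>"

lemma cK_pos: "cK > 0"
  using K_norm_const_pos[OF \<theta>] by (simp add: cK_def)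

lemma K_le_nK:
  assumes x: "x \<in> EK" and t: "t > 0"
  shows "K t x \<le> cK * t powr \<theta> * nK x"
proof (rule power2_le_imp_le)
  have "(2 * t) powr (-2 * \<theta>) / 2 * (K t x)\<^sup>2 \<le> (nK x / K_norm_const \<theta>)\<^sup>2"
    using K_le_I[OF EK_\<Sigma>[OF x] t] unfolding I_nK[OF x] by (subst (asm) ennreal_le_iff) auto
  then have "(K t x)\<^sup>2 \<le> 2 * (2 * t) powr (2 * \<theta>) * (nK x / K_norm_const \<theta>)\<^sup>2"
    using t by (simp add: powr_minus field_simps)
  moreover have "2 * (2 * t) powr (2 * \<theta>) \<le> 16 * (t powr \<theta>)\<^sup>2"
  proof -
    have "2 powr (2 * \<theta>) \<le> 2 powr (3 :: real)"
      using \<theta> by (intro powr_mono) auto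
    then have "2 powr (2 * \<theta>) * (t powr \<theta>)\<^sup>2 \<le> 8 * (t powr \<theta>)\<^sup>2"
      by (intro mult_right_mono) auto
    then show ?thesis using t by (simp add: powr_mult powr_power mult.commute)
  qed
  ultimately have "(K t x)\<^sup>2 \<le> 16 * (t powr \<theta>)\<^sup>2 * (nK x / K_norm_const \<theta>)\<^sup>2"
    by (meson mult_right_mono order_trans zero_le_power2)
  then show "(K t x)\<^sup>2 \<le> (cK * t powr \<theta> * nK x)\<^sup>2"
    by (simp add: cK_def power_mult_distrib power_divide)
qed (use cK_pos nK_nonneg in simp)

lemma n\<Sigma>_le_nK: "x \<in> EK \<Longrightarrow> n\<Sigma> x \<le> 2 * cK * nK x"
  using n\<Sigma>_le_K[of x] K_le_nK[of x 1] by (simp add: EK_\<Sigma>)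

lemma nK_eq_0_iff: "x \<in> EK \<Longrightarrow> nK x = 0 \<longleftrightarrow> x = 0"
  using n\<Sigma>_le_nK[of x] normed_onD(3,4)[OF normed_\<Sigma>, of x] XK.N_0 by (auto simp: EK_\<Sigma>)

lemma normed_K: "normed_on sc (K_space H0 H1 \<theta>)"
  unfolding normed_on_def
  using XK.subsp XK.N_triangle XK.N_scale nK_nonneg nK_eq_0_iff vector_space_axioms by blast

text \<open>\<open>K t\<close> is continuous for the norm of \<Sigma>, so the integrands converge
  pointwise and Fatou's lemma applies: the integral is lower semicontinuous along sequences that
  converge in \<Sigma>.\<close>

lemma I_diff_limit:
  assumes x: "x \<in> \<Sigma>" and s: "\<And>m. s m \<in> \<Sigma>" and l: "l \<in> \<Sigma>" "(\<lambda>m. n\<Sigma> (s m - l)) \<longlonglongrightarrow> 0"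
    and bound: "\<forall>\<^sub>F m in sequentially. I (x - s m) \<le> C"
  shows "I (x - l) \<le> C"
proof -
  have lim: "(\<lambda>m. \<phi> (x - s m) t) \<longlonglongrightarrow> \<phi> (x - l) t" for t
  proof (cases "t > 0")
    case True
    have "(\<lambda>m. K t (x - s m)) \<longlonglongrightarrow> K t (x - l)"
    proof (rule LIMSEQ_I)
      fix r :: real assume r: "r > 0"
      obtain M where M: "\<And>m. m \<ge> M \<Longrightarrow> n\<Sigma> (s m - l) < r / max 1 t"
        using order_tendstoD(2)[OF l(2), of "r / max 1 t"] r
        by (auto simp: eventually_sequentially)
      have "norm (K t (x - s m) - K t (x - l)) < r" if "m \<ge> M" for m
      proof -
        have S: "x - s m \<in> \<Sigma>" "x - l \<in> \<Sigma>" "s m - l \<in> \<Sigma>" "l - s m \<in> \<Sigma>"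
          using x s l \<Sigma>_closed by auto
        have "K t (x - s m) \<le> K t (x - l) + K t (l - s m)" "K t (x - l) \<le> K t (x - s m) + K t (s m - l)"
          using K_triangle[OF S(2,4), of t] K_triangle[OF S(1,3), of t] by simp_all
        moreover have "K t (l - s m) = K t (s m - l)" using K_minus[OF S(3), of t] by simp
        moreover have "K t (s m - l) \<le> max 1 t * n\<Sigma> (s m - l)"
          by (rule K_le_n\<Sigma>[OF S(3) True])
        moreover have "max 1 t * n\<Sigma> (s m - l) < r"
          using M[OF that] pos_less_divide_eq[of "max 1 t" "n\<Sigma> (s m - l)" r] by (simp add: mult.commute)
        ultimately show ?thesis by simp
      qed
      then show "\<exists>no. \<forall>n\<ge>no. norm (K t (x - s n) - K t (x - l)) < r" by blast
    qed
    then show ?thesis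
      unfolding \<phi>_pos[OF True] by (intro tendsto_ennrealI tendsto_intros)
  qed (simp add: \<phi>_nonpos)
  have "I (x - l) = (\<integral>\<^sup>+t. liminf (\<lambda>m. \<phi> (x - s m) t) \<partial>lborel)"
    unfolding I_eq by (intro nn_integral_cong) (simp add: lim_imp_Liminf[OF _ lim])
  also have "\<dots> \<le> liminf (\<lambda>m. \<integral>\<^sup>+t. \<phi> (x - s m) t \<partial>lborel)"
    using x s by (intro nn_integral_liminf) (simp add: \<Sigma>_closed)
  also have "\<dots> = liminf (\<lambda>m. I (x - s m))"
    by (simp add: I_eq)
  also have "\<dots> \<le> C"
    using bound by (intro Liminf_le) auto
  finally show ?thesis .
qed

lemma nK_le_iff: "x \<in> EK \<Longrightarrow> 0 \<le> e \<Longrightarrow> nK x \<le> e \<longleftrightarrow> I x \<le> ennreal ((e / K_norm_const \<theta>)\<^sup>2)"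
  using K_norm_const_pos[OF \<theta>] nK_nonneg[of x]
  by (simp add: I_nK ennreal_le_iff divide_le_cancel power_divide)

text \<open>The limit is taken in \<Sigma>. Lower semicontinuity, with one index of the Cauchy
  condition fixed and the other tending to infinity, shows that it is also the limit in the
  K-norm.\<close>

lemma banach_K: "banach_on sc (K_space H0 H1 \<theta>)"
  unfolding banach_on_def
proof (intro conjI normed_K allI impI)
  fix s :: "nat \<Rightarrow> 'a"
  assume "range s \<subseteq> EK" and Cauchy: "\<forall>e>0. \<exists>M. \<forall>m\<ge>M. \<forall>n\<ge>M. nK (s m - s n) < e"
  then have s: "s n \<in> EK" for n by auto
  have "\<exists>l\<in>\<Sigma>. (\<lambda>n. n\<Sigma> (s n - l)) \<longlonglongrightarrow> 0"
  proof -
    have "\<exists>M. \<forall>m\<ge>M. \<forall>n\<ge>M. n\<Sigma> (s m - s n) < e" if "e > 0" for e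
    proof -
      obtain M where M: "\<And>m n. m \<ge> M \<Longrightarrow> n \<ge> M \<Longrightarrow> nK (s m - s n) < e / (2 * cK)"
        using Cauchy cK_pos \<open>e > 0\<close> by (metis divide_pos_pos mult_pos_pos zero_less_numeral)
      have "n\<Sigma> (s m - s n) < e" if "m \<ge> M" "n \<ge> M" for m n
        using n\<Sigma>_le_nK[of "s m - s n"] M[OF that] cK_pos EK_closed_add(2)[OF s s, of m n]
        by (simp add: field_simps)
      then show ?thesis by blast
    qed
    moreover have "range s \<subseteq> \<Sigma>" using s EK_\<Sigma> by blast
    ultimately show ?thesis using banach_\<Sigma> unfolding banach_on_def by blast
  qed
  then obtain l where l: "l \<in> \<Sigma>" "(\<lambda>n. n\<Sigma> (s n - l)) \<longlonglongrightarrow> 0" by blast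
  have key: "\<exists>M. \<forall>n\<ge>M. s n - l \<in> EK \<and> nK (s n - l) \<le> e" if "e > 0" for e
  proof -
    obtain M where M: "\<And>m n. m \<ge> M \<Longrightarrow> n \<ge> M \<Longrightarrow> nK (s m - s n) < e"
      using Cauchy \<open>e > 0\<close> by blast
    have "s n - l \<in> EK \<and> nK (s n - l) \<le> e" if n: "n \<ge> M" for n
    proof -
      have "\<forall>\<^sub>F m in sequentially. I (s n - s m) \<le> ennreal ((e / K_norm_const \<theta>)\<^sup>2)"
        using eventually_ge_at_top[of M]
      proof eventually_elim
        case (elim m)
        show ?case
          using nK_le_iff[OF EK_closed_add(2)[OF s s], of e n m] M[OF n elim] \<open>e > 0\<close> by simp
      qed
      then have *: "I (s n - l) \<le> ennreal ((e / K_norm_const \<theta>)\<^sup>2)"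
        using s EK_\<Sigma> l by (intro I_diff_limit[where s = s]) auto
      then have "s n - l \<in> EK"
        using s EK_\<Sigma> l \<Sigma>_closed(3) by (auto simp: EK_iff intro: le_less_trans)
      then show ?thesis using * nK_le_iff \<open>e > 0\<close> by simp
    qed
    then show ?thesis by blast
  qed
  obtain M where "s M - l \<in> EK" using key[of 1] by auto
  then have "s M - (s M - l) \<in> EK" using s EK_closed_add by blast
  then have "l \<in> EK" by simp
  moreover have "(\<lambda>n. nK (s n - l)) \<longlonglongrightarrow> 0"
  proof (rule LIMSEQ_I)
    fix r :: real assume "r > 0"
    then obtain M where "\<forall>n\<ge>M. nK (s n - l) \<le> r / 2" using key[of "r / 2"] by auto
    then show "\<exists>no. \<forall>n\<ge>no. norm (nK (s n - l) - 0) < r"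
      using nK_nonneg \<open>r > 0\<close> by (intro exI[of _ M]) (auto intro: le_less_trans)
  qed
  ultimately show "\<exists>l\<in>EK. (\<lambda>n. nK (s n - l)) \<longlonglongrightarrow> 0" by blast
qed

lemma hilbert_K: "hilbert_on sc (K_space H0 H1 \<theta>)"
  using banach_K XK.parallelogram_seminorm_axioms by (rule hilbert_onI)

section \<open>Density of \<Delta> in the K-space\<close>

lemma K_pos:
  assumes "x \<in> \<Sigma>" "x \<noteq> 0" "t > 0"
  shows "K t x > 0"
proof -
  have "0 < n\<Sigma> x" using normed_onD(3,4)[OF normed_\<Sigma>, of x] assms by simp
  then have "0 < K 1 x" using n\<Sigma>_le_K[of x] assms by simp
  moreover have "K 1 x \<le> max 1 (1 / t) * K t x"
  proof (cases "t \<le> 1")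
    case True
    then show ?thesis using K_quasi_antimono[of x t 1] assms by simp
  next
    case False
    then show ?thesis using K_mono[of x 1 t] assms by simp
  qed
  ultimately show ?thesis using K_nonneg[OF assms(1), of t] by (cases "K t x = 0") auto
qed

lemma near_optimal_split:
  assumes x: "x \<in> \<Sigma>" and t: "t > 0"
  obtains x0 x1 where "x0 \<in> E0" "x1 \<in> E1" "x = x0 + x1" "n0 x0 \<le> 2 * K t x" "t * n1 x1 \<le> 2 * K t x"
proof (cases "x = 0")
  case True
  then show ?thesis
    using that[of 0 0] K_nonneg[OF x, of t] X0.S_closed(1) X1.S_closed(1) by (simp add: X0.N_0 X1.N_0)
next
  case False
  then have "K t x < 2 * K t x" using K_pos[OF x] t by simp
  then obtain x0 x1 where s: "x0 \<in> E0" "x1 \<in> E1" "x = x0 + x1" "cost t x0 x1 < 2 * K t x"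
    using K_split[OF x] by metis
  have "n0 x0 \<le> cost t x0 x1" "t * n1 x1 \<le> cost t x0 x1"
    unfolding cost_def by (auto intro!: real_le_rsqrt simp: power_mult_distrib)
  then show ?thesis using that s by simp
qed

text \<open>A splitting chosen for one \<open>t\<close> remains good at every \<open>s\<close>: for
  \<open>s \<le> t\<close> the part in H1 is controlled by the decrease of \<open>K s x / s\<close>,
  for \<open>s \<ge> t\<close> the part in H0 by the monotonicity of \<open>K\<close>, and the other
  part by the triangle inequality. The uniform factor 3 provides the integrable majorant.\<close>

lemma near_optimal_split_K:
  assumes x: "x0 \<in> E0" "x1 \<in> E1" "x = x0 + x1" and n: "n0 x0 \<le> 2 * K t x" "t * n1 x1 \<le> 2 * K t x"
    and t: "t > 0" and s: "s > 0"
  shows "K s x0 \<le> 3 * K s x" "K s x1 \<le> 3 * K s x" "K s x0 \<le> 2 * K t x" "K s x1 \<le> s * (2 * K t x / t)"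
proof -
  have S: "x \<in> \<Sigma>" "x0 \<in> \<Sigma>" "x1 \<in> \<Sigma>" using x \<Sigma>I \<Sigma>I0 \<Sigma>I1 by auto
  have a: "K s x0 \<le> n0 x0" by (rule K_le_n0[OF x(1)])
  have "s * n1 x1 \<le> s * (2 * K t x / t)"
    using n t s by (intro mult_left_mono) (simp_all add: field_simps)
  then have b: "K s x1 \<le> s * (2 * K t x / t)"
    using K_le_n1[OF x(2), of s] s by simp
  have "K s (x + - x1) \<le> K s x + K s (- x1)" "K s (x + - x0) \<le> K s x + K s (- x0)"
    by (rule K_triangle; use S \<Sigma>_closed in simp)+
  then have c: "K s x0 \<le> K s x + K s x1" "K s x1 \<le> K s x + K s x0"
    using S x(3) by (simp_all add: K_minus)
  have d: "s * (2 * K t x / t) \<le> 2 * K s x" if "s \<le> t"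
    using K_quasi_antimono[OF S(1) s that] s t by (simp add: field_simps)
  have e: "K t x \<le> K s x" if "t \<le> s"
    using K_mono[OF S(1) _ that] t by simp
  have pos: "0 \<le> K s x" by (rule K_nonneg[OF S(1)])
  show "K s x0 \<le> 2 * K t x" "K s x1 \<le> s * (2 * K t x / t)" using a b n by auto
  have "K s x0 \<le> 3 * K s x \<and> K s x1 \<le> 3 * K s x"
  proof (cases "s \<le> t")
    case True
    then have "K s x1 \<le> 2 * K s x" using b d by simp
    then show ?thesis using c pos by linarith
  next
    case False
    then have "K s x0 \<le> 2 * K s x" using a n e by simp
    then show ?thesis using c pos by linarith
  qed
  then show "K s x0 \<le> 3 * K s x" "K s x1 \<le> 3 * K s x" by auto
qed

text \<open>Split \<open>x\<close> at a small parameter \<open>a n\<close> and at a large one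
  \<open>b n\<close>. The difference of the two H0 parts equals, up to sign, that of the H1 parts
  and therefore lies in \<Delta>; it approximates \<open>x\<close> by dominated convergence.\<close>

lemma dense_K:
  assumes D_EK: "D \<subseteq> EK"
  shows "dense_in_space D (K_space H0 H1 \<theta>)"
  unfolding dense_in_space_def
proof (intro conjI D_EK ballI allI impI)
  fix x and e :: real assume x: "x \<in> EK" and e: "e > 0"
  note S = EK_\<Sigma>[OF x]
  define a where "a n = 1 / real (Suc n)" for n
  define b where "b n = real (Suc n)" for n
  have ab: "a n > 0" "b n > 0" for n by (simp_all add: a_def b_def)
  have "\<exists>x0 x1. x0 \<in> E0 \<and> x1 \<in> E1 \<and> x = x0 + x1 \<and> n0 x0 \<le> 2 * K t x \<and> t * n1 x1 \<le> 2 * K t x" if "t > 0" for t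
    using near_optimal_split[OF S that] by metis
  then obtain p q where pq: "\<And>t. t > 0 \<Longrightarrow> p t \<in> E0" "\<And>t. t > 0 \<Longrightarrow> q t \<in> E1" "\<And>t. t > 0 \<Longrightarrow> x = p t + q t"
      "\<And>t. t > 0 \<Longrightarrow> n0 (p t) \<le> 2 * K t x" "\<And>t. t > 0 \<Longrightarrow> t * n1 (q t) \<le> 2 * K t x"
    by metis
  note est = near_optimal_split_K[OF pq]
  define d where "d n = q (b n) + p (a n)" for n
  have dS: "d n \<in> \<Sigma>" for n
    unfolding d_def by (rule \<Sigma>_closed(2)[OF \<Sigma>I1[OF pq(2)[OF ab(2)]] \<Sigma>I0[OF pq(1)[OF ab(1)]]])
  have xd: "x - d n \<in> D" for n
  proof -
    have "x - d n = p (b n) - p (a n)" "x - d n = q (a n) - q (b n)"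
      using pq(3)[OF ab(1)[of n]] pq(3)[OF ab(2)[of n]] by (simp_all add: d_def algebra_simps)
    then show ?thesis
      using X0.S_closed(3)[OF pq(1)[OF ab(2)] pq(1)[OF ab(1)], of n n] X1.S_closed(3)[OF pq(2)[OF ab(1)] pq(2)[OF ab(2)], of n n]
      by auto
  qed
  have d6: "K s (d n) \<le> 6 * K s x" if "s > 0" for s n
  proof -
    have "K s (d n) \<le> K s (q (b n)) + K s (p (a n))"
      unfolding d_def by (intro K_triangle \<Sigma>I0 \<Sigma>I1 pq ab)
    then show ?thesis using est(2)[OF ab(2) ab(2) ab(2) ab(2) ab(2) ab(2) that, of n] est(1)[OF ab(1) ab(1) ab(1) ab(1) ab(1) ab(1) that, of n] by linarith
  qed
  \<comment> \<open>\<open>K_le_nK\<close> makes \<open>K (b n) x / b n\<close> of order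
    \<open>b n powr (\<theta> - 1)\<close> and \<open>K (a n) x\<close> of order
    \<open>a n powr \<theta>\<close>; both tend to \<open>0\<close> as
    \<open>0 < \<theta> < 1\<close>.\<close>
  have dlim: "(\<lambda>n. K s (d n)) \<longlonglongrightarrow> 0" if "s > 0" for s
  proof (rule real_tendsto_sandwich[OF _ _ tendsto_const])
    show "\<forall>\<^sub>F n in sequentially. 0 \<le> K s (d n)" by (simp add: K_nonneg dS)
    show "\<forall>\<^sub>F n in sequentially. K s (d n) \<le> s * (2 * cK * nK x * b n powr (\<theta> - 1)) + 2 * cK * nK x * a n powr \<theta>"
    proof (intro always_eventually allI)
      fix n
      have "K s (d n) \<le> K s (q (b n)) + K s (p (a n))"
        unfolding d_def by (intro K_triangle \<Sigma>I0 \<Sigma>I1 pq ab)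
      also have "K s (q (b n)) \<le> s * (2 * K (b n) x / b n)"
        using est(4)[OF ab(2) ab(2) ab(2) ab(2) ab(2) ab(2) that, of n] .
      also have "\<dots> \<le> s * (2 * (cK * b n powr \<theta> * nK x) / b n)"
        using K_le_nK[OF x ab(2)[of n]] that ab(2)[of n] by (intro mult_left_mono divide_right_mono) auto
      also have "\<dots> = s * (2 * cK * nK x * b n powr (\<theta> - 1))"
        using ab(2)[of n] by (simp add: powr_diff)
      also have "K s (p (a n)) \<le> 2 * K (a n) x"
        using est(3)[OF ab(1) ab(1) ab(1) ab(1) ab(1) ab(1) that, of n] .
      also have "\<dots> \<le> 2 * cK * nK x * a n powr \<theta>"
        using K_le_nK[OF x ab(1)[of n]] by (simp add: mult_ac)
      finally show "K s (d n) \<le> s * (2 * cK * nK x * b n powr (\<theta> - 1)) + 2 * cK * nK x * a n powr \<theta>"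
        by simp
    qed
    have b: "filterlim b at_top sequentially"
      unfolding b_def by (intro filterlim_compose[OF filterlim_real_sequentially] filterlim_Suc)
    have "(\<lambda>n. b n powr (\<theta> - 1)) \<longlonglongrightarrow> 0"
      using \<theta> by (intro tendsto_neg_powr b) auto
    moreover have "(\<lambda>n. a n powr \<theta>) \<longlonglongrightarrow> 0"
    proof -
      have "(\<lambda>n. b n powr (- \<theta>)) \<longlonglongrightarrow> 0"
        using \<theta> by (intro tendsto_neg_powr b) auto
      moreover have "a n powr \<theta> = b n powr (- \<theta>)" for n
        by (simp add: a_def b_def powr_minus_divide powr_divide)
      ultimately show ?thesis by simp
    qed
    ultimately have "(\<lambda>n. s * (2 * cK * nK x * b n powr (\<theta> - 1)) + 2 * cK * nK x * a n powr \<theta>)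
       \<longlonglongrightarrow> s * (2 * cK * nK x * 0) + 2 * cK * nK x * 0"
      by (intro tendsto_intros)
    then show "(\<lambda>n. s * (2 * cK * nK x * b n powr (\<theta> - 1)) + 2 * cK * nK x * a n powr \<theta>) \<longlonglongrightarrow> 0"
      by simp
  qed
  have "(\<lambda>n. \<integral>\<^sup>+t. \<phi> (d n) t \<partial>lborel) \<longlonglongrightarrow> (\<integral>\<^sup>+t. 0 \<partial>(lborel :: real measure))"
  proof (rule nn_integral_dominated_convergence[where w = "\<lambda>t. ennreal (6\<^sup>2) * \<phi> x t"])
    show "AE t in lborel. \<phi> (d n) t \<le> ennreal (6\<^sup>2) * \<phi> x t" for n
      using d6 dS by (intro AE_I2 \<phi>_scale_le) auto
    show "(\<integral>\<^sup>+t. ennreal (6\<^sup>2) * \<phi> x t \<partial>lborel) < \<infinity>"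
      using x S by (subst nn_integral_cmult) (simp_all add: I_eq[symmetric] EK_iff ennreal_mult_less_top)
    show "AE t in lborel. (\<lambda>n. \<phi> (d n) t) \<longlonglongrightarrow> 0"
    proof (intro AE_I2)
      fix t :: real
      show "(\<lambda>n. \<phi> (d n) t) \<longlonglongrightarrow> 0"
      proof (cases "t > 0")
        case True
        have "(\<lambda>n. ennreal (t powr (-2 * \<theta>) / t * (K t (d n))\<^sup>2)) \<longlonglongrightarrow> ennreal (t powr (-2 * \<theta>) / t * 0\<^sup>2)"
          by (intro tendsto_ennrealI tendsto_intros dlim[OF True])
        then show ?thesis by (simp add: \<phi>_pos[OF True])
      qed (simp add: \<phi>_nonpos)
    qed
  qed (use dS S in simp_all)
  then have "(\<lambda>n. I (d n)) \<longlonglongrightarrow> 0" by (simp add: I_eq)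
  moreover have "0 < ennreal ((e / 2 / K_norm_const \<theta>)\<^sup>2)"
    using e K_norm_const_pos[OF \<theta>] by simp
  ultimately have "\<forall>\<^sub>F n in sequentially. I (d n) < ennreal ((e / 2 / K_norm_const \<theta>)\<^sup>2)"
    by (rule order_tendstoD)
  then obtain n where n: "I (d n) < ennreal ((e / 2 / K_norm_const \<theta>)\<^sup>2)"
    by (auto simp: eventually_sequentially)
  then have "d n \<in> EK" using dS by (auto simp: EK_iff intro: less_trans)
  then have "nK (d n) \<le> e / 2" using n e by (subst nK_le_iff) auto
  then have "nK (x - (x - d n)) < e" using e by simp
  then show "\<exists>y\<in>D. nK (x - y) < e" using xd[of n] by blast
qed

section \<open>Sharp estimates by the endpoint norms and the three operator bounds\<close>

lemma K_sq_le_of_bounds: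
  assumes x: "x \<in> D" "n0 x \<le> a" "n1 x \<le> b" and pos: "0 < a" "0 < b" "0 < t"
  shows "(K t x)\<^sup>2 \<le> t\<^sup>2 * (a\<^sup>2 * b\<^sup>2) / (a\<^sup>2 + b\<^sup>2 * t\<^sup>2)"
proof -
  define Q where "Q = a\<^sup>2 + b\<^sup>2 * t\<^sup>2"
  \<comment> \<open>Among the splittings of \<open>x\<close> into multiples of itself, this
    \<open>s\<close> minimises \<open>s\<^sup>2 * a\<^sup>2 + t\<^sup>2 * (1 - s)\<^sup>2 *
    b\<^sup>2\<close>.\<close>
  define s where "s = b\<^sup>2 * t\<^sup>2 / Q"
  have Q: "Q > 0" using pos by (simp add: Q_def add_pos_pos)
  have s1: "1 - s = a\<^sup>2 / Q" using Q by (simp add: s_def Q_def field_simps)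
  have "sc (of_real s) x + sc (of_real (1 - s)) x = x"
    by (simp flip: scale_left_distrib)
  moreover have "(K t (sc (of_real s) x + sc (of_real (1 - s)) x))\<^sup>2
      \<le> (cost t (sc (of_real s) x) (sc (of_real (1 - s)) x))\<^sup>2"
    using x(1) by (intro K_sq_le X0.S_closed X1.S_closed) auto
  ultimately have "(K t x)\<^sup>2 \<le> (cost t (sc (of_real s) x) (sc (of_real (1 - s)) x))\<^sup>2"
    by (simp only:)
  also have "\<dots> = s\<^sup>2 * (n0 x)\<^sup>2 + t\<^sup>2 * ((1 - s)\<^sup>2 * (n1 x)\<^sup>2)"
    unfolding cost_sq X0.N_scale[OF IntD1[OF x(1)]] X1.N_scale[OF IntD2[OF x(1)]] norm_of_real
    by (simp only: power_mult_distrib power2_abs)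
  also have "\<dots> \<le> s\<^sup>2 * a\<^sup>2 + t\<^sup>2 * ((1 - s)\<^sup>2 * b\<^sup>2)"
    using x X0.N_nonneg[of x] X1.N_nonneg[of x]
    by (intro add_mono mult_left_mono power_mono) auto
  also have "\<dots> = t\<^sup>2 * (a\<^sup>2 * b\<^sup>2) * (a\<^sup>2 + b\<^sup>2 * t\<^sup>2) / Q\<^sup>2"
    unfolding s1 unfolding s_def power_divide
    by (simp add: add_divide_distrib[symmetric]) (simp add: algebra_simps power2_eq_square power4_eq_xxxx)
  also have "\<dots> = t\<^sup>2 * (a\<^sup>2 * b\<^sup>2) / Q"
    using Q by (simp add: Q_def[symmetric] power2_eq_square[of Q])
  finally show ?thesis by (simp add: Q_def)
qed

lemma powr_complement_sq:
  assumes "0 < a" "0 < b"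
  shows "a\<^sup>2 * b\<^sup>2 / (a powr \<theta> * b powr (1 - \<theta>))\<^sup>2 = (a powr (1 - \<theta>) * b powr \<theta>)\<^sup>2"
proof -
  have "(a powr \<theta> * b powr (1 - \<theta>)) * (a powr (1 - \<theta>) * b powr \<theta>)
      = (a powr \<theta> * a powr (1 - \<theta>)) * (b powr \<theta> * b powr (1 - \<theta>))"
    by (simp only: mult_ac)
  also have "\<dots> = a * b"
    using assms by (simp flip: powr_add)
  finally have "(a * b)\<^sup>2 = (a powr \<theta> * b powr (1 - \<theta>))\<^sup>2 * (a powr (1 - \<theta>) * b powr \<theta>)\<^sup>2"
    by (metis power_mult_distrib)
  then show ?thesis using assms by (simp add: power_mult_distrib)
qed

text \<open>The bound from splitting \<open>x\<close> into multiples of itself integrates to the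
  geometric mean with constant 1. This yields condition (iii) and the embedding of \<Delta>.\<close>

lemma nK_le_of_bounds:
  assumes x: "x \<in> D" "n0 x \<le> a" "n1 x \<le> b"
  shows "x \<in> EK" "nK x \<le> a powr (1 - \<theta>) * b powr \<theta>"
proof -
  have n: "0 \<le> n0 x" "0 \<le> n1 x" using x X0.N_nonneg X1.N_nonneg by auto
  have "x \<in> EK \<and> nK x \<le> a powr (1 - \<theta>) * b powr \<theta>"
  proof (cases "x = 0")
    case False
    have "0 < n0 x" "0 < n1 x"
      using n x False normed_onD(4)[OF normed_H0] normed_onD(4)[OF normed_H1] by (auto simp: less_le)
    then have a: "0 < a" and b: "0 < b" using x by auto
    have S: "x \<in> \<Sigma>" using x \<Sigma>I0 by blast
    have C: "0 < K_norm_const \<theta>" by (rule K_norm_const_pos[OF \<theta>])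
    have "\<phi> x t \<le> ennreal (a\<^sup>2 * b\<^sup>2) * (ennreal (t powr (1 - 2 * \<theta>) / (a\<^sup>2 + b\<^sup>2 * t\<^sup>2)) * indicator {0<..} t)" for t
    proof (cases "t > 0")
      case True
      have "t powr (-2 * \<theta>) / t * (K t x)\<^sup>2 \<le> t powr (-2 * \<theta>) / t * (t\<^sup>2 * (a\<^sup>2 * b\<^sup>2) / (a\<^sup>2 + b\<^sup>2 * t\<^sup>2))"
        using K_sq_le_of_bounds[OF x a b True] True by (intro mult_left_mono) auto
      also have "\<dots> = a\<^sup>2 * b\<^sup>2 * ((t powr (-2 * \<theta>) * t) / (a\<^sup>2 + b\<^sup>2 * t\<^sup>2))"
        using True by (simp add: power2_eq_square[of t])
      also have "t powr (-2 * \<theta>) * t = t powr (1 - 2 * \<theta>)"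
        using True powr_add[of t "-2 * \<theta>" 1] by simp
      finally show ?thesis
        using True by (simp add: \<phi>_pos ennreal_mult'[symmetric] del: times_divide_eq_left times_divide_eq_right)
    qed (simp add: \<phi>_nonpos)
    then have "I x \<le> (\<integral>\<^sup>+t. ennreal (a\<^sup>2 * b\<^sup>2) * (ennreal (t powr (1 - 2 * \<theta>) / (a\<^sup>2 + b\<^sup>2 * t\<^sup>2)) * indicator {0<..} t) \<partial>lborel)"
      unfolding I_eq by (intro nn_integral_mono)
    also have "\<dots> = ennreal (a\<^sup>2 * b\<^sup>2) * ennreal (1 / ((K_norm_const \<theta>)\<^sup>2 * (a powr \<theta> * b powr (1 - \<theta>))\<^sup>2))"
      by (subst nn_integral_cmult) (simp_all add: nn_integral_K_weight[OF a b \<theta>])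
    also have "\<dots> = ennreal ((a\<^sup>2 * b\<^sup>2 / (a powr \<theta> * b powr (1 - \<theta>))\<^sup>2) / (K_norm_const \<theta>)\<^sup>2)"
      by (simp add: ennreal_mult'[symmetric] mult.commute)
    also have "\<dots> = ennreal ((a powr (1 - \<theta>) * b powr \<theta> / K_norm_const \<theta>)\<^sup>2)"
      unfolding powr_complement_sq[OF a b] by (simp add: power_divide)
    finally have I: "I x \<le> ennreal ((a powr (1 - \<theta>) * b powr \<theta> / K_norm_const \<theta>)\<^sup>2)" .
    then have "x \<in> EK" using S by (auto simp: EK_iff intro: le_less_trans)
    then show ?thesis using I by (simp add: nK_le_iff)
  qed (simp add: EK_0 XK.N_0)
  then show "x \<in> EK" "nK x \<le> a powr (1 - \<theta>) * b powr \<theta>" by auto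
qed

lemma D_EK: "D \<subseteq> EK"
  using nK_le_of_bounds(1) by blast

text \<open>The dual estimate, again with constant 1: Cauchy-Schwarz turns \<open>le\<close> into a
  lower bound for \<open>K t x\<close>. With \<open>h\<close> the norm of \<open>T x\<close> it is
  condition (ii).\<close>

lemma nK_ge_of_bounds:
  assumes x: "x \<in> D" and pos: "0 < a" "0 < b" "0 \<le> h"
    and le: "\<And>x0 x1. x0 \<in> D \<Longrightarrow> x1 \<in> D \<Longrightarrow> x = x0 + x1 \<Longrightarrow> h \<le> a * n0 x0 + b * n1 x1"
  shows "h \<le> a powr (1 - \<theta>) * b powr \<theta> * nK x"
proof -
  have S: "x \<in> \<Sigma>" and xK: "x \<in> EK" using x \<Sigma>I0 D_EK by blast+
  have C: "0 < K_norm_const \<theta>" by (rule K_norm_const_pos[OF \<theta>])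
  have Kge: "t\<^sup>2 * h\<^sup>2 / (b\<^sup>2 + a\<^sup>2 * t\<^sup>2) \<le> (K t x)\<^sup>2" if t: "t > 0" for t
  proof (rule K_sq_ge[OF S])
    fix x0 x1 assume s: "x0 \<in> E0" "x1 \<in> E1" "x = x0 + x1"
    have "h \<le> a * n0 x0 + b * n1 x1"
      using split_in_D[OF x s] s(3) by (intro le) auto
    then have "h\<^sup>2 \<le> (a * n0 x0 + b * n1 x1)\<^sup>2"
      using pos by (intro power_mono) auto
    then have "t\<^sup>2 * h\<^sup>2 \<le> t\<^sup>2 * (a * n0 x0 + b * n1 x1)\<^sup>2"
      by (intro mult_left_mono) auto
    \<comment> \<open>Lagrange's identity for the vectors \<open>(a t, b)\<close> and
      \<open>(n0 x0, t n1 x1)\<close>.\<close>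
    also have "\<dots> = (b\<^sup>2 + a\<^sup>2 * t\<^sup>2) * ((n0 x0)\<^sup>2 + t\<^sup>2 * (n1 x1)\<^sup>2) - (b * n0 x0 - a * t\<^sup>2 * n1 x1)\<^sup>2"
      by (simp add: power2_eq_square algebra_simps)
    also have "\<dots> \<le> (b\<^sup>2 + a\<^sup>2 * t\<^sup>2) * (cost t x0 x1)\<^sup>2"
      by (simp add: cost_sq)
    finally show "t\<^sup>2 * h\<^sup>2 / (b\<^sup>2 + a\<^sup>2 * t\<^sup>2) \<le> (cost t x0 x1)\<^sup>2"
      using pos by (simp add: divide_le_eq add_pos_nonneg mult.commute)
  qed
  have "ennreal (h\<^sup>2) * (ennreal (t powr (1 - 2 * \<theta>) / (b\<^sup>2 + a\<^sup>2 * t\<^sup>2)) * indicator {0<..} t) \<le> \<phi> x t" for t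
  proof (cases "t > 0")
    case True
    have "t powr (1 - 2 * \<theta>) = t powr (-2 * \<theta>) * t"
      using True powr_add[of t "-2 * \<theta>" 1] by simp
    then have "h\<^sup>2 * (t powr (1 - 2 * \<theta>) / (b\<^sup>2 + a\<^sup>2 * t\<^sup>2)) = t powr (-2 * \<theta>) / t * (t\<^sup>2 * h\<^sup>2 / (b\<^sup>2 + a\<^sup>2 * t\<^sup>2))"
      using True by (simp add: power2_eq_square[of t])
    also have "\<dots> \<le> t powr (-2 * \<theta>) / t * (K t x)\<^sup>2"
      using Kge[OF True] True by (intro mult_left_mono) auto
    finally show ?thesis
      using True by (simp add: \<phi>_pos ennreal_mult'[symmetric] del: times_divide_eq_left times_divide_eq_right)
  qed (simp add: \<phi>_nonpos)
  then have "(\<integral>\<^sup>+t. ennreal (h\<^sup>2) * (ennreal (t powr (1 - 2 * \<theta>) / (b\<^sup>2 + a\<^sup>2 * t\<^sup>2)) * indicator {0<..} t) \<partial>lborel) \<le> I x"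
    unfolding I_eq by (intro nn_integral_mono)
  also have "(\<integral>\<^sup>+t. ennreal (h\<^sup>2) * (ennreal (t powr (1 - 2 * \<theta>) / (b\<^sup>2 + a\<^sup>2 * t\<^sup>2)) * indicator {0<..} t) \<partial>lborel)
     = ennreal (h\<^sup>2) * ennreal (1 / ((K_norm_const \<theta>)\<^sup>2 * (b powr \<theta> * a powr (1 - \<theta>))\<^sup>2))"
    by (subst nn_integral_cmult) (simp_all add: nn_integral_K_weight[OF pos(2,1) \<theta>])
  also have "\<dots> = ennreal ((h / (a powr (1 - \<theta>) * b powr \<theta>) / K_norm_const \<theta>)\<^sup>2)"
    by (simp add: ennreal_mult'[symmetric] power_divide power_mult_distrib mult_ac)
  finally have "(h / (a powr (1 - \<theta>) * b powr \<theta>) / K_norm_const \<theta>)\<^sup>2 \<le> (nK x / K_norm_const \<theta>)\<^sup>2"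
    unfolding I_nK[OF xK] by (subst (asm) ennreal_le_iff) auto
  then have "h / (a powr (1 - \<theta>) * b powr \<theta>) / K_norm_const \<theta> \<le> nK x / K_norm_const \<theta>"
    by (rule power2_le_imp_le) (use C nK_nonneg in simp)
  then show ?thesis using C pos by (simp add: divide_le_cancel) (simp add: field_simps)
qed

lemma n_eq_0: "x \<in> D \<Longrightarrow> n0 x = 0 \<longleftrightarrow> x = 0" "x \<in> D \<Longrightarrow> n1 x = 0 \<longleftrightarrow> x = 0"
  using normed_onD(4)[OF normed_H0] normed_onD(4)[OF normed_H1] by auto

text \<open>Applying \<open>T\<close> to splittings gives
  \<open>K t (T x) \<le> l0 * K (l1 / l0 * t) x\<close>; since dt / t is invariant under dilation,
  rescaling the integral contributes exactly the factor
  \<open>(l1 / l0) powr (2 * \<theta>)\<close>.\<close>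

lemma geo_cond_endo_K: "geo_cond_endo sc H0 H1 \<theta> (K_space H0 H1 \<theta>)"
  unfolding geo_cond_endo_def Let_def elems_\<Delta>
proof (intro allI impI ballI)
  fix T :: "'a \<Rightarrow> 'a" and l0 l1 :: real and x
  assume l: "0 \<le> l0" "0 \<le> l1" and T: "linear_between sc D sc D T"
    and T0: "\<forall>x\<in>D. n0 (T x) \<le> l0 * n0 x" and T1: "\<forall>x\<in>D. n1 (T x) \<le> l1 * n1 x" and x: "x \<in> D"
  have TD: "T y \<in> D" if "y \<in> D" for y using T that by (auto simp: linear_between_def)
  have Tadd: "T (y + z) = T y + T z" if "y \<in> D" "z \<in> D" for y z
    using T that unfolding linear_between_def by blast
  have S: "x \<in> \<Sigma>" "T x \<in> \<Sigma>" using x TD \<Sigma>I0 by blast+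
  show "nK (T x) \<le> l0 powr (1 - \<theta>) * l1 powr \<theta> * nK x"
  proof (cases "l0 = 0 \<or> l1 = 0")
    case True
    \<comment> \<open>Here the right side is \<open>0\<close>, as \<open>0 powr p = 0\<close>;
      definiteness of one endpoint norm gives \<open>T x = 0\<close>.\<close>
    then have "n0 (T x) \<le> 0 \<or> n1 (T x) \<le> 0" using T0 T1 x by fastforce
    then have "T x = 0"
      using n_eq_0 TD[OF x] X0.N_nonneg[of "T x"] X1.N_nonneg[of "T x"] by auto
    then show ?thesis using nK_nonneg[of x] by (simp add: XK.N_0)
  next
    case False
    then have pos: "0 < l0" "0 < l1" using l by auto
    define c where "c = l1 / l0"
    have c: "c > 0" using pos by (simp add: c_def)
    have KT: "K t (T x) \<le> l0 * K (c * t) x" if t: "t > 0" for t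
    proof -
      have "K t (T x) / l0 \<le> K (c * t) x"
      proof (rule K_ge[OF S(1)])
        fix x0 x1 assume s: "x0 \<in> E0" "x1 \<in> E1" "x = x0 + x1"
        note sD = split_in_D[OF x s]
        have "K t (T x) \<le> cost t (T x0) (T x1)"
          using K_le[of "T x0" "T x1" t] Tadd[OF sD] TD sD s(3) by auto
        also have "\<dots> \<le> sqrt ((l0 * n0 x0)\<^sup>2 + t\<^sup>2 * (l1 * n1 x1)\<^sup>2)"
          unfolding cost_def using T0 T1 sD TD X0.N_nonneg X1.N_nonneg
          by (intro real_sqrt_le_mono add_mono mult_left_mono power_mono) auto
        also have "\<dots> = sqrt (l0\<^sup>2 * ((n0 x0)\<^sup>2 + (c * t)\<^sup>2 * (n1 x1)\<^sup>2))"
          using pos by (simp add: c_def power_mult_distrib power_divide distrib_left)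
        also have "\<dots> = l0 * cost (c * t) x0 x1"
          using pos by (simp add: cost_def real_sqrt_mult)
        finally show "K t (T x) / l0 \<le> cost (c * t) x0 x1"
          using pos by (simp add: divide_le_eq mult.commute)
      qed
      then show ?thesis using pos by (simp add: divide_le_eq mult.commute)
    qed
    define d where "d = l0\<^sup>2 * c powr (2 * \<theta>)"
    have d: "d \<ge> 0" by (simp add: d_def)
    have "\<phi> (T x) t \<le> ennreal (d * c) * \<phi> x (c * t)" for t
    proof (cases "t > 0")
      case True
      have "t powr (-2 * \<theta>) / t * (K t (T x))\<^sup>2 \<le> t powr (-2 * \<theta>) / t * (l0 * K (c * t) x)\<^sup>2"
        using KT[OF True] True K_nonneg[OF S(2)] by (intro mult_left_mono power_mono) auto
      also have "\<dots> = d * c * ((c * t) powr (-2 * \<theta>) / (c * t) * (K (c * t) x)\<^sup>2)"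
        using True c by (simp add: d_def powr_mult powr_minus power_mult_distrib)
      finally show ?thesis
        using True c d by (simp add: \<phi>_pos ennreal_mult'[symmetric] del: times_divide_eq_left times_divide_eq_right)
    qed (simp add: \<phi>_nonpos)
    then have "I (T x) \<le> (\<integral>\<^sup>+t. ennreal (d * c) * \<phi> x (c * t) \<partial>lborel)"
      unfolding I_eq by (intro nn_integral_mono)
    also have "\<dots> = ennreal (d * c) * (\<integral>\<^sup>+t. \<phi> x (c * t) \<partial>lborel)"
      by (intro nn_integral_cmult measurable_compose[OF _ measurable_\<phi>[OF S(1)]]) simp
    also have "\<dots> = ennreal d * I x"
      using nn_integral_real_affine[OF measurable_\<phi>[OF S(1)], of c 0] c d
      by (simp add: I_eq ennreal_mult mult.assoc)
    also have "d = (l0 powr (1 - \<theta>) * l1 powr \<theta>)\<^sup>2"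
    proof -
      have "l0 powr (1 - \<theta>) * l1 powr \<theta> = l0 * (l1 / l0) powr \<theta>"
        using pos by (simp add: powr_diff powr_divide)
      then show ?thesis
        using c by (simp add: d_def power_mult_distrib c_def[symmetric] powr_power mult.commute)
    qed
    also have "ennreal ((l0 powr (1 - \<theta>) * l1 powr \<theta>)\<^sup>2) * I x
        = ennreal ((l0 powr (1 - \<theta>) * l1 powr \<theta> * nK x / K_norm_const \<theta>)\<^sup>2)"
      using D_EK x by (simp add: I_nK subset_iff ennreal_mult'[symmetric] power_mult_distrib power_divide)
    finally show ?thesis
      using D_EK TD[OF x] nK_nonneg[of x] by (subst nK_le_iff) auto
  qed
qed

lemma geo_cond_from_K:
  assumes "hilbert_on sg G"
  shows "geo_cond_from sg G sc H0 H1 \<theta> (K_space H0 H1 \<theta>)"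
  unfolding geo_cond_from_def Let_def elems_\<Delta>
proof (intro allI impI ballI)
  fix T and l0 l1 :: real and x
  assume l: "0 \<le> l0" "0 \<le> l1" and T: "linear_between sc D sg (elems G) T"
    and T0: "\<forall>x\<in>D. nrm G (T x) \<le> l0 * n0 x" and T1: "\<forall>x\<in>D. nrm G (T x) \<le> l1 * n1 x" and x: "x \<in> D"
  interpret G: parallelogram_seminorm sg "elems G" "nrm G"
    by (rule hilbert_on_parallelogram_seminorm[OF assms])
  have TG: "T y \<in> elems G" if "y \<in> D" for y using T that by (auto simp: linear_between_def)
  show "nrm G (T x) \<le> l0 powr (1 - \<theta>) * l1 powr \<theta> * nK x"
  proof (cases "l0 = 0 \<or> l1 = 0")
    case True
    then have "nrm G (T x) \<le> 0" using T0 T1 x by fastforce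
    then show ?thesis
      using nK_nonneg[of x] by (meson mult_nonneg_nonneg order_trans powr_ge_zero)
  next
    case False
    show ?thesis
    proof (rule nK_ge_of_bounds[OF x])
      fix x0 x1 assume s: "x0 \<in> D" "x1 \<in> D" "x = x0 + x1"
      have "T x = T x0 + T x1" using T s unfolding linear_between_def by blast
      then have "nrm G (T x) \<le> nrm G (T x0) + nrm G (T x1)"
        using G.N_triangle TG s by simp
      then show "nrm G (T x) \<le> l0 * n0 x0 + l1 * n1 x1"
        using bspec[OF T0 s(1)] bspec[OF T1 s(2)] by linarith
    qed (use False l G.N_nonneg TG x in auto)
  qed
qed

lemma geo_cond_into_K:
  assumes "hilbert_on sg G"
  shows "geo_cond_into sg G sc H0 H1 \<theta> (K_space H0 H1 \<theta>)"
  unfolding geo_cond_into_def Let_def elems_\<Delta>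
proof (intro allI impI ballI)
  fix T and l0 l1 :: real and x
  assume l: "0 \<le> l0" "0 \<le> l1" and T: "linear_between sg (elems G) sc D T"
    and T0: "\<forall>x\<in>elems G. n0 (T x) \<le> l0 * nrm G x" and T1: "\<forall>x\<in>elems G. n1 (T x) \<le> l1 * nrm G x"
    and x: "x \<in> elems G"
  interpret G: parallelogram_seminorm sg "elems G" "nrm G"
    by (rule hilbert_on_parallelogram_seminorm[OF assms])
  have "T x \<in> D" using T x by (auto simp: linear_between_def)
  then have "nK (T x) \<le> (l0 * nrm G x) powr (1 - \<theta>) * (l1 * nrm G x) powr \<theta>"
    using T0 T1 x by (intro nK_le_of_bounds) auto
  also have "\<dots> = l0 powr (1 - \<theta>) * l1 powr \<theta> * (nrm G x powr (1 - \<theta>) * nrm G x powr \<theta>)"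
    using l G.N_nonneg[OF x] by (simp add: powr_mult)
  also have "nrm G x powr (1 - \<theta>) * nrm G x powr \<theta> = nrm G x"
    using G.N_nonneg[OF x] by (simp flip: powr_add)
  finally show "nK (T x) \<le> l0 powr (1 - \<theta>) * l1 powr \<theta> * nrm G x" .
qed

lemma intermediate_space_K: "intermediate_space sc H0 H1 (K_space H0 H1 \<theta>)"
  unfolding intermediate_space_def
proof (intro conjI banach_K)
  show "continuous_inclusion (Delta_space H0 H1) (K_space H0 H1 \<theta>)"
  proof (rule continuous_inclusionI[OF normed_\<Delta>])
    fix x assume "x \<in> elems (Delta_space H0 H1)"
    then have x: "x \<in> D" by (simp add: elems_\<Delta>)
    have "nK x \<le> n\<Delta> x powr (1 - \<theta>) * n\<Delta> x powr \<theta>"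
      using x by (intro nK_le_of_bounds) (auto simp: n\<Delta>_eq)
    also have "\<dots> = n\<Delta> x"
      using x X0.N_nonneg[of x] by (simp add: n\<Delta>_eq flip: powr_add)
    finally show "nK x \<le> 1 * n\<Delta> x" by simp
  qed (use D_EK in \<open>auto simp: elems_\<Delta>\<close>)
  show "continuous_inclusion (K_space H0 H1 \<theta>) (Sigma_space H0 H1)"
    using EK_\<Sigma> n\<Sigma>_le_nK cK_pos by (intro continuous_inclusionI[OF normed_K, where C = "2 * cK"]) auto
qed

lemma geometric_K: "geometric_interpolation_space TYPE('h::ab_group_add) sc H0 H1 \<theta> (K_space H0 H1 \<theta>)"
  unfolding geometric_interpolation_space_def
proof (intro conjI allI impI)
  show "dense_in_space (elems (Delta_space H0 H1)) (K_space H0 H1 \<theta>)"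
    using dense_K[OF D_EK] by (simp add: elems_\<Delta>)
qed (use \<theta> intermediate_space_K hilbert_K geo_cond_endo_K geo_cond_from_K geo_cond_into_K in blast)+

end

section \<open>Uniqueness\<close>

context hilbert_pair
begin

lemma D_E0 [simp]: "x \<in> D \<Longrightarrow> x \<in> E0" and D_E1 [simp]: "x \<in> D \<Longrightarrow> x \<in> E1"
  by auto

declare Int_iff [simp del] IntI [rule del] IntE [rule del]

text \<open>The maximum norm of \<Delta> does not obey the parallelogram law in general; this
  equivalent norm does, and its form is the sum of the endpoint forms.\<close>

definition ND :: "'v \<Rightarrow> real" where "ND x = sqrt ((n0 x)\<^sup>2 + (n1 x)\<^sup>2)"

lemma ND_sq: "(ND x)\<^sup>2 = (n0 x)\<^sup>2 + (n1 x)\<^sup>2"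
  by (simp add: ND_def)

sublocale XD: parallelogram_seminorm sc D ND
proof
  show "subspace D" by (rule D_subspace)
  show "ND (sc c x) = cmod c * ND x" if "x \<in> D" for x c
    using that by (simp add: ND_def X0.N_scale X1.N_scale power_mult_distrib distrib_left[symmetric] real_sqrt_mult)
  show "(ND (x + y))\<^sup>2 + (ND (x - y))\<^sup>2 = 2 * (ND x)\<^sup>2 + 2 * (ND y)\<^sup>2" if "x \<in> D" "y \<in> D" for x y
    using X0.parallelogram[of x y] X1.parallelogram[of x y] that by (simp add: ND_sq)
qed (simp add: ND_def)

abbreviation "g0 \<equiv> polar n0"
abbreviation "g1 \<equiv> polar n1"
abbreviation "gD \<equiv> polar ND"

lemma gD_eq: "gD x y = g0 x y + g1 x y"
  by (simp add: polar_def ND_sq add_divide_distrib diff_divide_distrib)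

lemma ND_ge: "n0 x \<le> ND x" "n1 x \<le> ND x"
  unfolding ND_def by (auto intro!: real_le_rsqrt)

lemma n\<Delta>_le_ND: "n\<Delta> x \<le> ND x"
  using ND_ge by (simp add: n\<Delta>_eq)

lemma ND_le_n\<Delta>: "x \<in> D \<Longrightarrow> ND x \<le> 2 * n\<Delta> x"
proof (rule power2_le_imp_le)
  assume x: "x \<in> D"
  then have "0 \<le> n0 x" "0 \<le> n1 x" using X0.N_nonneg X1.N_nonneg by auto
  then have "(n0 x)\<^sup>2 \<le> (n\<Delta> x)\<^sup>2" "(n1 x)\<^sup>2 \<le> (n\<Delta> x)\<^sup>2"
    by (auto intro!: power_mono simp: n\<Delta>_eq)
  then show "(ND x)\<^sup>2 \<le> (2 * n\<Delta> x)\<^sup>2"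
    by (simp add: ND_sq power_mult_distrib) (use zero_le_power2[of "n\<Delta> x"] in linarith)
  show "0 \<le> 2 * n\<Delta> x" using \<open>0 \<le> n0 x\<close> by (simp add: n\<Delta>_eq)
qed

lemma ND_eq_0: "x \<in> D \<Longrightarrow> ND x = 0 \<longleftrightarrow> x = 0"
  using normed_onD(4)[OF normed_H0, of x] by (auto simp: ND_def XD.N_0 X0.N_0 X1.N_0 add_nonneg_eq_0_iff)

lemma D_complete:
  assumes s: "range s \<subseteq> D" and Cauchy: "\<forall>e>0. \<exists>M. \<forall>m\<ge>M. \<forall>n\<ge>M. ND (s m - s n) < e"
  shows "\<exists>l\<in>D. (\<lambda>n. ND (s n - l)) \<longlonglongrightarrow> 0"
proof -
  have "\<forall>e>0. \<exists>M. \<forall>m\<ge>M. \<forall>n\<ge>M. n\<Delta> (s m - s n) < e"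
    using Cauchy n\<Delta>_le_ND by (meson le_less_trans)
  then obtain l where l: "l \<in> D" "(\<lambda>n. n\<Delta> (s n - l)) \<longlonglongrightarrow> 0"
    using banach_\<Delta> s unfolding banach_on_def elems_\<Delta> by blast
  have sl: "s n - l \<in> D" for n using D_closed(3)[OF subsetD[OF s rangeI] l(1)] .
  have "(\<lambda>n. ND (s n - l)) \<longlonglongrightarrow> 0"
  proof (rule real_tendsto_sandwich[OF _ _ tendsto_const])
    show "\<forall>\<^sub>F n in sequentially. 0 \<le> ND (s n - l)" by (simp add: ND_def)
    show "\<forall>\<^sub>F n in sequentially. ND (s n - l) \<le> 2 * n\<Delta> (s n - l)" using ND_le_n\<Delta>[OF sl] by simp
    show "(\<lambda>n. 2 * n\<Delta> (s n - l)) \<longlonglongrightarrow> 0" by (rule tendsto_mult_right_zero[OF l(2)])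
  qed
  then show ?thesis using l by blast
qed

definition GD :: "'v nspace" where "GD = \<lparr>elems = D, nrm = ND\<rparr>"

lemma hilbert_GD: "hilbert_on sc GD"
proof (rule hilbert_onI)
  show "parallelogram_seminorm sc (elems GD) (nrm GD)"
    using XD.parallelogram_seminorm_axioms by (simp add: GD_def)
  have "normed_on sc GD"
    unfolding normed_on_def GD_def nspace.simps
    using XD.subsp XD.N_nonneg ND_eq_0 XD.N_scale XD.N_triangle vector_space_axioms by blast
  then show "banach_on sc GD"
    unfolding banach_on_def GD_def nspace.simps using D_complete by blast
qed

lemma ex_A: "x \<in> D \<Longrightarrow> \<exists>z\<in>D. \<forall>y\<in>D. gD z y = g0 x y"
proof (rule XD.Riesz_representation[where C = "n0 x", OF D_complete])
  fix y assume "x \<in> D" "y \<in> D"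
  then have "\<bar>g0 x y\<bar> \<le> n0 x * n0 y" using X0.Cauchy_Schwarz by auto
  also have "\<dots> \<le> n0 x * ND y" using ND_ge X0.N_nonneg[of x] \<open>x \<in> D\<close> by (intro mult_left_mono) auto
  finally show "\<bar>g0 x y\<bar> \<le> n0 x * ND y" .
qed (auto simp: X0.g_add_right X0.g_scale_right)

definition A :: "'v \<Rightarrow> 'v" where "A x = (SOME z. z \<in> D \<and> (\<forall>y\<in>D. gD z y = g0 x y))"

lemma A_D: "x \<in> D \<Longrightarrow> A x \<in> D" and gD_A: "x \<in> D \<Longrightarrow> y \<in> D \<Longrightarrow> gD (A x) y = g0 x y"
  using someI_ex[of "\<lambda>z. z \<in> D \<and> (\<forall>y\<in>D. gD z y = g0 x y)"] ex_A[of x] by (auto simp: A_def)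

lemma A_eqI:
  assumes "x \<in> D" "z \<in> D" "\<And>y. y \<in> D \<Longrightarrow> gD z y = g0 x y"
  shows "A x = z"
proof -
  have d: "A x - z \<in> D" using assms A_D D_closed(3) by blast
  have "gD (A x - z) (A x - z) = 0"
    using assms d gD_A[OF assms(1) d] by (subst XD.g_diff_left) (auto simp: A_D)
  then have "ND (A x - z) = 0" using XD.g_self[OF d] by simp
  then show ?thesis using ND_eq_0[OF d] by simp
qed

sublocale A: positive_contraction sc D ND A
proof
  fix x y assume x: "x \<in> D" and y: "y \<in> D"
  show "A (x + y) = A x + A y"
    using x y by (intro A_eqI) (auto simp: D_closed A_D XD.g_add_left X0.g_add_left gD_A)
  show "gD (A x) y = gD x (A y)"
    using x y gD_A[of x y] gD_A[of y x] XD.g_commute[of x "A y"] X0.g_commute[of x y] by (simp add: A_D)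
next
  fix x assume x: "x \<in> D"
  show "A (sc c x) = sc c (A x)" for c
  proof (rule A_eqI)
    fix y assume "y \<in> D"
    then show "gD (sc c (A x)) y = g0 (sc c x) y"
      using x D_closed(5)[of y "cnj c"] XD.g_scale_complex[OF A_D[OF x]] X0.g_scale_complex[of x y c]
      by (simp add: gD_A)
  qed (use x A_D D_closed in auto)
  have "g0 x x = (n0 x)\<^sup>2" "g1 x x = (n1 x)\<^sup>2"
    using X0.g_self X1.g_self x by auto
  then show "0 \<le> gD (A x) x" "gD (A x) x \<le> gD x x"
    using gD_A[OF x x] by (auto simp: gD_eq)
qed (rule A_D)

lemma gD_co: "x \<in> D \<Longrightarrow> y \<in> D \<Longrightarrow> gD (x - A x) y = g1 x y"
  by (simp add: XD.g_diff_left A_D gD_A) (simp add: gD_eq)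

text \<open>\<open>gD (A z) z = (n0 z)\<^sup>2\<close>, and \<open>n0\<close> is definite;
  \<open>co_inj\<close> is the same with \<open>1 - A\<close> and \<open>n1\<close>.\<close>

lemma A_inj: "z \<in> D \<Longrightarrow> ND (A z) = 0 \<Longrightarrow> ND z = 0"
  using gD_A[of z z] X0.g_self[of z] normed_onD(4)[OF normed_H0, of z] XD.Cauchy_Schwarz[of "A z" z]
  by (auto simp: A_D XD.N_0)

lemma co_inj: "z \<in> D \<Longrightarrow> ND (A z - z) = 0 \<Longrightarrow> ND z = 0"
  using gD_co[of z z] X1.g_self[of z] normed_onD(4)[OF normed_H1, of z] XD.Cauchy_Schwarz[of "z - A z" z]
    XD.N_minus_commute[of "A z" z]
  by (auto simp: A_D XD.N_0 D_closed)

lemma n0_A_le: assumes x: "x \<in> D" shows "n0 (A x) \<le> n0 x"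
proof -
  have "(n0 (A x))\<^sup>2 \<le> (ND (A x))\<^sup>2" by (simp add: ND_sq)
  also have "\<dots> = g0 x (A x)" using gD_A[OF x A_D[OF x]] XD.g_self[OF A_D[OF x]] by simp
  also have "\<dots> \<le> n0 x * n0 (A x)" using X0.Cauchy_Schwarz[of x "A x"] x A_D[OF x] by auto
  finally have "n0 (A x) * n0 (A x) \<le> n0 x * n0 (A x)" by (simp add: power2_eq_square)
  then show ?thesis using X0.N_nonneg[of x] X0.N_nonneg[of "A x"] x A_D[OF x] by (cases "n0 (A x) = 0") auto
qed

text \<open>\<open>A\<close> is not tied directly to the form of H1, but \<open>v = x - A x\<close>
  is: it satisfies \<open>(n1 v)\<^sup>2 \<le> g1 x v\<close>, which bounds
  \<open>n1 (x - v)\<close> by \<open>n1 x\<close>.\<close>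

lemma n1_A_le: assumes x: "x \<in> D" shows "n1 (A x) \<le> n1 x"
proof (rule power2_le_imp_le)
  define v where "v = x - A x"
  have v: "v \<in> D" using x A_D D_closed by (simp add: v_def)
  have "(n1 v)\<^sup>2 \<le> (ND v)\<^sup>2" by (simp add: ND_sq)
  also have "\<dots> = g1 x v" using gD_co[OF x v] XD.g_self[OF v] by (simp add: v_def)
  finally have "(n1 v)\<^sup>2 \<le> g1 x v" .
  moreover have "(n1 (A x))\<^sup>2 = (n1 x)\<^sup>2 - 2 * g1 x v + (n1 v)\<^sup>2"
    using X1.N_diff_sq[of x v] x v by (simp add: v_def)
  moreover have "0 \<le> (n1 v)\<^sup>2" by simp
  ultimately show "(n1 (A x))\<^sup>2 \<le> (n1 x)\<^sup>2" by linarith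
qed (use x X1.N_nonneg in auto)

text \<open>The product of \<open>A x\<close> and \<open>x\<close> in H0 is real. Together with
  \<open>g1_iA\<close> this removes the first-order term in \<open>s\<close> from both endpoint
  norms of \<open>x + i s A x\<close>.\<close>

lemma g0_iA: "x \<in> D \<Longrightarrow> g0 x (sc \<i> (A x)) = 0"
  using gD_A[of x "sc \<i> (A x)"] XD.g_i_self[of "A x"] XD.g_commute[of "A x" "sc \<i> (A x)"]
  by (simp add: A_D D_closed)

lemma g1_iA: "x \<in> D \<Longrightarrow> g1 x (sc \<i> (A x)) = 0"
proof -
  assume x: "x \<in> D"
  have "gD x (sc \<i> (A x)) = gD (A x) (sc \<i> x)"
    using x A.A_scale[of x \<i>] A.A_sym[of x "sc \<i> x"] by (simp add: D_closed)
  also have "\<dots> = g0 x (sc \<i> x)" using x by (simp add: gD_A D_closed)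
  also have "\<dots> = 0" using X0.g_i_self[of x] X0.g_commute[of x "sc \<i> x"] x by (simp add: X0.S_closed)
  finally show ?thesis using g0_iA[OF x] by (simp add: gD_eq)
qed

lemma cip_A: "x \<in> D \<Longrightarrow> y \<in> D \<Longrightarrow> XD.cip y (A x) = X0.cip y x"
  using gD_A[of x y] gD_A[of "sc \<i> x" y] XD.g_commute[of y "A x"] XD.g_commute[of y "sc \<i> (A x)"]
    X0.g_commute[of y x] X0.g_commute[of y "sc \<i> x"] A.A_scale[of x \<i>]
  by (simp add: XD.cip_def X0.cip_def D_closed X0.S_closed A_D)

lemma cip_co: "x \<in> D \<Longrightarrow> y \<in> D \<Longrightarrow> XD.cip y (x - A x) = X1.cip y x"
  using gD_co[of x y] gD_co[of "sc \<i> x" y] XD.g_commute[of y "x - A x"] XD.g_commute[of y "sc \<i> (x - A x)"]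
    X1.g_commute[of y x] X1.g_commute[of y "sc \<i> x"] A.A_scale[of x \<i>]
  by (simp add: XD.cip_def X1.cip_def D_closed X1.S_closed A_D scale_right_diff_distrib)

end

text \<open>The tangent at \<open>r\<close> of the concave function \<open>a \<mapsto> a\<^sup>1\<^sup>-\<^sup>\<theta> (1 - a)\<^sup>\<theta>\<close> and the cubic minorant touching it at \<open>r\<close>
  differ by \<open>(a - r)\<^sup>2\<close> times a factor that is linear in \<open>a\<close>.\<close>

lemma tangent_gap:
  fixes r \<theta> m0 m1 m2 m3 :: real
  shows "(1 - \<theta>) * r * (1 - r)\<^sup>2 * m1 + \<theta> * r\<^sup>2 * (1 - r) * (m0 - m1) - 2 * r * (1 - r) * (m1 - m2)
      + ((1 - \<theta>) * r * (m1 - 2 * m2 + m3) + \<theta> * (1 - r) * (m2 - m3))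
    = \<theta> * (1 - r) * ((m2 - 2 * r * m1 + r\<^sup>2 * m0) - (m3 - 2 * r * m2 + r\<^sup>2 * m1))
      + (1 - \<theta>) * r * (m3 - 2 * r * m2 + r\<^sup>2 * m1)"
  by algebra

section \<open>What the three conditions say about \<open>A\<close>\<close>

locale geometric_space = hilbert_pair_exponent +
  fixes H
  assumes geo: "geometric_interpolation_space TYPE('a) sc H0 H1 \<theta> H"
begin

abbreviation "nH \<equiv> nrm H"
abbreviation "h \<equiv> polar (nrm H)"
abbreviation "co x \<equiv> x - A x"

text \<open>Conditions (ii) and (iii) are used with the single auxiliary Hilbert space
  \<open>GD\<close>; it lives in the ambient type, which explains the type argument in the
  locale.\<close>

lemma hilbert_H: "hilbert_on sc H" and dense_H: "dense_in_space D H"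
  and banach_H: "banach_on sc H"
  and incl_\<Delta>: "continuous_inclusion (Delta_space H0 H1) H"
  and incl_\<Sigma>: "continuous_inclusion H (Sigma_space H0 H1)"
  and endo_H: "geo_cond_endo sc H0 H1 \<theta> H"
  and from_H: "geo_cond_from sc GD sc H0 H1 \<theta> H"
  and into_H: "geo_cond_into sc GD sc H0 H1 \<theta> H"
  using geo hilbert_GD
  by (simp_all add: geometric_interpolation_space_def intermediate_space_def elems_\<Delta>)

lemma normed_H: "normed_on sc H"
  using banach_H by (rule banach_on_normed_on)

sublocale XE: parallelogram_seminorm sc "elems H" nH
  by (rule hilbert_on_parallelogram_seminorm[OF hilbert_H])

lemma D_H: "D \<subseteq> elems H"
  using dense_H by (simp add: dense_in_space_def)

lemma D_HI [simp]: "x \<in> D \<Longrightarrow> x \<in> elems H"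
  using D_H by blast

sublocale XH: parallelogram_seminorm sc D nH
  by unfold_locales (simp_all add: D_subspace XE.N_nonneg XE.N_scale XE.parallelogram)

lemma nH_le_ND: "\<exists>C\<ge>0. \<forall>x\<in>D. nH x \<le> C * ND x"
proof -
  obtain C where C: "0 < C" "\<And>z. z \<in> D \<Longrightarrow> nH z \<le> C * n\<Delta> z"
    using continuous_inclusion_bounded[OF normed_\<Delta> normed_H incl_\<Delta>] unfolding elems_\<Delta> by blast
  have "nH x \<le> C * ND x" if "x \<in> D" for x
    using C(2)[OF that] n\<Delta>_le_ND[of x] C(1) by (meson less_imp_le mult_left_mono order_trans)
  then show ?thesis using C(1) by (intro exI[of _ C]) auto
qed

text \<open>The operators \<open>1 + isA\<close> have norm at most \<open>(1 + s\<^sup>2)\<^sup>1\<^sup>/\<^sup>2\<close> on both endpoint spaces, and hence on \<open>H\<close>;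
  expanding in \<open>s\<close> shows that \<open>A\<close> is symmetric for \<open>h\<close>.\<close>

lemma h_iA: assumes x: "x \<in> D" shows "h x (sc \<i> (A x)) = 0"
proof -
  have iA: "sc \<i> (A y) \<in> D" if "y \<in> D" for y using that by (simp add: A_D D_closed)
  have "s * (2 * h x (sc \<i> (A x))) \<le> s\<^sup>2 * (nH x)\<^sup>2" for s
  proof -
    define T where "T y = y + sc (of_real s) (sc \<i> (A y))" for y
    define L where "L = sqrt (1 + s\<^sup>2)"
    have L: "L > 0" "L\<^sup>2 = 1 + s\<^sup>2" by (auto simp: L_def add_pos_nonneg)
    have T_D: "T y \<in> D" if "y \<in> D" for y using that by (simp add: T_def D_closed A_D)
    have lin: "linear_between sc D sc D T"
      unfolding linear_between_def
      using T_D by (auto simp: T_def A.A_add A.A_scale scale_right_distrib scale_left_commute mult_ac)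
    have T0: "n0 (T y) \<le> L * n0 y" if y: "y \<in> D" for y
    proof (rule power2_le_imp_le)
      have "(n0 (T y))\<^sup>2 = (n0 y)\<^sup>2 + 2 * (s * g0 y (sc \<i> (A y))) + s\<^sup>2 * (n0 (A y))\<^sup>2"
        unfolding T_def using y iA[OF y] A_D[OF y]
        by (simp add: X0.N_add_sq X0.S_closed X0.g_scale_right X0.N_scale power_mult_distrib del: scale_scale)
      also have "\<dots> \<le> (n0 y)\<^sup>2 + s\<^sup>2 * (n0 y)\<^sup>2"
        using g0_iA[OF y] n0_A_le[OF y] A_D[OF y] by (simp add: mult_left_mono power_mono X0.N_nonneg)
      finally show "(n0 (T y))\<^sup>2 \<le> (L * n0 y)\<^sup>2" by (simp add: power_mult_distrib L algebra_simps)
    qed (use L y X0.N_nonneg in auto)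
    have T1: "n1 (T y) \<le> L * n1 y" if y: "y \<in> D" for y
    proof (rule power2_le_imp_le)
      have "(n1 (T y))\<^sup>2 = (n1 y)\<^sup>2 + 2 * (s * g1 y (sc \<i> (A y))) + s\<^sup>2 * (n1 (A y))\<^sup>2"
        unfolding T_def using y iA[OF y] A_D[OF y]
        by (simp add: X1.N_add_sq X1.S_closed X1.g_scale_right X1.N_scale power_mult_distrib del: scale_scale)
      also have "\<dots> \<le> (n1 y)\<^sup>2 + s\<^sup>2 * (n1 y)\<^sup>2"
        using g1_iA[OF y] n1_A_le[OF y] A_D[OF y] by (simp add: mult_left_mono power_mono X1.N_nonneg)
      finally show "(n1 (T y))\<^sup>2 \<le> (L * n1 y)\<^sup>2" by (simp add: power_mult_distrib L algebra_simps)
    qed (use L y X1.N_nonneg in auto)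
    have "nH (T x) \<le> L powr (1 - \<theta>) * L powr \<theta> * nH x"
      using endo_H[unfolded geo_cond_endo_def Let_def elems_\<Delta>, rule_format, OF _ _ lin, of L L x] T0 T1 x L by simp
    also have "L powr (1 - \<theta>) * L powr \<theta> = L" using L by (simp flip: powr_add)
    finally have "(nH (T x))\<^sup>2 \<le> (L * nH x)\<^sup>2"
      using XH.N_nonneg[OF T_D[OF x]] by (intro power_mono) auto
    moreover have "(nH (T x))\<^sup>2 = (nH x)\<^sup>2 + 2 * (s * h x (sc \<i> (A x))) + s\<^sup>2 * (nH (A x))\<^sup>2"
      unfolding T_def using x iA[OF x] A_D[OF x]
      by (simp add: XH.N_add_sq XH.S_closed XH.g_scale_right XH.N_scale power_mult_distrib del: scale_scale)
    moreover have "(L * nH x)\<^sup>2 = (nH x)\<^sup>2 + s\<^sup>2 * (nH x)\<^sup>2"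
      by (simp add: power_mult_distrib L algebra_simps)
    moreover have "0 \<le> s\<^sup>2 * (nH (A x))\<^sup>2" by simp
    ultimately show ?thesis by linarith
  qed
  then show ?thesis using linear_le_quadratic_imp_zero by fastforce
qed

text \<open>Polarise \<open>h_iA\<close> at \<open>u + v\<close>, then replace \<open>x\<close> by
  \<open>i x\<close>, using that multiplication by \<open>i\<close> preserves
  \<open>h\<close>.\<close>

lemma h_A_sym: assumes x: "x \<in> D" and y: "y \<in> D" shows "h (A x) y = h x (A y)"
proof -
  have cross: "h u (sc \<i> (A v)) + h v (sc \<i> (A u)) = 0" if u: "u \<in> D" and v: "v \<in> D" for u v
    using h_iA[OF D_closed(2)[OF u v]] h_iA[OF u] h_iA[OF v] u v
    by (simp add: A.A_add scale_right_distrib XH.g_add_left XH.g_add_right A_D D_closed)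
  have "h (sc \<i> x) (sc \<i> (A y)) + h y (sc \<i> (A (sc \<i> x))) = 0"
    using cross[of "sc \<i> x" y] x y by (simp add: D_closed)
  moreover have "sc \<i> (A (sc \<i> x)) = - A x"
    using x by (simp add: A.A_scale)
  ultimately show ?thesis
    using x y XH.g_commute[of y "A x"] by (simp add: XH.g_ii XH.g_minus_right A_D D_closed)
qed

lemma compatible_form_h: "compatible_form D ND A h"
  unfolding compatible_form_def
proof (intro conjI ballI)
  obtain C where C: "C \<ge> 0" "\<And>x. x \<in> D \<Longrightarrow> nH x \<le> C * ND x" using nH_le_ND by blast
  have "\<bar>h x y\<bar> \<le> C\<^sup>2 * ND x * ND y" if x: "x \<in> D" and y: "y \<in> D" for x y
  proof -
    have "\<bar>h x y\<bar> \<le> nH x * nH y" by (rule XH.Cauchy_Schwarz[OF x y])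
    also have "\<dots> \<le> (C * ND x) * (C * ND y)"
      using C x y XH.N_nonneg XD.N_nonneg by (intro mult_mono) auto
    finally show ?thesis by (simp add: power2_eq_square mult_ac)
  qed
  then show "\<exists>C\<ge>0. \<forall>x\<in>D. \<forall>y\<in>D. \<bar>h x y\<bar> \<le> C * ND x * ND y"
    by (intro exI[of _ "C\<^sup>2"]) auto
  show "h x y = h y x" if "x \<in> D" "y \<in> D" for x y using that by (rule XH.g_commute)
qed (simp_all add: XH.g_add_left h_A_sym)

lemma linear_between_rank_one:
  assumes "e \<in> D" "z \<in> D"
  shows "linear_between sc D sc D (\<lambda>y. sc (XD.cip y e / c) z)"
  unfolding linear_between_def
  using assms by (auto simp: D_closed XD.cip_add_left XD.cip_scale_left scale_left_distrib add_divide_distrib)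

text \<open>Condition (iii) for the rank-one map sending \<open>y\<close> to
  \<open>(y, x) x / ND x\<close>, with the product of \<Delta>. Its bounds into H0 and H1 are
  \<open>n0 x\<close> and \<open>n1 x\<close>, and at \<open>x\<close> it is multiplication by
  \<open>ND x\<close>.\<close>

lemma nH_upper: assumes x: "x \<in> D" shows "nH x \<le> n0 x powr (1 - \<theta>) * n1 x powr \<theta>"
proof (cases "x = 0")
  case True
  then show ?thesis by (simp add: XH.N_0)
next
  case False
  define c where "c = ND x"
  have c: "c > 0" using False ND_eq_0[OF x] XD.N_nonneg[OF x] by (simp add: c_def)
  define T where "T y = sc (XD.cip y x / of_real c) x" for y
  have lin: "linear_between sc (elems GD) sc D T"
    unfolding T_def GD_def using linear_between_rank_one[OF x x] by simp
  have cy: "cmod (XD.cip y x / of_real c) \<le> ND y" if "y \<in> D" for y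
    using XD.cip_Cauchy_Schwarz[OF that x] c by (simp add: norm_divide divide_le_eq c_def)
  have T0: "n0 (T y) \<le> n0 x * nrm GD y" and T1: "n1 (T y) \<le> n1 x * nrm GD y" if "y \<in> elems GD" for y
    using cy[of y] that x X0.N_nonneg[of x] X1.N_nonneg[of x]
    by (simp_all add: T_def GD_def X0.N_scale X1.N_scale mult.commute[of _ "n0 x"] mult.commute[of _ "n1 x"] mult_left_mono)
  have "nH (T x) \<le> n0 x powr (1 - \<theta>) * n1 x powr \<theta> * nrm GD x"
    using into_H[unfolded geo_cond_into_def Let_def elems_\<Delta>, rule_format, OF _ _ lin, of "n0 x" "n1 x" x]
      T0 T1 x X0.N_nonneg[of x] X1.N_nonneg[of x] by (simp add: GD_def)
  moreover have "XD.cip x x = of_real (c\<^sup>2)"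
    using XD.g_i_self[OF x] XD.g_commute[of x "sc \<i> x"] XD.g_self[OF x] x
    by (simp add: XD.cip_def complex_eq_iff D_closed c_def)
  then have "T x = sc (of_real c) x" using c by (simp add: T_def power2_eq_square)
  ultimately show ?thesis
    using c x by (simp add: XH.N_scale GD_def c_def[symmetric] mult.commute)
qed

text \<open>Condition (ii) for the functional \<open>(y, e)\<close> of \<Delta>, made
  \<open>GD\<close>-valued along the unit vector \<open>x / ND x\<close>. The choice
  \<open>e = A (1 - A) x\<close> can be read in two ways: as \<open>A\<close> applied to
  \<open>co x\<close> it is the functional of \<open>co x\<close> in H0, as \<open>1 - A\<close>
  applied to \<open>A x\<close> that of \<open>A x\<close> in H1. Both endpoint bounds are thereby
  explicit.\<close>

lemma nH_lower:
  assumes x: "x \<in> D"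
  shows "\<bar>gD x (A (co x))\<bar> \<le> n0 (co x) powr (1 - \<theta>) * n1 (A x) powr \<theta> * nH x"
proof (cases "x = 0")
  case True
  then show ?thesis using XD.g_0_left D_closed(1) A.A_scale[of 0 0] by (simp add: XH.N_0)
next
  case False
  define c where "c = ND x"
  have c: "c > 0" using False ND_eq_0[OF x] XD.N_nonneg[OF x] by (simp add: c_def)
  define e where "e = A (co x)"
  have co: "co x \<in> D" "A x \<in> D" using x by (auto simp: A_D D_closed)
  have e: "e \<in> D" using co by (simp add: e_def A_D)
  have e': "e = A x - A (A x)" using x by (simp add: e_def A.A_diff A_D)
  define T where "T y = sc (XD.cip y e / of_real c) x" for y
  have lin: "linear_between sc D sc (elems GD) T"
    unfolding T_def GD_def using linear_between_rank_one[OF e x] by simp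
  have nT: "nrm GD (T y) = cmod (XD.cip y e)" if "y \<in> D" for y
    using that x c by (simp add: T_def GD_def XD.N_scale norm_divide c_def[symmetric])
  have T0: "nrm GD (T y) \<le> n0 (co x) * n0 y" if "y \<in> D" for y
    unfolding nT[OF that] e_def cip_A[OF co(1) that]
    using X0.cip_Cauchy_Schwarz[of y "co x"] that co by (simp add: mult.commute)
  have T1: "nrm GD (T y) \<le> n1 (A x) * n1 y" if "y \<in> D" for y
    unfolding nT[OF that] e' cip_co[OF co(2) that]
    using X1.cip_Cauchy_Schwarz[of y "A x"] that co by (simp add: mult.commute)
  have "nrm GD (T x) \<le> n0 (co x) powr (1 - \<theta>) * n1 (A x) powr \<theta> * nH x"
    using from_H[unfolded geo_cond_from_def Let_def elems_\<Delta>, rule_format, OF _ _ lin, of "n0 (co x)" "n1 (A x)" x]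
      T0 T1 x co X0.N_nonneg[of "co x"] X1.N_nonneg[of "A x"] by simp
  moreover have "\<bar>gD x e\<bar> \<le> cmod (XD.cip x e)"
    using abs_Re_le_cmod[of "XD.cip x e"] by (simp add: XD.Re_cip)
  ultimately show ?thesis by (simp add: nT[OF x] e_def)
qed

end

section \<open>Comparison of two geometric interpolation spaces\<close>

context hilbert_pair_exponent
begin

text \<open>For an eigenvector of \<open>A\<close> with eigenvalue \<open>r\<close> the upper bound
  for \<open>H\<close> and the lower bound for \<open>H'\<close> coincide. As functions of the
  spectral variable they also agree to first order at \<open>r\<close>, so only a multiple of
  \<open>(A - r)\<^sup>2\<close> survives in the difference.\<close>

lemma geometric_norm_difference:
  assumes H: "geometric_space sc H0 H1 \<theta> H" and H': "geometric_space sc H0 H1 \<theta> H'"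
    and r: "0 < r" "r < 1" and x: "x \<in> D"
  shows "(nrm H x)\<^sup>2 - (nrm H' x)\<^sup>2 \<le> (ND (A x - sc (of_real r) x))\<^sup>2 / (r * (1 - r))\<^sup>2"
proof -
  interpret H: geometric_space sc H0 H1 \<theta> H by fact
  interpret H': geometric_space sc H0 H1 \<theta> H' by fact
  \<comment> \<open>The moments \<open>(A\<^sup>j x, x)\<close> in \<Delta>; every quantity below is
    a linear combination of them, which reduces the comparison to a polynomial identity.\<close>
  define m0 m1 m2 m3 where "m0 = gD x x" and "m1 = gD (A x) x" and "m2 = gD (A x) (A x)" and "m3 = gD (A (A x)) (A x)"
  define v where "v = A x - sc (of_real r) x"
  define u where "u = x - A x"
  define w where "w = r powr (1 - \<theta>) * (1 - r) powr \<theta>"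
  \<comment> \<open>The best multiplier in the completed square of \<open>lower\<close> would be
    \<open>gD x (A u) / Y\<close>; this is its value for an eigenvector with eigenvalue
    \<open>r\<close>.\<close>
  define k where "k = 1 / (r * (1 - r))"
  note cl = A_D D_closed
  have uv: "u \<in> D" "v \<in> D" using x by (simp_all add: u_def v_def cl)
  have n0_sq: "(n0 y)\<^sup>2 = gD (A y) y" if "y \<in> D" for y
    using gD_A[OF that that] X0.g_self[of y] that by simp
  have n1_sq: "(n1 y)\<^sup>2 = gD y y - gD (A y) y" if "y \<in> D" for y
    using gD_A[OF that that] X0.g_self[of y] X1.g_self[of y] that by (simp add: gD_eq)
  have sym: "gD x (A x) = m1" "gD x (A (A x)) = m2" "gD (A (A x)) x = m2" "gD (A x) (A (A x)) = m3"
    using x XD.g_commute[of x "A x"] A.A_sym[of x "A x"] A.A_sym[of "A x" x] A.A_sym[of "A x" "A x"]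
    by (simp_all add: m1_def m2_def m3_def cl)
  have a0: "(n0 x)\<^sup>2 = m1" and a1: "(n1 x)\<^sup>2 = m0 - m1"
    using n0_sq[OF x] n1_sq[OF x] by (simp_all add: m0_def m1_def)
  have X: "gD x (A u) = m1 - m2"
    using x by (simp add: u_def A.A_diff XD.g_diff_right cl sym)
  have P: "(n0 u)\<^sup>2 = m1 - 2 * m2 + m3"
    unfolding n0_sq[OF uv(1)] unfolding u_def using x
    by (simp add: A.A_diff XD.g_diff_left XD.g_diff_right cl sym m1_def[symmetric] m2_def[symmetric] m3_def[symmetric])
  have Q: "(n1 (A x))\<^sup>2 = m2 - m3"
    using n1_sq[of "A x"] x by (simp add: cl m2_def m3_def)
  have v0: "(n0 v)\<^sup>2 = m3 - 2 * r * m2 + r\<^sup>2 * m1"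
    unfolding n0_sq[OF uv(2)] unfolding v_def using x
    by (simp add: A.A_diff A.A_scale XD.g_diff_left XD.g_diff_right cl sym XD.g_scale_left XD.g_scale_right
        m1_def[symmetric] m2_def[symmetric] m3_def[symmetric] power2_eq_square algebra_simps)
  have vv: "(ND v)\<^sup>2 = m2 - 2 * r * m1 + r\<^sup>2 * m0"
    unfolding v_def using x
    by (simp add: XD.N_diff_sq cl XD.g_scale_right XD.N_scale power_mult_distrib XD.g_self
        m0_def m1_def m2_def)
  have v1: "(n1 v)\<^sup>2 = (ND v)\<^sup>2 - (n0 v)\<^sup>2" by (simp add: ND_sq)
  have w: "0 < w" "w \<le> 1"
  proof -
    show "0 < w" using r by (simp add: w_def)
    have "w \<le> (1 - \<theta>) * r + \<theta> * (1 - r)"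
      unfolding w_def using r \<theta> by (intro powr_weighted_mean_le) auto
    also have "\<dots> \<le> (1 - \<theta>) * 1 + \<theta> * 1"
      using r \<theta> by (intro add_mono mult_left_mono) auto
    finally show "w \<le> 1" by simp
  qed
  have k: "k > 0" using r by (simp add: k_def)
  have upper: "(nrm H x)\<^sup>2 \<le> w * k\<^sup>2 * ((1 - \<theta>) * r * (1 - r)\<^sup>2 * (n0 x)\<^sup>2 + \<theta> * r\<^sup>2 * (1 - r) * (n1 x)\<^sup>2)"
  proof -
    have "(nrm H x)\<^sup>2 \<le> (n0 x powr (1 - \<theta>) * n1 x powr \<theta>)\<^sup>2"
      using H.nH_upper[OF x] H.XH.N_nonneg[OF x] by (intro power_mono)
    also have "\<dots> = (n0 x)\<^sup>2 powr (1 - \<theta>) * (n1 x)\<^sup>2 powr \<theta>"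
      using x X0.N_nonneg X1.N_nonneg by (simp add: power_mult_distrib powr_sq)
    \<comment> \<open>Dividing by \<open>r\<close> and \<open>1 - r\<close> makes the two factors
      equal for an eigenvector with eigenvalue \<open>r\<close>, so the mean inequality produces the
      tangent at \<open>r\<close>.\<close>
    also have "\<dots> = w * (((n0 x)\<^sup>2 / r) powr (1 - \<theta>) * ((n1 x)\<^sup>2 / (1 - r)) powr \<theta>)"
      using r by (simp add: w_def powr_divide)
    also have "\<dots> \<le> w * ((1 - \<theta>) * ((n0 x)\<^sup>2 / r) + \<theta> * ((n1 x)\<^sup>2 / (1 - r)))"
      using w r \<theta> by (intro mult_left_mono powr_weighted_mean_le) auto
    also have "\<dots> = w * k\<^sup>2 * ((1 - \<theta>) * r * (1 - r)\<^sup>2 * (n0 x)\<^sup>2 + \<theta> * r\<^sup>2 * (1 - r) * (n1 x)\<^sup>2)"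
    proof -
      have "1 / r = k\<^sup>2 * (r * (1 - r)\<^sup>2)" "1 / (1 - r) = k\<^sup>2 * (r\<^sup>2 * (1 - r))"
        using r by (simp_all add: k_def power2_eq_square)
      then have "(n0 x)\<^sup>2 / r = k\<^sup>2 * (r * (1 - r)\<^sup>2) * (n0 x)\<^sup>2" "(n1 x)\<^sup>2 / (1 - r) = k\<^sup>2 * (r\<^sup>2 * (1 - r)) * (n1 x)\<^sup>2"
        by (metis mult.commute mult.right_neutral times_divide_eq_right)+
      then show ?thesis by (simp only: distrib_left mult_ac)
    qed
    finally show ?thesis .
  qed
  define Y where "Y = (1 - \<theta>) * r * (n0 u)\<^sup>2 + \<theta> * (1 - r) * (n1 (A x))\<^sup>2"
  have lower: "2 * w * k * gD x (A u) - w * k\<^sup>2 * Y \<le> (nrm H' x)\<^sup>2"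
  proof -
    have "(gD x (A u))\<^sup>2 \<le> (n0 u powr (1 - \<theta>) * n1 (A x) powr \<theta> * nrm H' x)\<^sup>2"
      using power_mono[OF H'.nH_lower[OF x], of 2] by (simp add: u_def)
    also have "\<dots> = (n0 u)\<^sup>2 powr (1 - \<theta>) * (n1 (A x))\<^sup>2 powr \<theta> * (nrm H' x)\<^sup>2"
      using uv A_D[OF x] X0.N_nonneg X1.N_nonneg by (simp add: power_mult_distrib powr_sq)
    finally have "w * (gD x (A u))\<^sup>2 \<le> w * ((n0 u)\<^sup>2 powr (1 - \<theta>) * (n1 (A x))\<^sup>2 powr \<theta> * (nrm H' x)\<^sup>2)"
      using w by (intro mult_left_mono) auto
    also have "\<dots> = ((r * (n0 u)\<^sup>2) powr (1 - \<theta>) * ((1 - r) * (n1 (A x))\<^sup>2) powr \<theta>) * (nrm H' x)\<^sup>2"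
      using r by (simp add: w_def powr_mult)
    also have "\<dots> \<le> ((1 - \<theta>) * (r * (n0 u)\<^sup>2) + \<theta> * ((1 - r) * (n1 (A x))\<^sup>2)) * (nrm H' x)\<^sup>2"
      using r \<theta> by (intro mult_right_mono powr_weighted_mean_le) auto
    finally have le: "w * (gD x (A u))\<^sup>2 \<le> Y * (nrm H' x)\<^sup>2" by (simp add: Y_def mult.assoc)
    have "Y \<ge> 0" using r \<theta> by (simp add: Y_def)
    show ?thesis
    proof (cases "Y = 0")
      case True
      then have "w * (gD x (A u))\<^sup>2 \<le> 0" using le by simp
      then have "gD x (A u) = 0" using w by (simp add: mult_le_0_iff)
      then show ?thesis using True by simp
    next
      case False
      then have "Y > 0" using \<open>Y \<ge> 0\<close> by simp
      \<comment> \<open>Linearises the quotient \<open>(gD x (A u))\<^sup>2 / Y\<close>, which is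
        not a quadratic form in \<open>x\<close>, by its lower bound
        \<open>2 * k * gD x (A u) - k\<^sup>2 * Y\<close>.\<close>
      have "0 \<le> w * (gD x (A u) - k * Y)\<^sup>2" using w by simp
      also have "\<dots> = w * (gD x (A u))\<^sup>2 - Y * (2 * w * k * gD x (A u) - w * k\<^sup>2 * Y)"
        by (simp add: power2_eq_square algebra_simps)
      finally have "Y * (2 * w * k * gD x (A u) - w * k\<^sup>2 * Y) \<le> Y * (nrm H' x)\<^sup>2" using le by simp
      then show ?thesis using \<open>Y > 0\<close> by (simp add: mult_le_cancel_left_pos)
    qed
  qed
  have "k = k\<^sup>2 * (r * (1 - r))" using r by (simp add: k_def power2_eq_square)
  then have "2 * w * k * gD x (A u) = w * k\<^sup>2 * (2 * r * (1 - r) * gD x (A u))"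
    by (metis (no_types, lifting) mult.assoc mult.left_commute)
  then have "(nrm H x)\<^sup>2 - (nrm H' x)\<^sup>2 \<le> w * k\<^sup>2 * ((1 - \<theta>) * r * (1 - r)\<^sup>2 * (n0 x)\<^sup>2
      + \<theta> * r\<^sup>2 * (1 - r) * (n1 x)\<^sup>2) - (w * k\<^sup>2 * (2 * r * (1 - r) * gD x (A u)) - w * k\<^sup>2 * Y)"
    using upper lower by linarith
  also have "\<dots> = w * k\<^sup>2 * ((1 - \<theta>) * r * (1 - r)\<^sup>2 * (n0 x)\<^sup>2 + \<theta> * r\<^sup>2 * (1 - r) * (n1 x)\<^sup>2
      - 2 * r * (1 - r) * gD x (A u) + Y)"
    by (simp add: right_diff_distrib distrib_left)
  also have "(1 - \<theta>) * r * (1 - r)\<^sup>2 * (n0 x)\<^sup>2 + \<theta> * r\<^sup>2 * (1 - r) * (n1 x)\<^sup>2 - 2 * r * (1 - r) * gD x (A u) + Y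
      = \<theta> * (1 - r) * (n1 v)\<^sup>2 + (1 - \<theta>) * r * (n0 v)\<^sup>2"
    unfolding Y_def a0 a1 X P Q v1 v0 vv by (rule tangent_gap)
  also have "w * k\<^sup>2 * (\<theta> * (1 - r) * (n1 v)\<^sup>2 + (1 - \<theta>) * r * (n0 v)\<^sup>2) \<le> 1 * k\<^sup>2 * (1 * (n1 v)\<^sup>2 + 1 * (n0 v)\<^sup>2)"
    using w r \<theta> by (intro mult_mono add_mono) (auto simp: mult_le_one)
  also have "\<dots> = (ND v)\<^sup>2 / (r * (1 - r))\<^sup>2"
    by (simp add: ND_sq k_def power_one_over add.commute)
  finally show ?thesis by (simp add: v_def)
qed

lemma geometric_norm_le_on_D:
  assumes H: "geometric_space sc H0 H1 \<theta> H" and H': "geometric_space sc H0 H1 \<theta> H'" and x: "x \<in> D"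
  shows "nrm H x \<le> nrm H' x"
proof -
  interpret H: geometric_space sc H0 H1 \<theta> H by fact
  interpret H': geometric_space sc H0 H1 \<theta> H' by fact
  define E where "E = (\<lambda>x y. H.h x y - H'.h x y)"
  have "E x x \<le> 0"
  proof (rule A.compatible_form_nonpos[where E = E, OF D_complete A_inj co_inj _ _ x])
    show "compatible_form D ND A E"
      unfolding E_def by (intro A.compatible_form_diff H.compatible_form_h H'.compatible_form_h)
    show "E y y \<le> (ND (A y - sc (of_real r) y))\<^sup>2 / (r * (1 - r))\<^sup>2" if "0 < r" "r < 1" "y \<in> D" for r y
      using geometric_norm_difference[OF H H' that] that by (simp add: E_def H.XH.g_self H'.XH.g_self)
  qed
  then have "(nrm H x)\<^sup>2 \<le> (nrm H' x)\<^sup>2" using x by (simp add: E_def H.XH.g_self H'.XH.g_self)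
  then show ?thesis by (rule power2_le_imp_le) (rule H'.XH.N_nonneg[OF x])
qed

text \<open>Both spaces are completions of \<open>D\<close> inside \<open>\<Sigma>\<close>.\<close>

lemma geometric_subset:
  assumes H: "geometric_space sc H0 H1 \<theta> H" and H': "geometric_space sc H0 H1 \<theta> H'" and x: "x \<in> elems H"
  shows "x \<in> elems H'" "nrm H x = nrm H' x"
proof -
  interpret H: geometric_space sc H0 H1 \<theta> H by fact
  interpret H': geometric_space sc H0 H1 \<theta> H' by fact
  have eq: "nrm H y = nrm H' y" if "y \<in> D" for y
    using geometric_norm_le_on_D[OF H H' that] geometric_norm_le_on_D[OF H' H that] by simp
  have "\<exists>y\<in>D. nrm H (x - y) < 1 / real (Suc n)" for n
    using H.dense_H x unfolding dense_in_space_def by simp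
  then obtain y where y: "\<And>n. y n \<in> D" "\<And>n. nrm H (x - y n) < 1 / real (Suc n)"
    by metis
  have inv: "(\<lambda>n. 1 / real (Suc n)) \<longlonglongrightarrow> 0"
    by (rule LIMSEQ_Suc[OF lim_1_over_n])
  have lim: "(\<lambda>n. nrm H (x - y n)) \<longlonglongrightarrow> 0"
  proof (rule real_tendsto_sandwich[OF _ _ tendsto_const inv])
    show "\<forall>\<^sub>F n in sequentially. 0 \<le> nrm H (x - y n)"
      using x y by (simp add: H.XE.N_nonneg H.XE.S_closed)
    show "\<forall>\<^sub>F n in sequentially. nrm H (x - y n) \<le> 1 / real (Suc n)"
      using y(2) by (simp add: less_imp_le)
  qed
  have "\<exists>M. \<forall>m\<ge>M. \<forall>n\<ge>M. nrm H' (y m - y n) < e" if e: "e > 0" for e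
  proof -
    obtain M where M: "\<And>n. n \<ge> M \<Longrightarrow> nrm H (x - y n) < e / 2"
      using order_tendstoD(2)[OF lim, of "e / 2"] e by (auto simp: eventually_sequentially)
    have "nrm H' (y m - y n) < e" if "m \<ge> M" "n \<ge> M" for m n
    proof -
      have "nrm H' (y m - y n) = nrm H ((x - y n) - (x - y m))"
        using eq[of "y m - y n"] y by (simp add: D_closed)
      also have "\<dots> \<le> nrm H (x - y n) + nrm H (x - y m)"
        using x y by (intro H.XE.N_diff_triangle) (simp_all add: H.XE.S_closed)
      finally show ?thesis using M[OF that(1)] M[OF that(2)] by simp
    qed
    then show ?thesis by blast
  qed
  moreover have "range y \<subseteq> elems H'" using y by auto
  ultimately obtain z where z: "z \<in> elems H'" "(\<lambda>n. nrm H' (y n - z)) \<longlonglongrightarrow> 0"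
    using H'.banach_H unfolding banach_on_def by blast
  obtain C where C: "\<And>u. u \<in> elems H \<Longrightarrow> n\<Sigma> u \<le> C * nrm H u"
    using continuous_inclusion_bounded[OF H.normed_H normed_\<Sigma> H.incl_\<Sigma>] by blast
  obtain C' where C': "\<And>u. u \<in> elems H' \<Longrightarrow> n\<Sigma> u \<le> C' * nrm H' u"
    using continuous_inclusion_bounded[OF H'.normed_H normed_\<Sigma> H'.incl_\<Sigma>] by blast
  have S: "x \<in> \<Sigma>" "z \<in> \<Sigma>" using x z H.incl_\<Sigma> H'.incl_\<Sigma> unfolding continuous_inclusion_def by auto
  \<comment> \<open>The limits \<open>x\<close> in \<open>H\<close> and \<open>z\<close> in
    \<open>H'\<close> of the same sequence are compared in \<Sigma>, into which both spaces embed
    continuously.\<close>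
  have "n\<Sigma> (x - z) \<le> C * nrm H (x - y n) + C' * nrm H' (y n - z)" for n
  proof -
    have yS: "y n \<in> \<Sigma>" using y \<Sigma>I0 by simp
    have "n\<Sigma> ((x - y n) + (y n - z)) \<le> n\<Sigma> (x - y n) + n\<Sigma> (y n - z)"
      using S yS by (intro normed_onD(6)[OF normed_\<Sigma>]) (simp_all add: \<Sigma>_closed)
    then show ?thesis
      using C[of "x - y n"] C'[of "y n - z"] x y z by (simp add: H.XE.S_closed H'.XE.S_closed)
  qed
  moreover have "(\<lambda>n. C * nrm H (x - y n) + C' * nrm H' (y n - z)) \<longlonglongrightarrow> C * 0 + C' * 0"
    by (intro tendsto_intros lim z)
  ultimately have "n\<Sigma> (x - z) \<le> 0" by (intro LIMSEQ_le_const) auto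
  then have xz: "x = z"
    using normed_onD(3,4)[OF normed_\<Sigma> \<Sigma>_closed(3)[OF S]] by simp
  then show "x \<in> elems H'" using z by simp
  have "(\<lambda>n. nrm H (y n)) \<longlonglongrightarrow> nrm H x"
  proof (rule metric_LIMSEQ_I)
    fix r :: real assume "r > 0"
    then obtain M where M: "\<And>n. n \<ge> M \<Longrightarrow> nrm H (x - y n) < r"
      using order_tendstoD(2)[OF lim, of r] by (auto simp: eventually_sequentially)
    have "dist (nrm H (y n)) (nrm H x) \<le> nrm H (x - y n)" for n
      using H.XE.N_reverse_triangle[of x "y n"] x y by (simp add: dist_real_def abs_minus_commute)
    then show "\<exists>no. \<forall>n\<ge>no. dist (nrm H (y n)) (nrm H x) < r" using M by (meson le_less_trans)
  qed
  moreover have "(\<lambda>n. nrm H (y n)) \<longlonglongrightarrow> nrm H' z"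
  proof (rule metric_LIMSEQ_I)
    fix r :: real assume "r > 0"
    then obtain M where M: "\<And>n. n \<ge> M \<Longrightarrow> nrm H' (y n - z) < r"
      using order_tendstoD(2)[OF z(2), of r] by (auto simp: eventually_sequentially)
    have "dist (nrm H (y n)) (nrm H' z) \<le> nrm H' (y n - z)" for n
      using H'.XE.N_reverse_triangle[of "y n" z] z y eq[OF y(1)] by (simp add: dist_real_def)
    then show "\<exists>no. \<forall>n\<ge>no. dist (nrm H (y n)) (nrm H' z) < r" using M by (meson le_less_trans)
  qed
  ultimately show "nrm H x = nrm H' x" using LIMSEQ_unique xz by blast
qed

end

theorem theorem3p5:
  fixes sc :: "complex \<Rightarrow> 'v::ab_group_add \<Rightarrow> 'v"
    and H0 H1 :: "'v nspace"
    and \<theta> :: real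
  assumes "compatible_pair sc H0 H1"
    and "0 < \<theta>" and "\<theta> < 1"
  shows "geometric_interpolation_space TYPE('h::ab_group_add) sc H0 H1 \<theta> (K_space H0 H1 \<theta>) \<and>
         (\<forall>H. geometric_interpolation_space TYPE('v) sc H0 H1 \<theta> H \<longrightarrow>
              same_space H (K_space H0 H1 \<theta>))"
proof -
  interpret vector_space sc
    using assms(1) by (simp add: compatible_pair_def banach_on_def normed_on_def)
  interpret hilbert_pair_exponent sc H0 H1 \<theta>
    by unfold_locales (rule assms)+
  have "same_space H (K_space H0 H1 \<theta>)"
    if "geometric_interpolation_space TYPE('v) sc H0 H1 \<theta> H" for H
  proof -
    \<comment> \<open>The K-space is geometric for auxiliary spaces in any type, so it may be taken
      at the ambient type and compared with \<open>H\<close> in both directions.\<close>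
    have H: "geometric_space sc H0 H1 \<theta> H" and K: "geometric_space sc H0 H1 \<theta> (K_space H0 H1 \<theta>)"
      by unfold_locales (rule that geometric_K)+
    show ?thesis
      unfolding same_space_def using geometric_subset[OF H K] geometric_subset[OF K H] by auto
  qed
  then show ?thesis using geometric_K by blast
qed

end
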